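(* Let $k$ be a field of characteristic zero, let $D=k[d_1,\dots,d_n]$, and let $M$ be the $D$-module defined by a linear system of partial differential equations with constant coefficients in $k$ which is involutive of order $q$, in solved form, with respect to $d_1,\dots,d_n$ (in this ordering). If $cd_D(M)=r$, then there is an exact sequence $$0\longrightarrow t_r(M)\longrightarrow M\longrightarrow k(\chi_1,\dots,\chi_{n-r})\otimes M ,$$ where the first map is the inclusion and the second map is the canonical localization map $x\mapsto 1\otimes x$.
   Context: Here $D=k[d_1,\dots,d_n]$ is the (commutative) polynomial ring in $n$ commuting formal derivatives $d_i$, where $k$ is a field of constants; it is identified with $k[\chi_1,\dots,\chi_n]$ by $d_i\leftrightarrow\chi_i$. For $0\le r\le n$, $k(\chi_1,\dots,\chi_{n-r})\otimes M$ denotes the partial localization of $M$, i.e. the tensor product over $k[\chi_1,\dots,\chi_{n-r}]\simeq k[d_1,\dots,d_{n-r}]$ of $M$ with the field of fractions $k(\chi_1,\dots,\chi_{n-r})$ (for $r=n$ this is just $M$). Module defined by a system: let $Dy=Dy^1+\dots+Dy^m\simeq D^m$ be free with basis $y^1,\dots,y^m$ and write $y^k_\mu=d_\mu y^k$ (jets). A system of order $q$ is a finite family $\Phi^\tau\equiv\sum_{k}\sum_{0\le|\mu|\le q}a^{\tau\mu}_k y^k_\mu=0$ with $a^{\tau\mu}_k\in k$, and it defines $M=Dy/D\Phi$, where $D\Phi$ is the submodule generated by the $\Phi^\tau$. Involution: a multi-index $\mu=(\mu_1,\dots,\mu_n)$ (and the jet $y^k_\mu$) is of class $i$ if $\mu_1=\dots=\mu_{i-1}=0$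 and $\mu_i\neq0$. After a linear change of the derivations $d_1,\dots,d_n$ if necessary, one solves the equations of order $q$ for the maximum possible number of jets of order $q$ and class $n$, then the remaining ones for the maximum number of jets of class $n-1$, and so on down to class $1$ (solved form); an equation solved for a jet of class $i$ is called an equation of class $i$. For an equation of order $q$ and class $i$, $d_1,\dots,d_i$ are called multiplicative and $d_{i+1},\dots,d_n$ nonmultiplicative; for an equation of order $\le q-1$ all of $d_1,\dots,d_n$ are nonmultiplicative. The system is involutive if each prolongation $d_j\Phi^\tau$ with respect to a nonmultiplicative $d_j$ is a linear combination over $k$ of the equations of the system and of their prolongations with respect to multiplicative derivations. Codimension: for a nonzero finitely generated $D$-module $N$, $cd_D(N)=n-d(N)$, where $d(N)$ is the (Krull) dimension of $D/\mathrm{ann}_D(N)$, equivalently the dimension of the characteristic variety of $N$; the zero module is regarded as having codimension greater than every $r$. For $0\le r\le n$, $t_r(M)=\{m\in M\mid cd_D(Dm)>r\}$; it is zero or the greatest $D$-submodule of $M$ of codimension $>r$. *)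

theory Defs
  imports
    "HOL-Library.Poly_Mapping"
    "HOL-Library.Extended_Nat"
    "HOL-Computational_Algebra.Fraction_Field"
    "HOL-Algebra.Module"
    "HOL-Algebra.QuotRing"
begin

section \<open>Modules over a commutative ring\<close>

text \<open>The fields \<open>mult\<close> and \<open>one\<close> inherited from the ring record play no role in a module
  and are left undefined.\<close>

definition free_module :: "('a, 'x) ring_scheme \<Rightarrow> 'i set \<Rightarrow> ('a, 'i \<Rightarrow> 'a) module" where
  "free_module R I =
    \<lparr>carrier = {v. (\<forall>i. v i \<in> carrier R) \<and> finite {i. v i \<noteq> \<zero>\<^bsub>R\<^esub>} \<and> {i. v i \<noteq> \<zero>\<^bsub>R\<^esub>} \<subseteq> I},
     mult = undefined, one = undefined, zero = (\<lambda>i. \<zero>\<^bsub>R\<^esub>),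
     add = (\<lambda>u v i. u i \<oplus>\<^bsub>R\<^esub> v i), smult = (\<lambda>a v i. a \<otimes>\<^bsub>R\<^esub> v i)\<rparr>"

definition basis_vector :: "('a, 'x) ring_scheme \<Rightarrow> 'i \<Rightarrow> 'i \<Rightarrow> 'a" where
  "basis_vector R i = (\<lambda>j. if j = i then \<one>\<^bsub>R\<^esub> else \<zero>\<^bsub>R\<^esub>)"

definition generated_submodule ::
    "('a, 'x) ring_scheme \<Rightarrow> ('a, 'b, 'y) module_scheme \<Rightarrow> 'b set \<Rightarrow> 'b set" where
  "generated_submodule R M X = \<Inter>{N. submodule N R M \<and> X \<subseteq> N}"

definition quotient_module ::
    "('a, 'b, 'y) module_scheme \<Rightarrow> 'b set \<Rightarrow> ('a, 'b set) module" where
  "quotient_module M N =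
    \<lparr>carrier = a_rcosets\<^bsub>M\<^esub> N, mult = undefined, one = undefined, zero = N, add = set_add M,
     smult = (\<lambda>a X. \<Union>x\<in>X. N +>\<^bsub>M\<^esub> (a \<odot>\<^bsub>M\<^esub> x))\<rparr>"

definition module_maps ::
    "('a, 'x) ring_scheme \<Rightarrow> ('a, 'b, 'y) module_scheme \<Rightarrow> ('a, 'c, 'z) module_scheme
      \<Rightarrow> ('b \<Rightarrow> 'c) set" where
  "module_maps R M N =
    {f \<in> carrier M \<rightarrow> carrier N.
       (\<forall>x\<in>carrier M. \<forall>y\<in>carrier M. f (x \<oplus>\<^bsub>M\<^esub> y) = f x \<oplus>\<^bsub>N\<^esub> f y) \<and>
       (\<forall>a\<in>carrier R. \<forall>x\<in>carrier M. f (a \<odot>\<^bsub>M\<^esub> x) = a \<odot>\<^bsub>N\<^esub> f x)}"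

text \<open>Exactness of \<open>0 \<longrightarrow> L \<longrightarrow> M \<longrightarrow> N\<close> with maps \<open>f\<close> and \<open>g\<close>.  The sequences of the library theory
  \<open>Exact_Sequence\<close> require all groups to live on the same type.\<close>

definition left_exact ::
    "('a, 'x) ring_scheme \<Rightarrow> ('a, 'b, 'u) module_scheme \<Rightarrow> ('b \<Rightarrow> 'c)
      \<Rightarrow> ('a, 'c, 'v) module_scheme \<Rightarrow> ('c \<Rightarrow> 'd) \<Rightarrow> ('a, 'd, 'w) module_scheme \<Rightarrow> bool" where
  "left_exact R L f M g N \<longleftrightarrow>
    module R L \<and> module R M \<and> module R N \<and> f \<in> module_maps R L M \<and> g \<in> module_maps R M N \<and>
    a_kernel L M f = {\<zero>\<^bsub>L\<^esub>} \<and> f ` carrier L = a_kernel M N g"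


section \<open>Tensor products\<close>

text \<open>The tensor product of \<open>M\<close> and \<open>N\<close> over \<open>R\<close> is the free \<open>R\<close>-module on the set
  \<open>carrier M \<times> carrier N\<close> modulo the submodule generated by the bilinearity relations.\<close>

definition tensor_free ::
    "('a, 'x) ring_scheme \<Rightarrow> ('a, 'b, 'y) module_scheme \<Rightarrow> ('a, 'c, 'z) module_scheme
      \<Rightarrow> ('a, 'b \<times> 'c \<Rightarrow> 'a) module" where
  "tensor_free R M N = free_module R (carrier M \<times> carrier N)"

definition tensor_relations ::
    "('a, 'x) ring_scheme \<Rightarrow> ('a, 'b, 'y) module_scheme \<Rightarrow> ('a, 'c, 'z) module_scheme
      \<Rightarrow> ('b \<times> 'c \<Rightarrow> 'a) set" where
  "tensor_relations R M N =
    (let F = tensor_free R M N; e = basis_vector R in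
     generated_submodule R F
      ({e (x \<oplus>\<^bsub>M\<^esub> x', y) \<ominus>\<^bsub>F\<^esub> (e (x, y) \<oplus>\<^bsub>F\<^esub> e (x', y)) | x x' y.
          x \<in> carrier M \<and> x' \<in> carrier M \<and> y \<in> carrier N} \<union>
       {e (x, y \<oplus>\<^bsub>N\<^esub> y') \<ominus>\<^bsub>F\<^esub> (e (x, y) \<oplus>\<^bsub>F\<^esub> e (x, y')) | x y y'.
          x \<in> carrier M \<and> y \<in> carrier N \<and> y' \<in> carrier N} \<union>
       {e (a \<odot>\<^bsub>M\<^esub> x, y) \<ominus>\<^bsub>F\<^esub> (a \<odot>\<^bsub>F\<^esub> e (x, y)) | a x y.
          a \<in> carrier R \<and> x \<in> carrier M \<and> y \<in> carrier N} \<union>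
       {e (x, a \<odot>\<^bsub>N\<^esub> y) \<ominus>\<^bsub>F\<^esub> (a \<odot>\<^bsub>F\<^esub> e (x, y)) | a x y.
          a \<in> carrier R \<and> x \<in> carrier M \<and> y \<in> carrier N}))"

definition tensor_product ::
    "('a, 'x) ring_scheme \<Rightarrow> ('a, 'b, 'y) module_scheme \<Rightarrow> ('a, 'c, 'z) module_scheme
      \<Rightarrow> ('a, ('b \<times> 'c \<Rightarrow> 'a) set) module" where
  "tensor_product R M N = quotient_module (tensor_free R M N) (tensor_relations R M N)"

definition pure_tensor ::
    "('a, 'x) ring_scheme \<Rightarrow> ('a, 'b, 'y) module_scheme \<Rightarrow> ('a, 'c, 'z) module_scheme
      \<Rightarrow> 'b \<Rightarrow> 'c \<Rightarrow> ('b \<times> 'c \<Rightarrow> 'a) set" where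
  "pure_tensor R M N x y = tensor_relations R M N +>\<^bsub>tensor_free R M N\<^esub> basis_vector R (x, y)"


section \<open>The ring of differential operators and its fraction fields\<close>

text \<open>A multi-index is a finitely supported function on \<open>nat\<close>; the variables are numbered from 1
  as usual, so index 0 never occurs.  \<open>poly_ring s\<close> is the subring \<open>k[d\<^sub>1,\<dots>,d\<^sub>s]\<close> of the ring
  of polynomials in countably many variables, hence all the rings \<open>k[d\<^sub>1,\<dots>,d\<^sub>s]\<close> for \<open>s \<le> n\<close> are
  subrings of \<open>D = poly_ring n\<close>, and \<open>poly_ring 0\<close> is the field \<open>k\<close> of constants.\<close>

type_synonym multi_index = "nat \<Rightarrow>\<^sub>0 nat"

type_synonym 'k mpoly = "multi_index \<Rightarrow>\<^sub>0 'k"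

definition poly_ring :: "nat \<Rightarrow> 'k::field mpoly ring" where
  "poly_ring s =
    \<lparr>carrier = {p. \<forall>\<mu>\<in>Poly_Mapping.keys p. Poly_Mapping.keys \<mu> \<subseteq> {1..s}},
     mult = (*), one = 1, zero = 0, add = (+)\<rparr>"

definition deriv_var :: "nat \<Rightarrow> 'k::field mpoly" where
  "deriv_var i = Poly_Mapping.single (Poly_Mapping.single i 1) 1"

text \<open>\<open>k(\<chi>\<^sub>1,\<dots>,\<chi>\<^sub>s)\<close> as a module over \<open>k[\<chi>\<^sub>1,\<dots>,\<chi>\<^sub>s]\<close>.\<close>

definition rational_functions :: "nat \<Rightarrow> ('k::field mpoly, 'k mpoly fract) module" where
  "rational_functions s =
    \<lparr>carrier = {Fract a b | a b. a \<in> carrier (poly_ring s) \<and> b \<in> carrier (poly_ring s) \<and> b \<noteq> 0},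
     mult = (*), one = 1, zero = 0, add = (+), smult = (\<lambda>a x. Fract a 1 * x)\<rparr>"

definition partial_localization ::
    "nat \<Rightarrow> ('k::field mpoly, 'b, 'y) module_scheme
      \<Rightarrow> ('k mpoly, ('k mpoly fract \<times> 'b \<Rightarrow> 'k mpoly) set) module" where
  "partial_localization s M = tensor_product (poly_ring s) (rational_functions s) M"

definition localization_map ::
    "nat \<Rightarrow> ('k::field mpoly, 'b, 'y) module_scheme
      \<Rightarrow> 'b \<Rightarrow> ('k mpoly fract \<times> 'b \<Rightarrow> 'k mpoly) set" where
  "localization_map s M x = pure_tensor (poly_ring s) (rational_functions s) M 1 x"


section \<open>Codimension and the torsion submodules\<close>

definition krull_dim :: "('a, 'x) ring_scheme \<Rightarrow> enat" where
  "krull_dim R =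
    Sup {enat l | l. \<exists>P. (\<forall>i\<le>l. primeideal (P i) R) \<and> (\<forall>i<l. P i \<subset> P (Suc i))}"

definition annihilator :: "('a, 'x) ring_scheme \<Rightarrow> ('a, 'b, 'y) module_scheme \<Rightarrow> 'a set" where
  "annihilator R M = {a \<in> carrier R. \<forall>x\<in>carrier M. a \<odot>\<^bsub>M\<^esub> x = \<zero>\<^bsub>M\<^esub>}"

text \<open>The subtraction is not truncated, since a quotient of \<open>poly_ring n\<close> has dimension at
  most \<open>n\<close>.\<close>

definition codim :: "nat \<Rightarrow> ('k::field mpoly, 'b, 'y) module_scheme \<Rightarrow> enat" where
  "codim n N =
    (if carrier N = {\<zero>\<^bsub>N\<^esub>} then \<infinity>
     else enat n - krull_dim (poly_ring n Quot annihilator (poly_ring n) N))"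

definition cyclic_submodule ::
    "('a, 'x) ring_scheme \<Rightarrow> ('a, 'b, 'y) module_scheme \<Rightarrow> 'b \<Rightarrow> 'b set" where
  "cyclic_submodule R M x = {a \<odot>\<^bsub>M\<^esub> x | a. a \<in> carrier R}"

definition torsion :: "nat \<Rightarrow> nat \<Rightarrow> ('k::field mpoly, 'b, 'y) module_scheme \<Rightarrow> 'b set" where
  "torsion n r M =
    {x \<in> carrier M. codim n (M\<lparr>carrier := cyclic_submodule (poly_ring n) M x\<rparr>) > enat r}"


section \<open>Linear systems with constant coefficients\<close>

text \<open>\<open>jet_space n m\<close> is \<open>D y\<^sup>1 + \<dots> + D y\<^sup>m\<close>.  An element \<open>\<Phi>\<close> of it is the equation whose
  coefficient at the jet \<open>y\<^sup>k\<^sub>\<mu>\<close>, represented by the pair \<open>(k, \<mu>)\<close>,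
  is the coefficient of the monomial \<open>\<mu>\<close> in the polynomial \<open>\<Phi> k\<close>.\<close>

type_synonym 'k equation = "nat \<Rightarrow> 'k mpoly"

type_synonym jet = "nat \<times> multi_index"

definition jet_space :: "nat \<Rightarrow> nat \<Rightarrow> ('k::field mpoly, 'k equation) module" where
  "jet_space n m = free_module (poly_ring n) {1..m}"

definition jet_coeff :: "'k::field equation \<Rightarrow> jet \<Rightarrow> 'k" where
  "jet_coeff \<Phi> y = Poly_Mapping.lookup (\<Phi> (fst y)) (snd y)"

definition jet_order :: "jet \<Rightarrow> nat" where
  "jet_order y = (\<Sum>i\<in>Poly_Mapping.keys (snd y). Poly_Mapping.lookup (snd y) i)"

definition jet_of_class :: "nat \<Rightarrow> jet \<Rightarrow> bool" where
  "jet_of_class i y \<longleftrightarrow>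
    (\<forall>j\<in>{1..<i}. Poly_Mapping.lookup (snd y) j = 0) \<and> Poly_Mapping.lookup (snd y) i \<noteq> 0"

definition jets :: "nat \<Rightarrow> nat \<Rightarrow> nat \<Rightarrow> nat \<Rightarrow> jet set" where
  "jets n m q i =
    {(k, \<mu>). k \<in> {1..m} \<and> Poly_Mapping.keys \<mu> \<subseteq> {1..n} \<and>
       jet_order (k, \<mu>) = q \<and> jet_of_class i (k, \<mu>)}"

definition linear_system :: "nat \<Rightarrow> nat \<Rightarrow> nat \<Rightarrow> 'k::field equation set \<Rightarrow> bool" where
  "linear_system n m q S \<longleftrightarrow>
    finite S \<and> S \<subseteq> carrier (jet_space n m) \<and>
    (\<forall>\<Phi>\<in>S. \<forall>y. jet_coeff \<Phi> y \<noteq> 0 \<longrightarrow> jet_order y \<le> q)"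

definition system_module ::
    "nat \<Rightarrow> nat \<Rightarrow> 'k::field equation set \<Rightarrow> ('k mpoly, 'k equation set) module" where
  "system_module n m S =
    quotient_module (jet_space n m) (generated_submodule (poly_ring n) (jet_space n m) S)"

text \<open>Linear combinations with coefficients in \<open>k\<close>.\<close>

definition k_span :: "nat \<Rightarrow> nat \<Rightarrow> 'k::field equation set \<Rightarrow> 'k equation set" where
  "k_span n m E = generated_submodule (poly_ring 0) (jet_space n m) E"

text \<open>The equations of order exactly \<open>q\<close> in a system of order \<open>q\<close>.\<close>

definition top_equations :: "nat \<Rightarrow> 'k::field equation set \<Rightarrow> 'k equation set" where
  "top_equations q S = {\<Phi> \<in> S. \<exists>y. jet_order y = q \<and> jet_coeff \<Phi> y \<noteq> 0}"


section \<open>Solved form and involution\<close>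

definition solvable_for :: "nat \<Rightarrow> nat \<Rightarrow> 'k::field equation set \<Rightarrow> jet set \<Rightarrow> bool" where
  "solvable_for n m E J \<longleftrightarrow>
    (\<exists>F. \<forall>y\<in>J. F y \<in> k_span n m E \<and> (\<forall>z\<in>J. jet_coeff (F y) z = (if z = y then 1 else 0)))"

definition equations_of_class ::
    "nat \<Rightarrow> 'k::field equation set \<Rightarrow> ('k equation \<Rightarrow> jet) \<Rightarrow> nat \<Rightarrow> 'k equation set" where
  "equations_of_class q S ld i = {\<Phi> \<in> top_equations q S. jet_of_class i (ld \<Phi>)}"

text \<open>\<open>ld \<Phi>\<close> is the jet for which the equation \<open>\<Phi>\<close> of order \<open>q\<close> is solved (up to division by the
  coefficient of that jet).  The equations of class at most \<open>i\<close> are those that remain after the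
  classes \<open>n, \<dots>, i + 1\<close> have been treated; they are solved for as many jets of class \<open>i\<close> as
  possible, and the jets for which they are solved are eliminated from the other ones.  Note
  that equations of class \<open>i\<close> may contain jets of lower class for which other equations are
  solved.\<close>

definition solved_form ::
    "nat \<Rightarrow> nat \<Rightarrow> nat \<Rightarrow> 'k::field equation set \<Rightarrow> ('k equation \<Rightarrow> jet) \<Rightarrow> bool" where
  "solved_form n m q S ld \<longleftrightarrow>
    (\<forall>\<Phi>\<in>top_equations q S. \<exists>i\<in>{1..n}. ld \<Phi> \<in> jets n m q i) \<and>
    (\<forall>i\<in>{1..n}.
      let C = equations_of_class q S ld i; E = (\<Union>j\<in>{1..i}. equations_of_class q S ld j) in
      (\<forall>\<Phi>\<in>E. \<forall>\<Psi>\<in>C. jet_coeff \<Phi> (ld \<Psi>) \<noteq> 0 \<longleftrightarrow> \<Phi> = \<Psi>) \<and>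
      (\<forall>J\<subseteq>jets n m q i. solvable_for n m E J \<longrightarrow> card J \<le> card (ld ` C)))"

definition multiplicative ::
    "nat \<Rightarrow> 'k::field equation set \<Rightarrow> ('k equation \<Rightarrow> jet) \<Rightarrow> 'k equation \<Rightarrow> nat \<Rightarrow> bool" where
  "multiplicative q S ld \<Phi> j \<longleftrightarrow> (\<exists>i. \<Phi> \<in> equations_of_class q S ld i \<and> j \<in> {1..i})"

definition prolongation :: "nat \<Rightarrow> nat \<Rightarrow> nat \<Rightarrow> 'k::field equation \<Rightarrow> 'k equation" where
  "prolongation n m j \<Phi> = deriv_var j \<odot>\<^bsub>jet_space n m\<^esub> \<Phi>"

definition involutive ::
    "nat \<Rightarrow> nat \<Rightarrow> nat \<Rightarrow> 'k::field equation set \<Rightarrow> ('k equation \<Rightarrow> jet) \<Rightarrow> bool" where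
  "involutive n m q S ld \<longleftrightarrow>
    (\<forall>\<Phi>\<in>S. \<forall>j\<in>{1..n}. \<not> multiplicative q S ld \<Phi> j \<longrightarrow>
      prolongation n m j \<Phi> \<in>
        k_span n m (S \<union> {prolongation n m l \<Psi> | \<Psi> l. \<Psi> \<in> S \<and> multiplicative q S ld \<Psi> l}))"

end

theory Submission
  imports Defs "Jordan_Normal_Form.Char_Poly" "HOL-Library.Function_Algebras"
begin

text \<open>Let \<open>t\<close> be the largest class in which some jet of order \<open>q\<close> is not solved for.  Solving
  for all jets of higher class shows that \<open>M\<close> is finitely generated over \<open>A = k[d\<^sub>1,\<dots>,d\<^sub>t]\<close>.
  By involution the multiplicative derivatives of the equations span \<open>D\<Phi>\<close> over \<open>k\<close>, and comparing
  leading jets no multiple by a nonzero element of \<open>A\<close> of an unsolved jet of class \<open>t\<close> lies in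
  \<open>D\<Phi>\<close>; hence \<open>A \<inter> ann(M) = 0\<close>.  Since \<open>D / ann(M)\<close> is integral over \<open>A\<close>, its dimension is \<open>t\<close>,
  so \<open>t = n - r\<close>, and \<open>D / ann(x)\<close> has smaller dimension exactly if \<open>A \<inter> ann(x) \<noteq> 0\<close>.  Thus
  \<open>t\<^sub>r(M)\<close> is the \<open>A\<close>-torsion of \<open>M\<close>, which is the kernel of the localization map.\<close>

section \<open>Polynomial rings\<close>

text \<open>All dimension statements are reduced to lengths of chains of primes. Going up produces
  long chains. The upper bounds rest on one count: if the bottom prime of a chain over ann(Z)
  contains a nonzero element of A, the chain is shorter than t. Indeed t + 1 elements have (p +
  1)^(t + 1) monomials with exponents up to p, while the coordinates of these monomials grow
  linearly in p and fill a space of dimension O(p^t). Applied to a chain without its bottom prime,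
  with incomparability supplying the element of A, the count gives dimension at most t; applied to
  ann(x) it gives the strict drop. On the side of the equations, the obstacle is cancellation
  between derivatives of different equations. It is controlled by cones: shifting a jet of order q
  and class i by monomials in d_1, ..., d_i only, distinct jets have disjoint cones, and the cone of
  an unsolved jet of class t is exactly what A generates from it. Order q = 0 falls outside this
  picture, since a jet of order 0 has no class; there M is free and t = n.\<close>

abbreviation "single \<equiv> Poly_Mapping.single"
abbreviation "keys \<equiv> Poly_Mapping.keys"
abbreviation "lookup \<equiv> Poly_Mapping.lookup"
abbreviation "polys s \<equiv> carrier (poly_ring s)"

lemma poly_ring_simps [simp]:
  "x \<otimes>\<^bsub>poly_ring s\<^esub> y = x * y" "x \<oplus>\<^bsub>poly_ring s\<^esub> y = x + y"
  "\<zero>\<^bsub>poly_ring s\<^esub> = 0" "\<one>\<^bsub>poly_ring s\<^esub> = 1"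
  by (simp_all add: poly_ring_def)

lemma carrier_poly_ring_iff:
  "p \<in> polys s \<longleftrightarrow> (\<forall>\<mu>\<in>keys p. keys \<mu> \<subseteq> {1..s})"
  by (simp add: poly_ring_def)

lemma poly_ring_zero [simp, intro]: "0 \<in> polys s"
  by (simp add: carrier_poly_ring_iff)

lemma poly_ring_one [simp, intro]: "1 \<in> polys s"
  by (simp add: carrier_poly_ring_iff)

lemma poly_ring_add [simp, intro]:
  "p \<in> polys s \<Longrightarrow> q \<in> polys s \<Longrightarrow> p + q \<in> polys s"
  using Poly_Mapping.keys_add[of p q] unfolding carrier_poly_ring_iff by blast

lemma keys_uminus_mpoly: "keys (- p) = keys (p :: 'k::field mpoly)"
  by (auto simp: in_keys_iff)

lemma poly_ring_uminus [simp, intro]: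
  "p \<in> polys s \<Longrightarrow> - p \<in> polys s"
  by (simp add: carrier_poly_ring_iff keys_uminus_mpoly)

lemma poly_ring_diff [simp, intro]:
  "p \<in> polys s \<Longrightarrow> q \<in> polys s \<Longrightarrow> p - q \<in> polys s"
  using poly_ring_add[of p s "- q"] by simp

lemma poly_ring_mult [simp, intro]:
  assumes "p \<in> polys s" "q \<in> polys s"
  shows "p * q \<in> polys s"
  unfolding carrier_poly_ring_iff
proof
  fix \<mu> assume "\<mu> \<in> keys (p * q)"
  then obtain a b where "\<mu> = a + b" "a \<in> keys p" "b \<in> keys q"
    using Poly_Mapping.keys_mult[of p q] by blast
  then show "keys \<mu> \<subseteq> {1..s}"
    using assms Poly_Mapping.keys_add[of a b] unfolding carrier_poly_ring_iff by blast
qed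

lemma poly_ring_sum [intro]:
  "(\<And>i. i \<in> I \<Longrightarrow> f i \<in> polys s) \<Longrightarrow> sum f I \<in> polys s"
  by (induction I rule: infinite_finite_induct) auto

lemma poly_ring_power [simp, intro]:
  "p \<in> polys s \<Longrightarrow> p ^ i \<in> polys s"
  by (induction i) auto

lemma poly_ring_single [simp, intro]:
  "keys \<mu> \<subseteq> {1..s} \<Longrightarrow> single \<mu> c \<in> polys s"
  by (simp add: carrier_poly_ring_iff)

lemma poly_ring_deriv_var [simp, intro]:
  "1 \<le> j \<Longrightarrow> j \<le> s \<Longrightarrow> deriv_var j \<in> polys s"
  by (simp add: deriv_var_def)

lemma poly_ring_mono:
  "s \<le> t \<Longrightarrow> p \<in> polys s \<Longrightarrow> p \<in> polys t"
  unfolding carrier_poly_ring_iff by fastforce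

lemma deriv_var_nonzero [simp]: "deriv_var j \<noteq> (0 :: 'k::field mpoly)"
proof -
  have "keys (deriv_var j :: 'k mpoly) \<noteq> {}"
    unfolding deriv_var_def by simp
  then show ?thesis by (metis Poly_Mapping.keys_zero)
qed

lemma cring_poly_ring: "cring (poly_ring s :: 'k::field mpoly ring)"
proof (rule cringI)
  show "abelian_group (poly_ring s :: 'k mpoly ring)"
  proof (rule abelian_groupI)
    fix x :: "'k mpoly" assume "x \<in> polys s"
    then show "\<exists>y\<in>polys s. y \<oplus>\<^bsub>poly_ring s\<^esub> x = \<zero>\<^bsub>poly_ring s\<^esub>"
      by (intro bexI[of _ "- x"]) auto
  qed (auto simp: algebra_simps)
  show "Group.comm_monoid (poly_ring s :: 'k mpoly ring)"
    by (rule comm_monoidI) (auto simp: algebra_simps)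
qed (auto simp: algebra_simps)

lemma poly_ring_a_inv [simp]:
  assumes "p \<in> polys s" shows "\<ominus>\<^bsub>poly_ring s\<^esub> p = - p"
proof -
  interpret cring "poly_ring s" by (rule cring_poly_ring)
  show ?thesis using minus_equality[of "- p" p] assms by simp
qed

lemma mpoly_sum_monomials:
  "p = (\<Sum>\<mu>\<in>keys p. single \<mu> (lookup p \<mu>))"
  for p :: "'k::field mpoly"
  by (rule poly_mapping_eqI)
    (auto simp: lookup_sum lookup_single when_def in_keys_iff)

lemma poly_mapping_nonzero_key:
  assumes "p \<noteq> 0" obtains k where "k \<in> keys p"
  using assms by (metis all_not_in_conv in_keys_iff lookup_zero poly_mapping_eqI)

lemma multi_index_split:
  fixes \<mu> :: multi_index
  assumes "i \<in> keys \<mu>"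
  obtains \<nu> where "\<mu> = single i 1 + \<nu>" "keys \<nu> \<subseteq> keys \<mu>"
proof
  show "\<mu> = single i 1 + (\<mu> - single i 1)"
    using assms by (intro poly_mapping_eqI)
      (auto simp: lookup_add lookup_minus lookup_single when_def in_keys_iff)
  show "keys (\<mu> - single i 1) \<subseteq> keys \<mu>"
    by (auto simp: in_keys_iff lookup_minus)
qed

text \<open>Division with remainder by the last variable: monomials containing it go into
  \<open>c1\<close>, the others into \<open>c0\<close>. In the chain construction it replaces
  coefficients by their residues modulo that variable.\<close>

lemma poly_ring_decomp:
  fixes c :: "'k::field mpoly"
  assumes "c \<in> polys (Suc s)"
  obtains c0 c1 where "c0 \<in> polys s" "c1 \<in> polys (Suc s)"
    "c = c0 + deriv_var (Suc s) * c1"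
proof -
  let ?P = "\<lambda>c. \<exists>c0\<in>polys s. \<exists>c1\<in>polys (Suc s).
              c = c0 + deriv_var (Suc s) * (c1 :: 'k mpoly)"
  have sum: "?P (sum f I)" if "\<And>i. i \<in> I \<Longrightarrow> ?P (f i)" for f and I :: "multi_index set"
    using that
  proof (induction I rule: infinite_finite_induct)
    case (insert x F)
    then obtain a0 a1 b0 b1 where *: "a0 \<in> polys s" "b0 \<in> polys s"
      "a1 \<in> polys (Suc s)" "b1 \<in> polys (Suc s)"
      "f x = a0 + deriv_var (Suc s) * a1" "sum f F = b0 + deriv_var (Suc s) * b1"
      by (metis insertCI)
    then have "sum f (insert x F) = (a0 + b0) + deriv_var (Suc s) * (a1 + b1)"
      using insert by (simp add: algebra_simps)
    then show ?case using * by (metis poly_ring_add)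
  qed (rule bexI[of _ 0], rule bexI[of _ 0], auto)+
  have "?P (single \<mu> a)" if mu: "keys \<mu> \<subseteq> {1..Suc s}" for \<mu> and a :: 'k
  proof (cases "Suc s \<in> keys \<mu>")
    case True
    then obtain \<nu> where mu_eq: "\<mu> = single (Suc s) 1 + \<nu>"
      and "keys \<nu> \<subseteq> keys \<mu>" using multi_index_split by blast
    then have "single \<nu> a \<in> polys (Suc s)" using mu by auto
    moreover have "single \<mu> a = 0 + deriv_var (Suc s) * single \<nu> a"
      by (simp add: deriv_var_def mult_single mu_eq)
    ultimately show ?thesis by blast
  next
    case False
    then have "keys \<mu> \<subseteq> {1..s}" using mu by (auto simp: le_Suc_eq)
    then show ?thesis
      by (intro bexI[of _ "single \<mu> a"] bexI[of _ 0]) auto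
  qed
  then have "?P (\<Sum>\<mu>\<in>keys c. single \<mu> (lookup c \<mu>))"
    using assms by (intro sum) (auto simp: carrier_poly_ring_iff)
  then have "?P c" using mpoly_sum_monomials[of c] by simp
  with that show thesis by blast
qed

text \<open>Every monomial of a multiple of the last variable contains that variable, so such a
  multiple can lie in the smaller ring only as 0.\<close>

lemma deriv_var_mult_in_smaller:
  fixes h :: "'k::field mpoly"
  assumes "deriv_var (Suc s) * h \<in> polys s"
  shows "h = 0"
proof (rule ccontr)
  assume "h \<noteq> 0"
  then have "deriv_var (Suc s) * h \<noteq> 0" by simp
  then obtain \<mu> where mu: "\<mu> \<in> keys (deriv_var (Suc s) * h)"
    by (rule poly_mapping_nonzero_key)
  then obtain \<nu> where "\<mu> = single (Suc s) 1 + \<nu>"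
    using Poly_Mapping.keys_mult[of "deriv_var (Suc s)" h]
    by (auto simp: deriv_var_def split: if_splits)
  then have "Suc s \<in> keys \<mu>"
    by (simp add: in_keys_iff lookup_add)
  moreover have "keys \<mu> \<subseteq> {1..s}"
    using assms mu by (auto simp: carrier_poly_ring_iff)
  ultimately show False by auto
qed

section \<open>Ideals of polynomial rings and chains of primes\<close>

text \<open>Negatives come from multiplication by -1, which reduces ideals to closure conditions in
  the type-class operations.\<close>

lemma ideal_poly_ring_iff:
  "ideal J (poly_ring n :: 'k::field mpoly ring) \<longleftrightarrow>
    J \<subseteq> polys n \<and> 0 \<in> J \<and> (\<forall>a\<in>J. \<forall>b\<in>J. a + b \<in> J) \<and>
    (\<forall>x\<in>polys n. \<forall>a\<in>J. x * a \<in> J)" (is "?l \<longleftrightarrow> ?r")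
proof
  assume ?l
  then interpret ideal J "poly_ring n :: 'k mpoly ring" .
  show ?r
    using a_subset additive_subgroup.zero_closed[OF additive_subgroup_axioms]
      additive_subgroup.a_closed[OF additive_subgroup_axioms] I_l_closed by auto
next
  assume r: ?r
  interpret cring "poly_ring n :: 'k mpoly ring" by (rule cring_poly_ring)
  have rmult: "a * x \<in> J" if "x \<in> polys n" "a \<in> J" for x a
    using r that by (subst mult.commute) blast
  show ?l
  proof (rule idealI)
    show "subgroup J (add_monoid (poly_ring n))"
    proof (rule add.subgroupI)
      fix a assume a: "a \<in> J"
      then have "(- 1) * a \<in> J" using r by blast
      then show "\<ominus>\<^bsub>poly_ring n\<^esub> a \<in> J" using a r by auto
    qed (use r in auto)
  qed (use r rmult ring_axioms in auto)
qed

lemma primeideal_poly_ring_iff: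
  "primeideal J (poly_ring n :: 'k::field mpoly ring) \<longleftrightarrow>
    ideal J (poly_ring n) \<and> 1 \<notin> J \<and>
    (\<forall>a\<in>polys n. \<forall>b\<in>polys n. a * b \<in> J \<longrightarrow> a \<in> J \<or> b \<in> J)"
    (is "?l \<longleftrightarrow> ?r")
proof
  assume l: ?l
  then interpret primeideal J "poly_ring n :: 'k mpoly ring" .
  show ?r using I_prime I_notcarr one_imp_carrier by (auto intro: is_ideal)
next
  assume r: ?r
  then show ?l
    by (intro primeidealI) (auto simp: cring_poly_ring)
qed

lemma ideal_poly_ring_closed:
  assumes "ideal J (poly_ring n :: 'k::field mpoly ring)"
  shows "J \<subseteq> polys n" "0 \<in> J"
    "a \<in> J \<Longrightarrow> b \<in> J \<Longrightarrow> a + b \<in> J"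
    "x \<in> polys n \<Longrightarrow> a \<in> J \<Longrightarrow> x * a \<in> J"
    "x \<in> polys n \<Longrightarrow> a \<in> J \<Longrightarrow> a * x \<in> J"
    "a \<in> J \<Longrightarrow> - a \<in> J"
    "a \<in> J \<Longrightarrow> b \<in> J \<Longrightarrow> a - b \<in> J"
proof -
  have *: "J \<subseteq> polys n" "0 \<in> J" "\<And>a b. a \<in> J \<Longrightarrow> b \<in> J \<Longrightarrow> a + b \<in> J"
    "\<And>x a. x \<in> polys n \<Longrightarrow> a \<in> J \<Longrightarrow> x * a \<in> J"
    using assms unfolding ideal_poly_ring_iff by auto
  have neg: "- a \<in> J" if "a \<in> J" for a
    using *(4)[of "- 1" a] that by simp
  show "J \<subseteq> polys n" "0 \<in> J"
    "a \<in> J \<Longrightarrow> b \<in> J \<Longrightarrow> a + b \<in> J"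
    "x \<in> polys n \<Longrightarrow> a \<in> J \<Longrightarrow> x * a \<in> J"
    "x \<in> polys n \<Longrightarrow> a \<in> J \<Longrightarrow> a * x \<in> J"
    "a \<in> J \<Longrightarrow> - a \<in> J" "a \<in> J \<Longrightarrow> b \<in> J \<Longrightarrow> a - b \<in> J"
    using * neg *(3)[of a "- b"] by (auto simp: mult.commute[of a x])
qed

lemma ideal_poly_ring_sum:
  assumes "ideal J (poly_ring n :: 'k::field mpoly ring)" "\<And>i. i \<in> I \<Longrightarrow> f i \<in> J"
  shows "sum f I \<in> J"
  using assms(2) by (induction I rule: infinite_finite_induct)
    (auto intro: ideal_poly_ring_closed[OF assms(1)])

lemma ideal_poly_ring_power_diff:
  assumes "ideal J (poly_ring n :: 'k::field mpoly ring)"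
    "x \<in> polys n" "y \<in> polys n" "x - y \<in> J"
  shows "x ^ i - y ^ i \<in> J"
proof (induction i)
  case (Suc i)
  have "x ^ Suc i - y ^ Suc i = x * (x ^ i - y ^ i) + (x - y) * y ^ i"
    by (simp add: algebra_simps)
  also have "\<dots> \<in> J"
    by (rule ideal_poly_ring_closed(3)[OF assms(1) ideal_poly_ring_closed(4)[OF assms(1)]
          ideal_poly_ring_closed(5)[OF assms(1)]]) (use Suc assms in auto)
  finally show ?case .
qed (use ideal_poly_ring_closed[OF assms(1)] in auto)

section \<open>Ideals disjoint from a multiplicative set\<close>

lemma ideal_add_principal:
  assumes J: "ideal J (poly_ring n :: 'k::field mpoly ring)" and d: "d \<in> polys n"
  shows "ideal {p + d * f | p f. p \<in> J \<and> f \<in> polys n} (poly_ring n)" (is "ideal ?I _")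
    and "J \<subseteq> {p + d * f | p f. p \<in> J \<and> f \<in> polys n}"
    and "d \<in> {p + d * f | p f. p \<in> J \<and> f \<in> polys n}"
proof -
  note cl = ideal_poly_ring_closed[OF J]
  show "ideal ?I (poly_ring n)"
    unfolding ideal_poly_ring_iff
  proof (intro conjI ballI)
    show "?I \<subseteq> polys n" using cl(1) d by auto
    have "(0 :: 'k mpoly) = 0 + d * 0" by simp
    then show "0 \<in> ?I" using cl(2) by blast
  next
    fix a b assume "a \<in> ?I" "b \<in> ?I"
    then obtain p f q g where *: "a = p + d * f" "p \<in> J" "f \<in> polys n"
      "b = q + d * g" "q \<in> J" "g \<in> polys n" by auto
    then have "a + b = (p + q) + d * (f + g)" by (simp add: algebra_simps)
    then show "a + b \<in> ?I" using * cl(3) by blast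
  next
    fix x a :: "'k mpoly" assume x: "x \<in> polys n" and "a \<in> ?I"
    then obtain p f where *: "a = p + d * f" "p \<in> J" "f \<in> polys n" by auto
    then have "x * a = x * p + d * (x * f)" by (simp add: algebra_simps)
    then show "x * a \<in> ?I" using * x cl(4) by blast
  qed
  show "J \<subseteq> ?I"
  proof
    fix p assume "p \<in> J"
    then show "p \<in> ?I" by (intro CollectI exI[of _ p] exI[of _ 0]) auto
  qed
  show "d \<in> ?I"
    using cl(2) by (intro CollectI exI[of _ 0] exI[of _ 1]) auto
qed

text \<open>Krull's argument: an ideal that is maximal among those containing \<open>J\<close> and
  disjoint from the multiplicative set \<open>S\<close> is prime. It supplies primes lying over zero
  (\<open>S\<close> the nonzero elements of a subring) and primes over a proper ideal
  (\<open>S = {1}\<close>).\<close>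

lemma exists_prime_avoiding:
  assumes J: "ideal J (poly_ring n :: 'k::field mpoly ring)"
    and S: "S \<subseteq> polys n" "1 \<in> S" "\<And>a b. a \<in> S \<Longrightarrow> b \<in> S \<Longrightarrow> a * b \<in> S"
    and disj: "J \<inter> S = {}"
  obtains P where "primeideal P (poly_ring n)" "J \<subseteq> P" "P \<inter> S = {}"
proof -
  let ?A = "{I. ideal I (poly_ring n) \<and> J \<subseteq> I \<and> I \<inter> S = {}}"
  have "\<exists>M\<in>?A. \<forall>X\<in>?A. M \<subseteq> X \<longrightarrow> X = M"
  proof (rule subset_Zorn_nonempty)
    show "?A \<noteq> {}" using J disj by blast
    fix C assume C: "C \<noteq> {}" "subset.chain ?A C"
    then have CA: "C \<subseteq> ?A" and tot: "\<And>X Y. X \<in> C \<Longrightarrow> Y \<in> C \<Longrightarrow> X \<subseteq> Y \<or> Y \<subseteq> X"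
      by (auto simp: subset_chain_def)
    have id: "ideal X (poly_ring n)" if "X \<in> C" for X using that CA by blast
    have "ideal (\<Union>C) (poly_ring n)"
      unfolding ideal_poly_ring_iff
    proof (intro conjI ballI)
      show "\<Union>C \<subseteq> polys n" using ideal_poly_ring_closed(1)[OF id] by blast
      show "0 \<in> \<Union>C" using C(1) ideal_poly_ring_closed(2)[OF id] by blast
    next
      fix a b assume "a \<in> \<Union>C" "b \<in> \<Union>C"
      then obtain X Y where XY: "X \<in> C" "Y \<in> C" "a \<in> X" "b \<in> Y" by blast
      then obtain Z where "Z \<in> C" "a \<in> Z" "b \<in> Z" using tot[of X Y] by blast
      then show "a + b \<in> \<Union>C" using ideal_poly_ring_closed(3)[OF id] by blast
    next
      fix x a :: "'k mpoly" assume "x \<in> polys n" "a \<in> \<Union>C"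
      then show "x * a \<in> \<Union>C" using ideal_poly_ring_closed(4)[OF id] by blast
    qed
    then show "\<Union>C \<in> ?A" using C(1) CA by blast
  qed
  then obtain M where M: "ideal M (poly_ring n)" "J \<subseteq> M" "M \<inter> S = {}"
    and max: "\<forall>X\<in>?A. M \<subseteq> X \<longrightarrow> X = M"
    by auto
  note cl = ideal_poly_ring_closed[OF M(1)]
  \<comment> \<open>By maximality the ideal generated by \<open>M\<close> and an element outside
    \<open>M\<close> must meet \<open>S\<close>.\<close>
  have meet: "\<exists>p\<in>M. \<exists>f\<in>polys n. p + a * f \<in> S"
    if a: "a \<in> polys n" "a \<notin> M" for a
  proof (rule ccontr)
    assume no: "\<not> ?thesis"
    let ?I = "{p + a * f | p f. p \<in> M \<and> f \<in> polys n}"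
    have "?I = M"
    proof (rule max[rule_format])
      show "?I \<in> ?A" using no M(2) ideal_add_principal(1,2)[OF M(1) a(1)] by auto
    qed (rule ideal_add_principal(2)[OF M(1) a(1)])
    then show False using ideal_add_principal(3)[OF M(1) a(1)] a(2) by simp
  qed
  have "primeideal M (poly_ring n)"
    unfolding primeideal_poly_ring_iff
  proof (intro conjI ballI impI)
    show "1 \<notin> M" using S(2) M(3) by blast
    fix a b assume ab: "a \<in> polys n" "b \<in> polys n" "a * b \<in> M"
    show "a \<in> M \<or> b \<in> M"
    proof (rule ccontr)
      assume "\<not> (a \<in> M \<or> b \<in> M)"
      then obtain p f q g where *: "p \<in> M" "q \<in> M" "f \<in> polys n"
        "g \<in> polys n" "p + a * f \<in> S" "q + b * g \<in> S"
        using meet[of a] meet[of b] ab by blast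
      \<comment> \<open>The product of two such elements of \<open>S\<close> would lie in
        \<open>M\<close> as soon as \<open>a * b\<close> does, although \<open>M\<close> misses
        \<open>S\<close>.\<close>
      have "(p + a * f) * (q + b * g) = p * (q + b * g) + (a * f) * q + (f * g) * (a * b)"
        by (simp add: algebra_simps)
      also have "\<dots> \<in> M"
        by (rule cl(3)[OF cl(3)[OF cl(5) cl(4)] cl(4)]) (use * ab cl(1) in auto)
      finally show False using S(3)[OF *(5,6)] M(3) by blast
    qed
  qed (rule M(1))
  then show thesis using that M by blast
qed

section \<open>Integrality modulo an ideal, going up and incomparability\<close>

definition integral_mod :: "nat \<Rightarrow> 'k::field mpoly set \<Rightarrow> 'k mpoly \<Rightarrow> bool" where
  "integral_mod s J f \<longleftrightarrow>
    (\<exists>p. lead_coeff p = 1 \<and> (\<forall>i. coeff p i \<in> polys s) \<and> poly p f \<in> J)"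

lemma integral_mod_mono: "integral_mod s J f \<Longrightarrow> J \<subseteq> J' \<Longrightarrow> integral_mod s J' f"
  unfolding integral_mod_def by blast

text \<open>Going up, one variable at a time: a prime \<open>P\<close> over \<open>J\<close> that
  lies over zero in the ring of \<open>s + 1\<close> variables is followed by the ideal generated by
  \<open>P\<close> and the last of these variables. This ideal meets the ring of \<open>s\<close>
  variables in zero, and D stays integral modulo it over that ring, so the induction hypothesis
  continues the chain above it.\<close>

lemma exists_prime_chain:
  assumes "ideal J (poly_ring n :: 'k::field mpoly ring)" "J \<inter> polys s = {0}"
    "\<And>f. f \<in> polys n \<Longrightarrow> integral_mod s J f" "s \<le> n"
  shows "\<exists>P. (\<forall>i\<le>s. primeideal (P i) (poly_ring n)) \<and> (\<forall>i<s. P i \<subset> P (Suc i)) \<and> J \<subseteq> P 0"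
  using assms
proof (induction s arbitrary: J)
  case (0 J)
  obtain P where "primeideal P (poly_ring n)" "J \<subseteq> P" "P \<inter> {1} = {}"
  proof (rule exists_prime_avoiding[of J n "{1}"])
    have "(1 :: 'k mpoly) \<in> polys 0" by simp
    then have "1 \<notin> J" using "0.prems"(2) by (metis IntI singletonD zero_neq_one)
    then show "J \<inter> {1} = {}" by simp
  qed (use "0.prems" in auto)
  then show ?case by (intro exI[of _ "\<lambda>_. P"]) auto
next
  case (Suc s J)
  let ?A = "polys (Suc s) :: 'k mpoly set"
  let ?D = "polys n :: 'k mpoly set"
  have AD: "a \<in> ?D" if "a \<in> ?A" for a
    using that Suc.prems(4) poly_ring_mono by blast
  \<comment> \<open>The nonzero elements of \<open>?A\<close> form a multiplicative set because the
    polynomial ring is a domain; \<open>P\<close> thus lies over zero.\<close>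
  obtain P where P: "primeideal P (poly_ring n)" "J \<subseteq> P" "P \<inter> (?A - {0}) = {}"
    using Suc.prems(1,2) AD by (elim exists_prime_avoiding[of J n "?A - {0}"]) auto
  have idP: "ideal P (poly_ring n)" using P(1) by (simp add: primeideal_poly_ring_iff)
  note cl = ideal_poly_ring_closed[OF idP]
  define d where "d = (deriv_var (Suc s) :: 'k mpoly)"
  have dA: "d \<in> ?A" by (simp add: d_def)
  have dP: "d \<notin> P" using P(3) dA deriv_var_nonzero[of "Suc s"] unfolding d_def by blast
  define J' where "J' = {p + d * f | p f. p \<in> P \<and> f \<in> ?D}"
  have J': "ideal J' (poly_ring n)" "P \<subseteq> J'" "d \<in> J'"
    unfolding J'_def using ideal_add_principal[OF idP AD[OF dA]] by auto
  have "J' \<inter> polys s = {0}"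
  proof -
    have "s0 = 0" if s0: "s0 \<in> J'" "s0 \<in> polys s" for s0
    proof -
      obtain p0 f where f: "s0 = p0 + d * f" "p0 \<in> P" "f \<in> ?D"
        using s0(1) unfolding J'_def by blast
      obtain p where p: "lead_coeff p = 1" "\<And>i. coeff p i \<in> ?A" "poly p f \<in> P"
        using Suc.prems(3)[OF f(3)] P(2) unfolding integral_mod_def by blast
      define k where "k = Polynomial.degree p"
      have s0A: "s0 \<in> ?A" using s0(2) poly_ring_mono by (metis le_SucI order_refl)
      \<comment> \<open>The integral equation of \<open>f\<close>, multiplied by
        \<open>d ^ k\<close> and rewritten in powers of \<open>d * f\<close>, which is congruent to
        \<open>s0\<close> modulo \<open>P\<close>. All terms lie in \<open>?A\<close>, which
        \<open>P\<close> meets only in zero.\<close>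
      define Q where "Q = (\<Sum>i\<le>k. coeff p i * d ^ (k - i) * s0 ^ i)"
      have "d ^ k * poly p f = (\<Sum>i\<le>k. coeff p i * d ^ (k - i) * (d * f) ^ i)"
        unfolding poly_altdef k_def[symmetric] sum_distrib_left
      proof (rule sum.cong)
        fix i assume "i \<in> {..k}"
        then have "d ^ k = d ^ (k - i) * d ^ i" by (simp flip: power_add)
        then show "d ^ k * (coeff p i * f ^ i) = coeff p i * d ^ (k - i) * (d * f) ^ i"
          by (simp add: power_mult_distrib algebra_simps)
      qed simp
      then have eq: "Q = d ^ k * poly p f - (\<Sum>i\<le>k. coeff p i * d ^ (k - i) * ((d * f) ^ i - s0 ^
        i))"
        unfolding Q_def by (simp add: right_diff_distrib sum_subtractf)
      have "d * f - s0 = - p0" using f(1) by simp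
      then have pd: "(d * f) ^ i - s0 ^ i \<in> P" for i
        using f cl(6) AD[OF dA] AD[OF s0A] by (intro ideal_poly_ring_power_diff[OF idP]) auto
      have "Q \<in> P"
        unfolding eq
        by (rule cl(7)[OF cl(4) ideal_poly_ring_sum[OF idP cl(4)]]) (use p pd AD dA in auto)
      moreover have "Q \<in> ?A"
        unfolding Q_def using p(2) dA s0A by (intro poly_ring_sum) auto
      ultimately have "Q = 0" using P(3) by blast
      \<comment> \<open>All terms of \<open>Q\<close> except \<open>s0 ^ k\<close> are divisible by
        \<open>d\<close>. From \<open>Q = 0\<close> the power \<open>s0 ^ k\<close>, which is free
        of the last variable, becomes a multiple of it and vanishes.\<close>
      define h where "h = (\<Sum>i<k. coeff p i * d ^ (k - Suc i) * s0 ^ i)"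
      have "Q = (\<Sum>i<k. coeff p i * d ^ (k - i) * s0 ^ i) + s0 ^ k"
        using p(1) unfolding Q_def k_def by (simp flip: lessThan_Suc_atMost)
      also have "(\<Sum>i<k. coeff p i * d ^ (k - i) * s0 ^ i) = d * h"
        unfolding h_def sum_distrib_left
      proof (rule sum.cong)
        fix i assume "i \<in> {..<k}"
        then have "k - i = Suc (k - Suc i)" by auto
        then show "coeff p i * d ^ (k - i) * s0 ^ i = d * (coeff p i * d ^ (k - Suc i) * s0 ^ i)"
          by (simp add: algebra_simps)
      qed simp
      finally have "s0 ^ k = d * (- h)" using \<open>Q = 0\<close>
        by (metis add.commute add_eq_0_iff mult_minus_right)
      moreover have "s0 ^ k \<in> polys s" using s0(2) by simp
      ultimately have "- h = 0" 
        using deriv_var_mult_in_smaller[of s "- h"] by (simp add: d_def)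
      then have "s0 ^ k = 0" using \<open>s0 ^ k = d * (- h)\<close> by simp
      then show "s0 = 0" by (metis power_not_zero)
    qed
    then show ?thesis using ideal_poly_ring_closed(2)[OF J'(1)] by auto
  qed
  moreover have "integral_mod s J' f" if f: "f \<in> ?D" for f
  proof -
    obtain p where p: "lead_coeff p = 1" "\<And>i. coeff p i \<in> ?A" "poly p f \<in> P"
      using Suc.prems(3)[OF f] P(2) unfolding integral_mod_def by blast
    define k where "k = Polynomial.degree p"
    have "\<forall>i. \<exists>c0 c1. c0 \<in> polys s \<and> c1 \<in> ?A \<and> coeff p i = c0 + d * c1"
      using poly_ring_decomp[OF p(2)] unfolding d_def by metis
    then obtain c0 c1 where c: "\<And>i. c0 i \<in> polys s" "\<And>i. c1 i \<in> ?A"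
      "\<And>i. coeff p i = c0 i + d * c1 i" by metis
    \<comment> \<open>Reduction of \<open>p\<close> modulo \<open>d\<close>: below the leading term
      the coefficients are replaced by their remainders, with an error that is a multiple of
      \<open>d\<close> and so lies in \<open>J'\<close>. The leading 1 is written explicitly to keep
      \<open>p'\<close> monic.\<close>
    define p' where "p' = (\<Sum>i<k. monom (c0 i) i) + monom 1 k"
    have co: "coeff p' i = (if i < k then c0 i else if i = k then 1 else 0)" for i
      unfolding p'_def by (simp add: coeff_sum)
    have "Polynomial.degree p' = k"
      by (rule antisym) (auto simp: co intro!: degree_le le_degree)
    then have "lead_coeff p' = 1" by (simp add: co)
    moreover have "\<forall>i. coeff p' i \<in> polys s" using c(1) by (simp add: co)
    moreover have "poly p' f \<in> J'"
    proof -
      have "poly p f = (\<Sum>i<k. coeff p i * f ^ i) + f ^ k"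
        unfolding poly_altdef k_def[symmetric] using p(1) k_def
        by (simp flip: lessThan_Suc_atMost)
      also have "\<dots> = poly p' f + (\<Sum>i<k. c1 i * f ^ i) * d"
        by (simp add: p'_def poly_sum poly_monom c(3) ring_distribs sum.distrib sum_distrib_right
          sum_distrib_left algebra_simps)
      finally have "poly p' f = poly p f - (\<Sum>i<k. c1 i * f ^ i) * d" by simp
      also have "\<dots> \<in> J'"
        by (rule ideal_poly_ring_closed(7)[OF J'(1) _ ideal_poly_ring_closed(4)[OF J'(1)
          poly_ring_sum]])
          (use p(3) J'(2,3) c(2) AD f in auto)
      finally show ?thesis .
    qed
    ultimately show ?thesis unfolding integral_mod_def by blast
  qed
  ultimately obtain P' where P': "\<forall>i\<le>s. primeideal (P' i) (poly_ring n)"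
    "\<forall>i<s. P' i \<subset> P' (Suc i)" "J' \<subseteq> P' 0"
    using Suc.IH[OF J'(1)] Suc.prems(4) by auto
  \<comment> \<open>The inclusion is strict because \<open>d\<close> belongs to \<open>P' 0\<close>
    but not to \<open>P\<close>.\<close>
  have "P \<subset> P' 0" using J'(2,3) P'(3) dP by blast
  then show ?case
    using P P' by (intro exI[of _ "case_nat P P'"]) (auto split: nat.splits)
qed

text \<open>Horner's scheme on an integral equation of \<open>x\<close> modulo \<open>P\<close>: the
  constant coefficient lies in \<open>Q\<close>; if it already lies in \<open>P\<close>, the factor
  \<open>x\<close>, which is outside the prime \<open>P\<close>, can be cancelled and the degree
  drops. A monic polynomial cannot be exhausted in this way, since its last coefficient 1 is not in
  \<open>P\<close>.\<close>

lemma incomparability: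
  assumes P: "primeideal P (poly_ring n :: 'k::field mpoly ring)" and Q: "ideal Q (poly_ring n)"
    and "P \<subseteq> Q" "x \<in> Q" "x \<notin> P" "integral_mod s P x" "s \<le> n"
  shows "\<exists>a\<in>polys s. a \<in> Q \<and> a \<notin> P"
proof -
  have idP: "ideal P (poly_ring n)" using P by (simp add: primeideal_poly_ring_iff)
  have x: "x \<in> polys n" using assms(4) ideal_poly_ring_closed(1)[OF Q] by blast
  have "\<exists>a\<in>polys s. a \<in> Q \<and> a \<notin> P"
    if "lead_coeff p = 1" "\<forall>i. coeff p i \<in> polys s" "poly p x \<in> P" for p
    using that
  proof (induction p)
    case (pCons c p)
    have co: "\<forall>i. coeff p i \<in> polys s" "c \<in> polys s"
      using pCons.prems(2) by (metis coeff_pCons_Suc, metis coeff_pCons_0)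
    have D: "poly p x \<in> polys n"
      unfolding poly_altdef using co(1) x assms(7) poly_ring_mono
      by (intro poly_ring_sum poly_ring_mult poly_ring_power) blast+
    show ?case
    proof (cases "c \<in> P")
      case True
      \<comment> \<open>If only \<open>c\<close> were left, it would be the leading coefficient
        1.\<close>
      have "p \<noteq> 0"
        using pCons.prems(1) True P by (auto simp: primeideal_poly_ring_iff)
      have "x * poly p x = poly (pCons c p) x - c" by simp
      then have "x * poly p x \<in> P"
        using pCons.prems(3) True by (metis ideal_poly_ring_closed(7)[OF idP])
      then have "poly p x \<in> P" using P x D assms(5) by (auto simp: primeideal_poly_ring_iff)
      then show ?thesis using pCons.IH co pCons.prems(1) \<open>p \<noteq> 0\<close> by simp
    next
      case False
      have "c = poly (pCons c p) x - x * poly p x" by simp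
      then have "c \<in> Q"
        using pCons.prems(3) assms(3,4) D
        by (metis ideal_poly_ring_closed(5,7)[OF Q] subsetD)
      then show ?thesis using False co(2) by blast
    qed
  qed simp
  then show ?thesis using assms(6) unfolding integral_mod_def by blast
qed

section \<open>Counting monomials\<close>

lemma primeideal_poly_ringD:
  assumes "primeideal P (poly_ring n :: 'k::field mpoly ring)" "a * b \<in> P"
    "a \<in> polys n" "b \<in> polys n"
  shows "a \<in> P \<or> b \<in> P"
  using assms unfolding primeideal_poly_ring_iff by blast

text \<open>Gaussian elimination: equation \<open>j\<close> is solved for a pivot unknown
  \<open>i0\<close> and substituted into the others, which leaves one equation and one unknown
  fewer.\<close>

lemma more_unknowns_than_equations:
  fixes B :: "'i \<Rightarrow> 'j \<Rightarrow> 'k::field"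
  assumes "finite J" "finite I" "card J < card I"
  shows "\<exists>c. (\<exists>i\<in>I. c i \<noteq> 0) \<and> (\<forall>j\<in>J. (\<Sum>i\<in>I. c i * B i j) = 0)"
  using assms
proof (induction J arbitrary: I B rule: finite_induct)
  case empty
  then show ?case by (intro exI[of _ "\<lambda>_. 1"]) (auto simp: card_gt_0_iff)
next
  case (insert j J)
  show ?case
  proof (cases "\<forall>i\<in>I. B i j = 0")
    case True
    then show ?thesis using insert.IH[of I B] insert.prems insert.hyps by auto
  next
    case False
    then obtain i0 where i0: "i0 \<in> I" "B i0 j \<noteq> 0" by blast
    define B' where "B' = (\<lambda>i l. B i l - B i j / B i0 j * B i0 l)"
    have "card J < card (I - {i0})"
      using insert i0 by (simp add: card_Diff_singleton)
    then obtain c where c: "\<exists>i\<in>I - {i0}. c i \<noteq> 0"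
      "\<And>l. l \<in> J \<Longrightarrow> (\<Sum>i\<in>I - {i0}. c i * B' i l) = 0"
      using insert.IH[of "I - {i0}" B'] insert.prems(1) by auto
    \<comment> \<open>The value of the pivot unknown that satisfies equation \<open>j\<close>; it
      also turns the original sums into those with matrix \<open>B'\<close>.\<close>
    define c' where "c' = c(i0 := - (\<Sum>i\<in>I - {i0}. c i * (B i j / B i0 j)))"
    have "(\<Sum>i\<in>I. c' i * B i l) = (\<Sum>i\<in>I - {i0}. c i * B' i l)" for l
    proof -
      have "(\<Sum>i\<in>I. c' i * B i l) = c' i0 * B i0 l + (\<Sum>i\<in>I - {i0}. c' i * B i l)"
        using i0(1) insert.prems(1) by (simp add: sum.remove)
      also have "(\<Sum>i\<in>I - {i0}. c' i * B i l) = (\<Sum>i\<in>I - {i0}. c i * B i l)"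
        by (intro sum.cong) (auto simp: c'_def)
      finally show ?thesis
        by (simp add: c'_def B'_def right_diff_distrib sum_subtractf sum_distrib_right mult.assoc)
    qed
    moreover have "B' i j = 0" for i using i0(2) by (simp add: B'_def)
    ultimately have "\<forall>l\<in>insert j J. (\<Sum>i\<in>I. c' i * B i l) = 0" using c(2) by auto
    moreover have "\<exists>i\<in>I. c' i \<noteq> 0" using c(1) by (auto simp: c'_def)
    ultimately show ?thesis by blast
  qed
qed

lemma lookup_single_mult_add:
  fixes p :: "'k::field mpoly"
  shows "lookup (single \<nu> c * p) (\<nu> + \<kappa>) = c * lookup p \<kappa>"
proof -
  have eq: "(\<nu> + \<kappa> = \<nu> + q) = (q = \<kappa>)" for q by auto
  have "lookup (single \<nu> c * p) (\<nu> + \<kappa>) =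
     (\<Sum>l. lookup (single \<nu> c) l *
       (\<Sum>q. lookup p q when \<nu> + \<kappa> = l + q))"
    by (rule lookup_mult)
  also have "\<dots> = (\<Sum>l. (c * (\<Sum>q. lookup p q when \<nu> + \<kappa> = \<nu> + q)) when l = \<nu>)"
    by (rule Sum_any.cong) (auto simp: lookup_single when_def)
  also have "\<dots> = c * lookup p \<kappa>"
    by (simp add: eq)
  finally show ?thesis .
qed

lemma lookup_scalar_mult:
  fixes p :: "'k::field mpoly"
  shows "lookup (single 0 c * p) \<kappa> = c * lookup p \<kappa>"
  using lookup_single_mult_add[of 0 c p \<kappa>] by simp

section \<open>Polynomials with bounded exponents\<close>

definition exponent_box :: "nat \<Rightarrow> nat \<Rightarrow> multi_index set" where
  "exponent_box s d = {\<mu>. keys \<mu> \<subseteq> {1..s} \<and> (\<forall>i. lookup \<mu> i \<le> d)}"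

definition poly_box :: "nat \<Rightarrow> nat \<Rightarrow> 'k::field mpoly set" where
  "poly_box s d = {p. keys p \<subseteq> exponent_box s d}"

text \<open>Bounding every exponent separately, rather than the total degree, makes the box a cube.
  Its size can be read off after restriction to the \<open>s\<close> variables, and boxes simply add
  under multiplication of polynomials.\<close>

lemma exponent_box_finite: "finite (exponent_box s d)"
  and card_exponent_box: "card (exponent_box s d) \<le> (d + 1) ^ s"
proof -
  let ?E = "PiE {1..s} (\<lambda>_. {..d})"
  let ?f = "\<lambda>\<mu>::multi_index. restrict (lookup \<mu>) {1..s}"
  have inj: "inj_on ?f (exponent_box s d)"
  proof (rule inj_onI)
    fix \<mu> \<nu> assume *: "\<mu> \<in> exponent_box s d" "\<nu> \<in> exponent_box s d" "?f \<mu> = ?f \<nu>"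
    show "\<mu> = \<nu>"
    proof (rule poly_mapping_eqI)
      fix i
      show "lookup \<mu> i = lookup \<nu> i"
      proof (cases "i \<in> {1..s}")
        case True then show ?thesis using fun_cong[OF *(3), of i] by simp
      next
        case False
        then have "i \<notin> keys \<mu>" "i \<notin> keys \<nu>"
          using *(1,2) unfolding exponent_box_def by blast+
        then show ?thesis by (simp add: in_keys_iff)
      qed
    qed
  qed
  have img: "?f ` exponent_box s d \<subseteq> ?E"
    by (auto simp: exponent_box_def)
  have fin: "finite ?E" by (intro finite_PiE) auto
  show "finite (exponent_box s d)" using inj img fin by (metis finite_imageD finite_subset)
  have "card (exponent_box s d) \<le> card ?E" using inj img fin by (rule card_inj_on_le)
  also have "\<dots> = (d + 1) ^ s" by (simp add: card_PiE)
  finally show "card (exponent_box s d) \<le> (d + 1) ^ s" .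
qed

lemma poly_box_carrier: "p \<in> poly_box s d \<Longrightarrow> p \<in> polys s"
  by (auto simp: poly_box_def exponent_box_def carrier_poly_ring_iff)

lemma exponent_box_mono: "d \<le> d' \<Longrightarrow> exponent_box s d \<subseteq> exponent_box s d'"
  unfolding exponent_box_def by (auto intro: le_trans)

lemma poly_box_mono: "p \<in> poly_box s d \<Longrightarrow> d \<le> d' \<Longrightarrow> p \<in> poly_box s d'"
  using exponent_box_mono[of d d' s] by (auto simp: poly_box_def)

lemma poly_box_exists:
  assumes "p \<in> polys s"
  obtains d where "p \<in> poly_box s d"
proof
  let ?V = "(\<Union>\<mu>\<in>keys p. lookup \<mu> ` keys \<mu>)"
  \<comment> \<open>The inserted 0 keeps the maximum meaningful for constants, where
    \<open>?V\<close> is empty.\<close>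
  let ?d = "Max (insert 0 ?V)"
  have "lookup \<mu> i \<le> ?d" if "\<mu> \<in> keys p" for \<mu> i
  proof (cases "i \<in> keys \<mu>")
    case True
    then show ?thesis using that by (intro Max_ge) auto
  qed (simp add: in_keys_iff)
  then show "p \<in> poly_box s ?d"
    using assms by (auto simp: poly_box_def exponent_box_def carrier_poly_ring_iff)
qed

lemma poly_box_zero [simp]: "0 \<in> poly_box s d"
  by (simp add: poly_box_def)

lemma poly_box_one [simp]: "1 \<in> poly_box s d"
  by (simp add: poly_box_def exponent_box_def)

lemma poly_box_add: "p \<in> poly_box s d \<Longrightarrow> q \<in> poly_box s d \<Longrightarrow> p + q \<in> poly_box s d"
  using Poly_Mapping.keys_add[of p q] by (auto simp: poly_box_def)

lemma poly_box_sum: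
  "(\<And>i. i \<in> I \<Longrightarrow> f i \<in> poly_box s d) \<Longrightarrow> sum f I \<in> poly_box s d"
  by (induction I rule: infinite_finite_induct) (auto intro: poly_box_add)

lemma poly_box_mult:
  assumes "p \<in> poly_box s d" "q \<in> poly_box s e"
  shows "p * q \<in> poly_box s (d + e)"
  unfolding poly_box_def
proof (intro CollectI subsetI)
  fix \<mu> assume "\<mu> \<in> keys (p * q)"
  then obtain a b where ab: "\<mu> = a + b" "a \<in> keys p" "b \<in> keys q"
    using Poly_Mapping.keys_mult[of p q] by blast
  then have "a \<in> exponent_box s d" "b \<in> exponent_box s e" using assms by (auto simp: poly_box_def)
  then show "\<mu> \<in> exponent_box s (d + e)"
    using Poly_Mapping.keys_add[of a b]
    by (auto simp: ab(1) exponent_box_def lookup_add intro!: add_mono)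
qed

lemma poly_box_power: "p \<in> poly_box s d \<Longrightarrow> p ^ i \<in> poly_box s (d * i)"
  by (induction i) (auto dest: poly_box_mult)

text \<open>One unknown scalar for each \<open>i\<close> and one equation for each pair of a
  coordinate \<open>b\<close> and a monomial of the box: a nontrivial k-linear relation exists once
  the unknowns outnumber the coefficients.\<close>

lemma linear_relation_in_poly_box:
  fixes w :: "'i \<Rightarrow> 'b \<Rightarrow> 'k::field mpoly"
  assumes fin: "finite I" "finite B" and w: "\<And>i b. i \<in> I \<Longrightarrow> b \<in> B \<Longrightarrow> w i b \<in> poly_box s d"
    and card: "card B * (d + 1) ^ s < card I"
  obtains c :: "'i \<Rightarrow> 'k" where "\<exists>i\<in>I. c i \<noteq> 0"
    "\<And>b. b \<in> B \<Longrightarrow> (\<Sum>i\<in>I. single 0 (c i) * w i b) = 0"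
proof -
  let ?J = "B \<times> exponent_box s d"
  have "card ?J < card I"
    unfolding card_cartesian_product
    by (rule order_le_less_trans[OF mult_le_mono2[OF card_exponent_box] card])
  moreover have "finite ?J" using fin exponent_box_finite by blast
  ultimately obtain c :: "'i \<Rightarrow> 'k" where c: "\<exists>i\<in>I. c i \<noteq> 0"
    "\<forall>j\<in>?J. (\<Sum>i\<in>I. c i * (case j of (b, \<mu>) \<Rightarrow> lookup (w i b) \<mu>)) = 0"
    using more_unknowns_than_equations[of ?J I "\<lambda>i (b, \<mu>). lookup (w i b) \<mu>"] fin(1)
    by auto
  have "(\<Sum>i\<in>I. single 0 (c i) * w i b) = 0" if b: "b \<in> B" for b
  proof (rule poly_mapping_eqI)
    fix \<mu>
    have "(\<Sum>i\<in>I. c i * lookup (w i b) \<mu>) = 0"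
    proof (cases "\<mu> \<in> exponent_box s d")
      case True then show ?thesis using c(2) b by auto
    next
      case False
      then have "\<mu> \<notin> keys (w i b)" if "i \<in> I" for i
        using w[OF that b] by (auto simp: poly_box_def)
      then show ?thesis by (intro sum.neutral) (auto simp: in_keys_iff)
    qed
    then show "lookup (\<Sum>i\<in>I. single 0 (c i) * w i b) \<mu>
      = lookup 0 \<mu>"
      by (simp add: lookup_sum lookup_scalar_mult)
  qed
  with c(1) that show thesis by blast
qed

section \<open>Monomials in the elements of a chain\<close>

fun monomial_of :: "'a::comm_monoid_mult list \<Rightarrow> nat list \<Rightarrow> 'a" where
  "monomial_of (x # xs) (i # is) = x ^ i * monomial_of xs is"
| "monomial_of _ _ = 1"

text \<open>Lists instead of multi-indices let an induction along the chain split off the exponent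
  of the first element as the head.\<close>

definition exponent_lists :: "nat \<Rightarrow> nat \<Rightarrow> nat list set" where
  "exponent_lists p l = {as. set as \<subseteq> {..p} \<and> length as = l}"

lemma finite_exponent_lists: "finite (exponent_lists p l)"
  unfolding exponent_lists_def by (rule finite_lists_length_eq) simp

lemma card_exponent_lists: "card (exponent_lists p l) = (p + 1) ^ l"
  unfolding exponent_lists_def by (subst card_lists_length_eq) auto

lemma sum_exponent_lists_Suc:
  "(\<Sum>as\<in>exponent_lists p (Suc l). f as) = (\<Sum>i\<le>p. \<Sum>as\<in>exponent_lists p l. f (i # as))"
proof -
  have "exponent_lists p (Suc l) = (\<lambda>(i, as). i # as) ` ({..p} \<times> exponent_lists p l)"
    unfolding exponent_lists_def by (auto simp: length_Suc_conv image_iff)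
  moreover have "inj_on (\<lambda>(i, as). i # as) ({..p} \<times> exponent_lists p l)"
    by (auto simp: inj_on_def)
  ultimately show ?thesis
    by (simp add: sum.reindex sum.cartesian_product case_prod_unfold)
qed

text \<open>With \<open>i0\<close> the lowest exponent that occurs, \<open>x ^ i0\<close> factors
  out and the cofactor is \<open>G i0\<close> plus a multiple of \<open>x\<close>. In this form a
  lowest power is cancelled and the rest is reduced modulo a prime containing
  \<open>x\<close>.\<close>

lemma sum_power_extract_lowest:
  fixes x :: "'a::comm_ring_1"
  assumes "\<And>i. i < i0 \<Longrightarrow> G i = 0" "i0 \<le> p"
  shows "(\<Sum>i\<le>p. x ^ i * G i) = x ^ i0 * (\<Sum>i\<in>{i0..p}. x ^ (i - i0) * G i)"
    and "(\<Sum>i\<in>{i0..p}. x ^ (i - i0) * G i) = G i0 + x * (\<Sum>i\<in>{Suc i0..p}. x ^ (i - Suc i0) * G i)"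
proof -
  have "(\<Sum>i\<le>p. x ^ i * G i) = (\<Sum>i\<in>{i0..p}. x ^ i * G i)"
    using assms by (intro sum.mono_neutral_right) auto
  also have "\<dots> = (\<Sum>i\<in>{i0..p}. x ^ i0 * (x ^ (i - i0) * G i))"
    by (intro sum.cong) (auto simp flip: mult.assoc power_add)
  finally show "(\<Sum>i\<le>p. x ^ i * G i) = x ^ i0 * (\<Sum>i\<in>{i0..p}. x ^ (i - i0) * G i)"
    by (simp add: sum_distrib_left)
  have "(\<Sum>i\<in>{i0..p}. x ^ (i - i0) * G i) = G i0 + (\<Sum>i\<in>{Suc i0..p}. x ^ (i - i0) * G i)"
    using assms(2) by (simp add: sum.atLeast_Suc_atMost)
  also have "(\<Sum>i\<in>{Suc i0..p}. x ^ (i - i0) * G i) = (\<Sum>i\<in>{Suc i0..p}. x * (x ^ (i - Suc i0) * G i))"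
  proof (rule sum.cong)
    fix i assume "i \<in> {Suc i0..p}"
    then have "i - i0 = Suc (i - Suc i0)" by auto
    then show "x ^ (i - i0) * G i = x * (x ^ (i - Suc i0) * G i)" by simp
  qed simp
  finally show "(\<Sum>i\<in>{i0..p}. x ^ (i - i0) * G i)
    = G i0 + x * (\<Sum>i\<in>{Suc i0..p}. x ^ (i - Suc i0) * G i)"
    by (simp add: sum_distrib_left)
qed

lemma monomial_of_poly_ring:
  "set xs \<subseteq> polys n \<Longrightarrow> monomial_of xs as \<in> polys n"
  by (induction xs as rule: monomial_of.induct) auto

lemma scalar_poly_ring [simp, intro]: "single 0 c \<in> polys n"
  by (rule poly_ring_single) simp

text \<open>Elements picked from the successive differences of a chain of primes are algebraically
  independent modulo its bottom: the lowest power of the first element can be cancelled, and what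
  remains lies in the next prime.\<close>

lemma chain_algebraically_independent:
  fixes c :: "nat list \<Rightarrow> 'k::field"
  assumes "\<And>i. i \<le> length xs \<Longrightarrow> primeideal (P i) (poly_ring n :: 'k mpoly ring)"
    and "\<And>i. i < length xs \<Longrightarrow> P i \<subseteq> P (Suc i) \<and> xs ! i \<in> P (Suc i) \<and> xs ! i \<notin> P i"
    and "(\<Sum>as\<in>exponent_lists p (length xs). single 0 (c as) * monomial_of xs as) \<in> P 0"
    and "as \<in> exponent_lists p (length xs)"
  shows "c as = 0"
  using assms
proof (induction xs arbitrary: P c as)
  case Nil
  have "as = []" "exponent_lists p 0 = {[]}" using Nil.prems(4) by (auto simp: exponent_lists_def)
  then have mem: "single 0 (c as) \<in> P 0" using Nil.prems(3) by simp
  have prime: "primeideal (P 0) (poly_ring n)" using Nil.prems(1) by simp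
  show ?case
  proof (rule ccontr)
    assume "c as \<noteq> 0"
    \<comment> \<open>A nonzero constant in \<open>P 0\<close> would be a unit of the ring.\<close>
    then have "1 = single 0 (1 / c as) * single 0 (c as)"
      by (simp add: mult_single)
    also have "\<dots> \<in> P 0"
      using mem prime by (intro ideal_poly_ring_closed(4)) (auto simp: primeideal_poly_ring_iff)
    finally show False using prime by (simp add: primeideal_poly_ring_iff)
  qed
next
  case (Cons x xs)
  let ?l = "length xs"
  have prime: "primeideal (P i) (poly_ring n)" if "i \<le> Suc ?l" for i using Cons.prems(1) that
    by simp
  then have id: "ideal (P i) (poly_ring n)" if "i \<le> Suc ?l" for i
    using that by (auto simp: primeideal_poly_ring_iff)
  have x: "x \<in> P 1" "x \<notin> P 0" "P 0 \<subseteq> P 1" using Cons.prems(2)[of 0] by auto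
  have carr: "set (x # xs) \<subseteq> polys n"
  proof
    fix y assume "y \<in> set (x # xs)"
    then obtain i where i: "i < length (x # xs)" "y = (x # xs) ! i" by (metis in_set_conv_nth)
    then have "y \<in> P (Suc i)" using Cons.prems(2) by blast
    then show "y \<in> polys n"
      using ideal_poly_ring_closed(1)[OF id[of "Suc i"]] i by auto
  qed
  define G where "G = (\<lambda>i. \<Sum>as\<in>exponent_lists p ?l. single 0 (c (i # as)) * monomial_of xs as)"
  have G: "G i \<in> polys n" for i
    unfolding G_def using carr monomial_of_poly_ring by (intro poly_ring_sum) auto
  have sum: "(\<Sum>i\<le>p. x ^ i * G i) \<in> P 0"
    using Cons.prems(3) by (simp add: sum_exponent_lists_Suc G_def sum_distrib_left algebra_simps)
  show ?case
  proof (rule ccontr)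
    assume "c as \<noteq> 0"
    moreover obtain i as' where as: "as = i # as'" "i \<le> p" "as' \<in> exponent_lists p ?l"
      using Cons.prems(4) by (auto simp: exponent_lists_def length_Suc_conv)
    ultimately have ex: "\<exists>i. i \<le> p \<and> (\<exists>as\<in>exponent_lists p ?l. c (i # as) \<noteq> 0)" by blast
    define i0 where "i0 = (LEAST i. i \<le> p \<and> (\<exists>as\<in>exponent_lists p ?l. c (i # as) \<noteq> 0))"
    have i0: "i0 \<le> p" "\<exists>as\<in>exponent_lists p ?l. c (i0 # as) \<noteq> 0"
      using LeastI_ex[OF ex] unfolding i0_def by auto
    have "G i = 0" if "i < i0" for i
      using not_less_Least[OF that[unfolded i0_def]] that i0(1)
      unfolding G_def by (intro sum.neutral) auto
    note ex = sum_power_extract_lowest[OF this i0(1), where x = x]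
    let ?h = "\<Sum>i\<in>{Suc i0..p}. x ^ (i - Suc i0) * G i"
    have h: "?h \<in> polys n" using G carr by (intro poly_ring_sum) auto
    have "x ^ i0 * (G i0 + x * ?h) \<in> P 0" using sum by (simp only: ex)
    moreover have "x ^ i \<notin> P 0" for i
      using prime[of 0] x(2) carr by (induction i) (auto simp: primeideal_poly_ring_iff)
    ultimately have "G i0 + x * ?h \<in> P 0"
      using primeideal_poly_ringD[OF prime[of 0], of "x ^ i0" "G i0 + x * ?h"] carr G h by auto
    then have "(G i0 + x * ?h) - x * ?h \<in> P 1"
      using x h by (intro ideal_poly_ring_closed(7)[OF id] ideal_poly_ring_closed(5)[OF id]) auto
    then have "G i0 \<in> P 1" by simp
    then have G1: "(\<Sum>as\<in>exponent_lists p ?l. single 0 (c (i0 # as)) * monomial_of xs as)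
      \<in> P (Suc 0)"
      by (simp add: G_def)
    \<comment> \<open>The remaining relation involves one element fewer, so the hypothesis applies
      to the chain without its bottom prime.\<close>
    have "c (i0 # as) = 0" if as: "as \<in> exponent_lists p ?l" for as
    proof (rule Cons.IH[of "\<lambda>i. P (Suc i)" "\<lambda>as. c (i0 # as)", OF _ _ G1 as])
      fix i assume "i < ?l"
      then show "P (Suc i) \<subseteq> P (Suc (Suc i)) \<and> xs ! i \<in> P (Suc (Suc i)) \<and> xs ! i \<notin> P (Suc i)"
        using Cons.prems(2)[of "Suc i"] by simp
    qed (use prime in auto)
    then show False using i0(2) by blast
  qed
qed

section \<open>Modules finitely generated over fewer variables\<close>

text \<open>The Leibniz formula builds the determinant from sums, products and signs of entries. The
  closed set \<open>X\<close> is a parameter because the lemma serves both for elements of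
  \<open>polys n\<close> and for univariate polynomials with coefficients in
  \<open>polys t\<close>.\<close>

lemma det_mem_subring:
  fixes A :: "'a::comm_ring_1 mat"
  assumes A: "A \<in> carrier_mat g g" "\<And>i j. i < g \<Longrightarrow> j < g \<Longrightarrow> A $$ (i, j) \<in> X"
    and X: "0 \<in> X" "1 \<in> X" "\<And>a b. a \<in> X \<Longrightarrow> b \<in> X \<Longrightarrow> a + b \<in> X"
      "\<And>a b. a \<in> X \<Longrightarrow> b \<in> X \<Longrightarrow> a * b \<in> X" "\<And>a. a \<in> X \<Longrightarrow> - a \<in> X"
  shows "det A \<in> X"
proof -
  have sum: "sum f I \<in> X" if "\<And>i. i \<in> I \<Longrightarrow> f i \<in> X" for f and I :: "(nat \<Rightarrow> nat) set"
    using that by (induction I rule: infinite_finite_induct) (auto intro: X)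
  have prod: "prod f I \<in> X" if "\<And>i. i \<in> I \<Longrightarrow> f i \<in> X" for f and I :: "nat set"
    using that by (induction I rule: infinite_finite_induct) (auto intro: X)
  have "signof p \<in> X" for p :: "nat \<Rightarrow> nat"
    using X(2) X(5)[OF X(2)] by (simp add: sign_def)
  moreover have "p i < g" if "p permutes {0..<g}" "i < g" for p i
    using permutes_in_image[OF that(1), of i] that(2) by simp
  ultimately show ?thesis
    unfolding det_def'[OF A(1)] using A(2) by (intro sum X(4) prod) auto
qed

text \<open>The quotient by \<open>N\<close> is never formed: everything is congruence modulo
  \<open>N\<close> in an ambient type with a total scalar multiplication. The last assumption says
  that, modulo \<open>N\<close>, the span of the \<open>e j\<close> over k[d_1,...,d_t] is stable
  under all of D.\<close>

locale fg_module = Modules.module scale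
  for scale :: "'k::field mpoly \<Rightarrow> 'e::ab_group_add \<Rightarrow> 'e" (infixr \<open>*s\<close> 75) +
  fixes n t :: nat and N :: "'e set" and g :: nat and e :: "nat \<Rightarrow> 'e"
  assumes t_le_n: "t \<le> n"
    and N_zero: "0 \<in> N"
    and N_add: "x \<in> N \<Longrightarrow> y \<in> N \<Longrightarrow> x + y \<in> N"
    and N_scale: "a \<in> polys n \<Longrightarrow> x \<in> N \<Longrightarrow> a *s x \<in> N"
    and generators: "f \<in> polys n \<Longrightarrow> j < g \<Longrightarrow>
      \<exists>c. (\<forall>b<g. c b \<in> polys t) \<and> f *s e j - (\<Sum>b<g. c b *s e b) \<in> N"
begin

lemma N_sum: "(\<And>i. i \<in> I \<Longrightarrow> f i \<in> N) \<Longrightarrow> sum f I \<in> N"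
  by (induction I rule: infinite_finite_induct) (auto intro: N_zero N_add)

lemma poly_ring_t_n: "a \<in> polys t \<Longrightarrow> a \<in> polys n"
  using poly_ring_mono t_le_n by blast

text \<open>The annihilator in D of the images of \<open>Z\<close> modulo \<open>N\<close>: a
  one-element \<open>Z\<close> gives ann(x), a set of generators the annihilator of the whole
  module.\<close>

definition ann :: "'e set \<Rightarrow> 'k mpoly set" where
  "ann Z = {f \<in> polys n. \<forall>z\<in>Z. f *s z \<in> N}"

lemma ideal_ann: "ideal (ann Z) (poly_ring n)"
  unfolding ideal_poly_ring_iff ann_def
  by (auto simp: N_zero scale_left_distrib N_add N_scale simp flip: scale_scale)

text \<open>The determinant trick: \<open>f\<close> acts on the generators through a matrix
  \<open>C\<close> over k[d_1,...,d_t], and the adjugate of f I - C shows that the characteristic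
  polynomial of \<open>C\<close>, evaluated at \<open>f\<close>, kills every generator modulo
  \<open>N\<close>.\<close>

lemma integral_ann_generators:
  assumes f: "f \<in> polys n"
  shows "integral_mod t (ann (e ` {..<g})) f"
proof -
  obtain c where c: "\<And>a b. a < g \<Longrightarrow> b < g \<Longrightarrow> c a b \<in> polys t"
    "\<And>a. a < g \<Longrightarrow> f *s e a - (\<Sum>b<g. c a b *s e b) \<in> N"
    using generators[OF f] by metis
  define C where "C = mat g g (\<lambda>(a, b). c a b)"
  define B where "B = mat g g (\<lambda>(a, b). (if a = b then f else 0) - c a b)"
  have C: "C \<in> carrier_mat g g" and B: "B \<in> carrier_mat g g" by (auto simp: C_def B_def)
  let ?h = "\<lambda>p. poly p f"
  have h: "comm_ring_hom ?h" by unfold_locales auto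
  \<comment> \<open>\<open>B\<close> is f I - C, that is, the characteristic matrix evaluated at
    \<open>f\<close>; evaluation is a ring homomorphism and commutes with the determinant.\<close>
  have "map_mat ?h (char_poly_matrix C) = B"
    by (rule eq_matI) (auto simp: char_poly_matrix_def C_def B_def)
  then have detB: "det B = poly (char_poly C) f"
    unfolding char_poly_def by (metis comm_ring_hom.hom_det[OF h])
  have ent: "B $$ (a, b) \<in> polys n" if "a < g" "b < g" for a b
    using that c(1) f poly_ring_t_n by (auto simp: B_def)
  have adj: "adj_mat B $$ (k, a) \<in> polys n" if k: "k < g" "a < g" for k a
  proof -
    have "mat_delete B a k \<in> carrier_mat (g - 1) (g - 1)" using B mat_delete_carrier by blast
    moreover have "mat_delete B a k $$ (i, j) \<in> polys n" if "i < g - 1" "j < g - 1" for i j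
      using B that k by (auto simp: mat_delete_def intro!: ent)
    ultimately have "det (mat_delete B a k) \<in> polys n"
      by (intro det_mem_subring[of _ "g - 1"]) auto
    then show ?thesis using B k by (simp add: adj_mat_def cofactor_def)
  qed
  have row: "f *s e a - (\<Sum>b<g. c a b *s e b) = (\<Sum>b<g. B $$ (a, b) *s e b)" if "a < g" for a
  proof -
    have "(\<Sum>b<g. B $$ (a, b) *s e b) = (\<Sum>b<g. (if a = b then f *s e a else 0) - c a b *s e b)"
      using that by (intro sum.cong) (auto simp: B_def scale_left_diff_distrib)
    then show ?thesis using that by (simp add: sum_subtractf)
  qed
  have "poly (char_poly C) f *s e k \<in> N" if k: "k < g" for k
  proof -
    have entry: "(\<Sum>a<g. adj_mat B $$ (k, a) * B $$ (a, b)) = (if k = b then det B else 0)" if b: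
      "b < g" for b
    proof -
      have "(adj_mat B * B) $$ (k, b) = (det B \<cdot>\<^sub>m 1\<^sub>m g) $$ (k, b)"
        by (simp add: adj_mat(3)[OF B])
      then show ?thesis
        using adj_mat(1)[OF B] B k b by (simp add: scalar_prod_def atLeast0LessThan)
    qed
    \<comment> \<open>The relations given by the rows of \<open>B\<close> are combined with the
      entries of row \<open>k\<close> of the adjugate; what remains is \<open>det B\<close> times
      \<open>e k\<close>.\<close>
    have "(\<Sum>a<g. adj_mat B $$ (k, a) *s (\<Sum>b<g. B $$ (a, b) *s e b)) =
        (\<Sum>b<g. (\<Sum>a<g. adj_mat B $$ (k, a) * B $$ (a, b)) *s e b)"
      unfolding scale_sum_right scale_sum_left scale_scale by (rule sum.swap)
    also have "\<dots> = (\<Sum>b<g. (if k = b then det B *s e k else 0))"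
      by (intro sum.cong) (auto simp: entry)
    also have "\<dots> = det B *s e k" using k by simp
    finally have "det B *s e k = (\<Sum>a<g. adj_mat B $$ (k, a) *s (\<Sum>b<g. B $$ (a, b) *s e b))" by simp
    also have "\<dots> \<in> N"
    proof (rule N_sum)
      fix a assume "a \<in> {..<g}"
      then show "adj_mat B $$ (k, a) *s (\<Sum>b<g. B $$ (a, b) *s e b) \<in> N"
        using c(2)[of a] row[of a] adj k by (intro N_scale) auto
    qed
    finally show ?thesis by (simp add: detB)
  qed
  moreover have "coeff (char_poly C) i \<in> polys t" for i
  proof -
    \<comment> \<open>Univariate polynomials with coefficients in \<open>polys t\<close> are closed
      under the ring operations, so the determinant stays among them.\<close>
    have "char_poly C \<in> {p. \<forall>i. coeff p i \<in> polys t}"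
      unfolding char_poly_def
    proof (rule det_mem_subring[of _ g])
      show "char_poly_matrix C \<in> carrier_mat g g" using C by simp
    next
      fix i j assume ij: "i < g" "j < g"
      then show "char_poly_matrix C $$ (i, j) \<in> {p. \<forall>i. coeff p i \<in> polys t}"
        using c(1)[OF ij] by (auto simp: char_poly_matrix_def C_def coeff_pCons split: nat.splits)
    qed (auto simp: coeff_mult coeff_pCons split: nat.splits)
    then show ?thesis by blast
  qed
  moreover have "lead_coeff (char_poly C) = 1"
    using degree_monic_char_poly[OF C] by simp
  moreover have "poly (char_poly C) f \<in> polys n"
    unfolding poly_altdef using calculation(2) f poly_ring_t_n by (intro poly_ring_sum) auto
  ultimately show ?thesis unfolding integral_mod_def ann_def by blast
qed

section \<open>Growth of coordinates under multiplication by D\<close>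

definition span_box :: "nat \<Rightarrow> 'e set" where
  "span_box d = {z. \<exists>v. (\<forall>b<g. v b \<in> poly_box t d) \<and> z - (\<Sum>b<g. v b *s e b) \<in> N}"

lemma span_box_mono: "z \<in> span_box d \<Longrightarrow> d \<le> d' \<Longrightarrow> z \<in> span_box d'"
  unfolding span_box_def using poly_box_mono by blast

lemma span_boxI:
  assumes "\<forall>b<g. c b \<in> polys t" "z - (\<Sum>b<g. c b *s e b) \<in> N"
  shows "\<exists>d. z \<in> span_box d"
proof -
  have "\<exists>d. c b \<in> poly_box t d" if "b < g" for b
    using poly_box_exists assms(1) that by blast
  then obtain d where d: "\<And>b. b < g \<Longrightarrow> c b \<in> poly_box t (d b)" by metis
  have "c b \<in> poly_box t (\<Sum>b<g. d b)" if "b < g" for b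
    using poly_box_mono[OF d[OF that]] member_le_sum[of b "{..<g}" d] that by simp
  then show ?thesis using assms(2) unfolding span_box_def by blast
qed

text \<open>Multiplication by \<open>f\<close> composes coordinates with the matrix of
  \<open>f\<close> on the generators, whose entries have bounded exponents. The increment
  \<open>C\<close> depends on \<open>f\<close> alone, not on the vector.\<close>

lemma span_box_scale:
  assumes f: "f \<in> polys n"
  obtains C where "\<And>d z. z \<in> span_box d \<Longrightarrow> f *s z \<in> span_box (d + C)"
proof -
  obtain c where c: "\<And>a b. a < g \<Longrightarrow> b < g \<Longrightarrow> c a b \<in> polys t"
    "\<And>a. a < g \<Longrightarrow> f *s e a - (\<Sum>b<g. c a b *s e b) \<in> N"
    using generators[OF f] by metis
  have "\<exists>d. c a b \<in> poly_box t d" if "a < g" "b < g" for a b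
    using poly_box_exists[OF c(1)[OF that]] by blast
  then obtain D where D: "\<And>a b. a < g \<Longrightarrow> b < g \<Longrightarrow> c a b \<in> poly_box t (D a b)"
    by metis
  \<comment> \<open>The sum of all the bounds dominates each of them.\<close>
  define C where "C = (\<Sum>a<g. \<Sum>b<g. D a b)"
  have "D a b \<le> C" if "a < g" "b < g" for a b
  proof -
    have "D a b \<le> (\<Sum>b<g. D a b)" using that by (intro member_le_sum) auto
    also have "\<dots> \<le> C" unfolding C_def using that(1) by (intro member_le_sum) auto
    finally show ?thesis .
  qed
  then have CC: "c a b \<in> poly_box t C" if "a < g" "b < g" for a b
    using that D poly_box_mono by blast
  show thesis
  proof
    fix d z assume "z \<in> span_box d"
    then obtain v where v: "\<And>b. b < g \<Longrightarrow> v b \<in> poly_box t d" "z - (\<Sum>b<g. v b *s e b) \<in> N"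
      unfolding span_box_def by blast
    define w where "w = (\<lambda>b. \<Sum>a<g. v a * c a b)"
    have "w b \<in> poly_box t (d + C)" if "b < g" for b
      unfolding w_def using v(1) CC that by (intro poly_box_sum poly_box_mult) auto
    moreover have "f *s z - (\<Sum>b<g. w b *s e b) \<in> N"
    proof -
      have 1: "(\<Sum>b<g. w b *s e b) = (\<Sum>a<g. v a *s (\<Sum>b<g. c a b *s e b))"
        unfolding w_def scale_sum_right scale_sum_left scale_scale by (rule sum.swap)
      have 2: "f *s (\<Sum>a<g. v a *s e a) = (\<Sum>a<g. v a *s (f *s e a))"
        unfolding scale_sum_right scale_scale by (simp add: mult.commute)
      have "f *s z - (\<Sum>b<g. w b *s e b) =
          f *s (z - (\<Sum>b<g. v b *s e b)) + (\<Sum>a<g. v a *s (f *s e a - (\<Sum>b<g. c a b *s e b)))"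
        unfolding 1 scale_right_diff_distrib 2 sum_subtractf by simp
      also have "\<dots> \<in> N"
        using f v c(2) poly_box_carrier poly_ring_t_n by (intro N_add N_scale N_sum) blast+
      finally show ?thesis .
    qed
    ultimately show "f *s z \<in> span_box (d + C)" unfolding span_box_def by blast
  qed
qed

lemma span_box_power:
  assumes "\<And>d z. z \<in> span_box d \<Longrightarrow> f *s z \<in> span_box (d + C)" "z \<in> span_box d"
  shows "f ^ i *s z \<in> span_box (d + C * i)"
proof (induction i)
  case (Suc i)
  show ?case using assms(1)[OF Suc] by (simp add: algebra_simps)
qed (use assms(2) in simp)

text \<open>Iterating the bound for one factor, the growth is linear in the largest exponent
  \<open>p\<close>, with a constant independent of the monomial. The counting argument rests on this
  linearity.\<close>

lemma span_box_monomial: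
  assumes "set xs \<subseteq> polys n"
  obtains C where "\<And>p d z as. as \<in> exponent_lists p (length xs) \<Longrightarrow> z \<in> span_box d \<Longrightarrow>
    monomial_of xs as *s z \<in> span_box (d + C * p)"
  using assms
proof (induction xs arbitrary: thesis)
  case Nil
  show ?case by (rule Nil(1)[of 0]) simp
next
  case (Cons x xs)
  obtain C where C: "\<And>p d z as. as \<in> exponent_lists p (length xs) \<Longrightarrow> z \<in> span_box d \<Longrightarrow>
    monomial_of xs as *s z \<in> span_box (d + C * p)"
    using Cons by auto
  have "x \<in> polys n" using Cons.prems(2) by simp
  then obtain C' where C': "\<And>d z. z \<in> span_box d \<Longrightarrow> x *s z \<in> span_box (d + C')"
    using span_box_scale by blast
  show ?case
  proof (rule Cons.prems(1))
    fix p d z as assume "as \<in> exponent_lists p (length (x # xs))" and z: "z \<in> span_box d"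
    then obtain i as' where as: "as = i # as'" "i \<le> p" "as' \<in> exponent_lists p (length xs)"
      by (auto simp: exponent_lists_def length_Suc_conv)
    have "x ^ i *s (monomial_of xs as' *s z) \<in> span_box (d + C * p + C' * i)"
      by (rule span_box_power[OF C' C[OF as(3) z]])
    moreover have "d + C * p + C' * i \<le> d + (C + C') * p"
      using as(2) by (simp add: algebra_simps)
    ultimately show "monomial_of (x # xs) as *s z \<in> span_box (d + (C + C') * p)"
      using span_box_mono by (auto simp: as(1))
  qed
qed

text \<open>If \<open>l \<ge> t\<close>, the monomials in \<open>a\<close> and in elements of the successive differences of the chain
  would be \<open>t + 1\<close> parameters' worth of vectors whose coordinates are polynomials in \<open>t\<close> variables,
  so they would satisfy a linear relation; the lowest power of \<open>a\<close> can be cancelled from it.\<close>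

lemma prime_chain_short:
  assumes Z: "finite Z" "\<And>z. z \<in> Z \<Longrightarrow> \<exists>d. z \<in> span_box d"
    and a: "a \<in> polys t" "a \<noteq> 0" "a \<in> P 0" and ann: "ann Z \<subseteq> P 0"
    and P: "\<And>i. i \<le> l \<Longrightarrow> primeideal (P i) (poly_ring n)" "\<And>i. i < l \<Longrightarrow> P i \<subset> P (Suc i)"
  shows "l < t"
proof (rule ccontr)
  assume "\<not> l < t"
  then have tl: "t \<le> l" by simp
  \<comment> \<open>The first \<open>t\<close> steps of the chain provide one element each; together
    with \<open>a\<close> these are \<open>t + 1\<close> elements.\<close>
  have "\<exists>x. i < t \<longrightarrow> x \<in> P (Suc i) \<and> x \<notin> P i" for i using P(2)[of i] tl by auto
  then obtain y where y: "\<And>i. i < t \<Longrightarrow> y i \<in> P (Suc i) \<and> y i \<notin> P i" by metis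
  define xs where "xs = map y [0..<t]"
  have len: "length xs = t" by (simp add: xs_def)
  have prime: "primeideal (P i) (poly_ring n)" if "i \<le> t" for i using P(1) that tl by simp
  then have id: "ideal (P i) (poly_ring n)" if "i \<le> t" for i
    using that by (auto simp: primeideal_poly_ring_iff)
  have xs: "set xs \<subseteq> polys n"
  proof
    fix x assume "x \<in> set xs"
    then obtain i where "i < t" "x = y i" by (auto simp: xs_def)
    then show "x \<in> polys n"
      using y[of i] ideal_poly_ring_closed(1)[OF id[of "Suc i"]] by auto
  qed
  obtain C where C: "\<And>p d z as. as \<in> exponent_lists p t \<Longrightarrow> z \<in> span_box d \<Longrightarrow>
    monomial_of xs as *s z \<in> span_box (d + C * p)"
    using span_box_monomial[OF xs] len by metis
  obtain D where D: "a \<in> poly_box t D" using poly_box_exists[OF a(1)] .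
  obtain dz where dz: "\<And>z. z \<in> Z \<Longrightarrow> z \<in> span_box (dz z)" using Z(2) by metis
  define d0 where "d0 = (\<Sum>z\<in>Z. dz z)"
  have d0: "z \<in> span_box d0" if "z \<in> Z" for z
    using span_box_mono[OF dz[OF that]] member_le_sum[of z Z dz] that Z(1) by (simp add: d0_def)
  \<comment> \<open>\<open>E * (p + 1)\<close> is a side length, linear in \<open>p\<close>, of a
    box holding all coordinates \<open>w\<close>; the summand 1 keeps it positive. With
    \<open>p\<close> as below there are at most \<open>p * (p + 1) ^ t\<close> equations, fewer than
    the (p + 1)^(t + 1) unknowns.\<close>
  define E where "E = D + d0 + C + 1"
  define p where "p = card (Z \<times> {..<g}) * E ^ t"
  have "\<forall>as z. \<exists>v. as \<in> exponent_lists p t \<and> z \<in> Z \<longrightarrow>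
      (\<forall>b<g. v b \<in> poly_box t (d0 + C * p)) \<and> monomial_of xs as *s z - (\<Sum>b<g. v b *s e b) \<in> N"
    using C[OF _ d0] unfolding span_box_def by blast
  then obtain v where v: "\<And>as z b. as \<in> exponent_lists p t \<Longrightarrow> z \<in> Z \<Longrightarrow> b < g \<Longrightarrow> v as z b
    \<in> poly_box t (d0 + C * p)"
    "\<And>as z. as \<in> exponent_lists p t \<Longrightarrow> z \<in> Z \<Longrightarrow> monomial_of xs as *s z - (\<Sum>b<g. v as z b *s e b) \<in> N"
    by metis
  let ?I = "exponent_lists p (Suc t)" and ?L = "exponent_lists p t"
  \<comment> \<open>Coordinates of a member of \<open>Z\<close> multiplied by the monomial of the
    tail exponents and by \<open>a\<close> to the head exponent. As \<open>a\<close> lies in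
    k[d_1,...,d_t], it multiplies coordinates directly.\<close>
  define w where "w = (\<lambda>as zb. a ^ hd as * v (tl as) (fst zb) (snd zb))"
  obtain c where c: "\<exists>as\<in>?I. c as \<noteq> 0"
    "\<And>zb. zb \<in> Z \<times> {..<g} \<Longrightarrow> (\<Sum>as\<in>?I. single 0 (c as) * w as zb) = 0"
  proof (rule linear_relation_in_poly_box[of ?I "Z \<times> {..<g}" w t "E * (p + 1) - 1"])
    fix as zb assume "as \<in> ?I" and zb: "zb \<in> Z \<times> {..<g}"
    then obtain i as' where as: "as = i # as'" "i \<le> p" "as' \<in> ?L"
      by (auto simp: exponent_lists_def length_Suc_conv)
    have "w as zb = a ^ i * v as' (fst zb) (snd zb)" by (simp add: w_def as(1))
    also have "\<dots> \<in> poly_box t (D * i + (d0 + C * p))"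
      using v(1)[OF as(3)] zb by (intro poly_box_mult poly_box_power D) auto
    finally have "w as zb \<in> poly_box t (D * i + (d0 + C * p))" .
    moreover have "D * i \<le> D * p" using as(2) by simp
    moreover have "E * (p + 1) - 1 = D * p + d0 * p + C * p + p + D + d0 + C"
      by (simp add: E_def algebra_simps)
    ultimately show "w as zb \<in> poly_box t (E * (p + 1) - 1)"
      by (elim poly_box_mono) linarith
  next
    have "E * (p + 1) - 1 + 1 = E * (p + 1)" by (simp add: E_def)
    then have "card (Z \<times> {..<g}) * (E * (p + 1) - 1 + 1) ^ t = p * (p + 1) ^ t"
      by (simp only: p_def power_mult_distrib mult.assoc)
    also have "\<dots> < (p + 1) * (p + 1) ^ t" by (intro mult_strict_right_mono) auto
    finally show "card (Z \<times> {..<g}) * (E * (p + 1) - 1 + 1) ^ t < card ?I"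
      by (simp add: card_exponent_lists)
  qed (use Z(1) finite_exponent_lists in auto)
  define V where "V = (\<lambda>i z b. \<Sum>as\<in>?L. single 0 (c (i # as)) * v as z b)"
  define G where "G = (\<lambda>i. \<Sum>as\<in>?L. single 0 (c (i # as)) * monomial_of xs as)"
  have Vsum: "(\<Sum>i\<le>p. a ^ i * V i z b) = 0" if "z \<in> Z" "b < g" for z b
    using c(2)[of "(z, b)"] that
    by (simp add: sum_exponent_lists_Suc w_def V_def sum_distrib_left algebra_simps)
  have ex: "\<exists>i. i \<le> p \<and> (\<exists>as\<in>?L. c (i # as) \<noteq> 0)"
  proof -
    obtain as where "as \<in> ?I" "c as \<noteq> 0" using c(1) by blast
    then show ?thesis
      by (intro exI[of _ "hd as"] conjI bexI[of _ "tl as"])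
        (auto simp: exponent_lists_def length_Suc_conv)
  qed
  define i0 where "i0 = (LEAST i. i \<le> p \<and> (\<exists>as\<in>?L. c (i # as) \<noteq> 0))"
  have i0: "i0 \<le> p" "\<exists>as\<in>?L. c (i0 # as) \<noteq> 0"
    using LeastI_ex[OF ex] unfolding i0_def by auto
  have lower: "c (i # as) = 0" if "i < i0" "as \<in> ?L" for i as
    using not_less_Least[OF that(1)[unfolded i0_def]] that i0(1) by auto
  then have V0: "V i z b = 0" if "i < i0" for i z b
    using that unfolding V_def by (intro sum.neutral) auto
  have G0: "G i = 0" if "i < i0" for i
    using that lower unfolding G_def by (intro sum.neutral) auto
  \<comment> \<open>The cancellation takes place among the coordinates, which are polynomials, so
    \<open>a \<noteq> 0\<close> suffices; on the module itself \<open>a\<close> may be a zero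
    divisor.\<close>
  have V1: "(\<Sum>i\<in>{i0..p}. a ^ (i - i0) * V i z b) = 0" if "z \<in> Z" "b < g" for z b
    using sum_power_extract_lowest(1)[of i0 "\<lambda>i. V i z b" p a] V0 i0(1) Vsum[OF that] a(2) by simp
  define F where "F = (\<Sum>i\<in>{i0..p}. a ^ (i - i0) * G i)"
  have aD: "a \<in> polys n" by (rule poly_ring_t_n[OF a(1)])
  have G: "G i \<in> polys n" for i
    unfolding G_def using monomial_of_poly_ring[OF xs] by (intro poly_ring_sum) auto
  \<comment> \<open>The coordinates of \<open>F\<close> times \<open>z\<close> are the sums that
    vanish by \<open>V1\<close>, so \<open>F\<close> annihilates \<open>Z\<close> modulo
    \<open>N\<close> and falls into \<open>P 0\<close>.\<close>
  have "F *s z \<in> N" if z: "z \<in> Z" for z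
  proof -
    have "G i *s z - (\<Sum>b<g. V i z b *s e b) \<in> N" for i
    proof -
      have "(\<Sum>b<g. V i z b *s e b) = (\<Sum>as\<in>?L. single 0 (c (i # as)) *s (\<Sum>b<g. v as z b *s e b))"
        unfolding V_def scale_sum_right scale_sum_left scale_scale by (rule sum.swap)
      then have "G i *s z - (\<Sum>b<g. V i z b *s e b) =
        (\<Sum>as\<in>?L. single 0 (c (i # as)) *s (monomial_of xs as *s z - (\<Sum>b<g. v as z b *s e b)))"
        by (simp add: G_def scale_sum_left scale_right_diff_distrib sum_subtractf)
      also have "\<dots> \<in> N" using v(2) z by (intro N_sum N_scale) auto
      finally show ?thesis .
    qed
    then have "(\<Sum>i\<in>{i0..p}. a ^ (i - i0) *s (G i *s z - (\<Sum>b<g. V i z b *s e b))) \<in> N"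
      using aD by (intro N_sum N_scale) auto
    also have "(\<Sum>i\<in>{i0..p}. a ^ (i - i0) *s (G i *s z - (\<Sum>b<g. V i z b *s e b))) =
       F *s z - (\<Sum>i\<in>{i0..p}. \<Sum>b<g. (a ^ (i - i0) * V i z b) *s e b)"
      by (simp add: F_def scale_sum_left scale_right_diff_distrib sum_subtractf scale_sum_right)
    also have "(\<Sum>i\<in>{i0..p}. \<Sum>b<g. (a ^ (i - i0) * V i z b) *s e b) =
       (\<Sum>b<g. (\<Sum>i\<in>{i0..p}. a ^ (i - i0) * V i z b) *s e b)"
      unfolding scale_sum_left by (rule sum.swap)
    also have "\<dots> = 0" using V1[OF z] by simp
    finally show ?thesis by simp
  qed
  moreover have "F \<in> polys n"
    unfolding F_def using aD G by (intro poly_ring_sum) auto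
  ultimately have "F \<in> P 0" using ann unfolding ann_def by blast
  let ?h = "\<Sum>i\<in>{Suc i0..p}. a ^ (i - Suc i0) * G i"
  \<comment> \<open>Modulo \<open>P 0\<close>, which contains \<open>a\<close>, only the term
    \<open>G i0\<close> survives: a nontrivial relation among the chain elements.\<close>
  have "F = G i0 + a * ?h"
    unfolding F_def using G0 i0(1) by (intro sum_power_extract_lowest(2)) auto
  moreover have "?h \<in> polys n" using aD G by (intro poly_ring_sum) auto
  ultimately have "F - a * ?h \<in> P 0"
    using \<open>F \<in> P 0\<close> a(3) by (intro ideal_poly_ring_closed(7)[OF id] ideal_poly_ring_closed(5)[OF
      id]) auto
  then have "G i0 \<in> P 0" using \<open>F = G i0 + a * ?h\<close> by simp
  then have Gmem: "(\<Sum>as\<in>exponent_lists p (length xs). single 0 (c (i0 # as)) * monomial_of xs as)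
    \<in> P 0"
    by (simp add: G_def len)
  have "c (i0 # as) = 0" if "as \<in> ?L" for as
  proof (rule chain_algebraically_independent[where c = "\<lambda>as. c (i0 # as)" and xs = xs and P = P
    and p = p, OF _ _ Gmem])
    fix i assume "i < length xs"
    then show "P i \<subseteq> P (Suc i) \<and> xs ! i \<in> P (Suc i) \<and> xs ! i \<notin> P i"
      using P(2)[of i] y[of i] tl by (auto simp: xs_def)
  qed (use that prime len in auto)
  then show False using i0(2) by blast
qed

text \<open>By incomparability the second prime of the chain contains an element of k[d_1,...,d_t]
  outside the first, in particular a nonzero one. Dropping the bottom prime leaves a chain of length
  \<open>l - 1\<close> to which the strict bound applies.\<close>

lemma prime_chain_length_le:
  assumes Z: "finite Z" "\<And>z. z \<in> Z \<Longrightarrow> \<exists>d. z \<in> span_box d"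
    and int: "\<And>f. f \<in> polys n \<Longrightarrow> integral_mod t (ann Z) f" and ann: "ann Z \<subseteq> P 0"
    and P: "\<And>i. i \<le> l \<Longrightarrow> primeideal (P i) (poly_ring n)" "\<And>i. i < l \<Longrightarrow> P i \<subset> P (Suc i)"
  shows "l \<le> t"
proof (cases l)
  case (Suc l')
  obtain x where x: "x \<in> P 1" "x \<notin> P 0" using P(2)[of 0] Suc by auto
  have id: "ideal (P 1) (poly_ring n)" using P(1)[of 1] Suc by (simp add: primeideal_poly_ring_iff)
  obtain a where a: "a \<in> polys t" "a \<in> P 1" "a \<notin> P 0"
    using incomparability[OF P(1)[of 0] id, of x t] x P(2)[of 0] Suc t_le_n
      integral_mod_mono[OF int ann] ideal_poly_ring_closed(1)[OF id] by auto
  have "a \<noteq> 0" using a(3) P(1)[of 0] ideal_poly_ring_closed(2) by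
    (auto simp: primeideal_poly_ring_iff)
  then have "l' < t"
    using a P[of "Suc _"] P(2)[of 0] Suc ann
    by (intro prime_chain_short[OF Z, of a "\<lambda>i. P (Suc i)" l']) auto
  then show ?thesis using Suc by simp
qed simp

end

section \<open>Krull dimension of quotient rings\<close>

text \<open>The correspondence between primes of the quotient and primes containing
  \<open>J\<close>, by image and preimage, preserves strict inclusion in both directions and hence
  the lengths of chains.\<close>

lemma krull_dim_Quot:
  fixes R (structure)
  assumes "cring R" and J: "ideal J R"
  shows "krull_dim (R Quot J) =
    Sup {enat l | l. \<exists>P. (\<forall>i\<le>l. primeideal (P i) R \<and> J \<subseteq> P i) \<and> (\<forall>i<l. P i \<subset> P (Suc i))}"
proof -
  have zero: "\<zero>\<^bsub>R Quot J\<^esub> = J" by (simp add: FactRing_def)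
  interpret cring R by fact
  interpret Q: cring "R Quot J" using J is_cring by (rule ideal.quotient_is_cring)
  interpret h: ring_hom_ring R "R Quot J" "(+>) J" using J by (rule ideal.rcos_ring_hom_ring)
  note JR = additive_subgroup.a_subset[OF ideal.axioms(1)[OF J]]
  have Jzero: "J +> x = \<zero>\<^bsub>R Quot J\<^esub>" if "x \<in> J" for x
    unfolding zero by (rule a_rcos_zero[OF J that])
  have carr: "\<exists>x\<in>carrier R. X = J +> x" if "X \<in> carrier (R Quot J)" for X
    using that unfolding FactRing_def A_RCOSETS_def' by auto
  \<comment> \<open>Representatives of one coset differ by an element of \<open>J\<close>, hence of
    \<open>P\<close>.\<close>
  have mem_img: "x \<in> P" if P: "ideal P R" "J \<subseteq> P" and x: "x \<in> carrier R" "J +> x \<in> (+>) J ` P"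
    for P x
  proof -
    obtain p where p: "p \<in> P" "J +> x = J +> p" using x(2) by blast
    have pc: "p \<in> carrier R" using p(1) P(1) by (simp add: ideal.Icarr)
    have "x \<ominus> p \<in> P"
      using quotient_eq_iff_same_a_r_cos[OF J x(1) pc] p(2) P(2) by blast
    then have "(x \<ominus> p) \<oplus> p \<in> P"
      using p(1) P(1) by (simp add: additive_subgroup.a_closed ideal.axioms(1))
    then show ?thesis using x(1) pc by (simp add: a_minus_def a_assoc l_neg)
  qed
  have img: "primeideal ((+>) J ` P) (R Quot J)" if P: "primeideal P R" "J \<subseteq> P" for P
  proof (rule primeidealI)
    have idP: "ideal P R" using P(1) by (rule primeideal.axioms)
    show "ideal ((+>) J ` P) (R Quot J)" using J idP by (rule ring_ideal_imp_quot_ideal)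
    show "cring (R Quot J)" by (rule Q.is_cring)
    show "carrier (R Quot J) \<noteq> (+>) J ` P"
    proof
      assume eq: "carrier (R Quot J) = (+>) J ` P"
      have "P = carrier R"
      proof
        show "P \<subseteq> carrier R" using ideal.Icarr[OF idP] by blast
        show "carrier R \<subseteq> P"
        proof
          fix x assume "x \<in> carrier R"
          then show "x \<in> P" using mem_img[OF idP P(2)] h.hom_closed eq by simp
        qed
      qed
      then show False using primeideal.I_notcarr[OF P(1)] by simp
    qed
    fix X Y assume XY: "X \<in> carrier (R Quot J)" "Y \<in> carrier (R Quot J)"
      "X \<otimes>\<^bsub>R Quot J\<^esub> Y \<in> (+>) J ` P"
    obtain x y where xy: "x \<in> carrier R" "y \<in> carrier R" "X = J +> x" "Y = J +> y"
      using carr[OF XY(1)] carr[OF XY(2)] by auto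
    then have "J +> (x \<otimes> y) \<in> (+>) J ` P" using XY(3) by simp
    then have "x \<otimes> y \<in> P" using mem_img[OF idP P(2)] xy by simp
    then show "X \<in> (+>) J ` P \<or> Y \<in> (+>) J ` P"
      using primeideal.I_prime[OF P(1)] xy by blast
  qed
  have vimg: "primeideal {x \<in> carrier R. J +> x \<in> P} R \<and> J \<subseteq> {x \<in> carrier R. J +> x \<in> P}"
    if P: "primeideal P (R Quot J)" for P
  proof
    show "primeideal {x \<in> carrier R. J +> x \<in> P} R"
      using is_cring P by (rule h.primeideal_vimage)
    have "\<zero>\<^bsub>R Quot J\<^esub> \<in> P"
      using P by (simp add: additive_subgroup.zero_closed ideal.axioms(1) primeideal.axioms(1))
    then show "J \<subseteq> {x \<in> carrier R. J +> x \<in> P}"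
      using Jzero JR by (intro subsetI CollectI conjI) (simp_all add: subsetD)
  qed
  have "(\<exists>P. (\<forall>i\<le>l. primeideal (P i) (R Quot J)) \<and> (\<forall>i<l. P i \<subset> P (Suc i))) \<longleftrightarrow>
    (\<exists>P. (\<forall>i\<le>l. primeideal (P i) R \<and> J \<subseteq> P i) \<and> (\<forall>i<l. P i \<subset> P (Suc i)))" (is "?L \<longleftrightarrow> ?R") for l
  proof
    assume ?L
    then obtain P where P: "\<forall>i\<le>l. primeideal (P i) (R Quot J)" "\<forall>i<l. P i \<subset> P (Suc i)" by blast
    define P' where "P' = (\<lambda>i. {x \<in> carrier R. J +> x \<in> P i})"
    have "P' i \<subset> P' (Suc i)" if i: "i < l" for i
    proof -
      obtain X where X: "X \<in> P (Suc i)" "X \<notin> P i" using P(2) i by blast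
      have "ideal (P (Suc i)) (R Quot J)" using P(1) i by (simp add: primeideal.axioms(1))
      then have "X \<in> carrier (R Quot J)" using X(1) by (rule ideal.Icarr)
      then obtain x where "x \<in> carrier R" "X = J +> x" using carr by (auto dest: carr)
      then have "x \<in> P' (Suc i)" "x \<notin> P' i" using X by (auto simp: P'_def)
      moreover have "P' i \<subseteq> P' (Suc i)" using P(2) i by (auto simp: P'_def)
      ultimately show ?thesis by blast
    qed
    moreover have "primeideal (P' i) R \<and> J \<subseteq> P' i" if "i \<le> l" for i
      unfolding P'_def using P(1) that by (intro vimg) simp
    ultimately show ?R by blast
  next
    assume ?R
    then obtain P where P: "\<forall>i\<le>l. primeideal (P i) R \<and> J \<subseteq> P i" "\<forall>i<l. P i \<subset> P (Suc i)" by blast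
    have "(+>) J ` P i \<subset> (+>) J ` P (Suc i)" if i: "i < l" for i
    proof -
      have id: "ideal (P i) R" "ideal (P (Suc i)) R" using P(1) i by
        (auto simp: primeideal.axioms(1))
      obtain x where x: "x \<in> P (Suc i)" "x \<notin> P i" using P(2) i by blast
      then have "J +> x \<notin> (+>) J ` P i"
        using mem_img[OF id(1), of x] P(1) i ideal.Icarr[OF id(2)] by auto
      moreover have "J +> x \<in> (+>) J ` P (Suc i)" using x(1) by (rule imageI)
      moreover have "(+>) J ` P i \<subseteq> (+>) J ` P (Suc i)" using P(2) i by (intro image_mono) auto
      ultimately show ?thesis by blast
    qed
    moreover have "primeideal ((+>) J ` P i) (R Quot J)" if "i \<le> l" for i
      using P(1) that by (intro img) auto
    ultimately show ?L by (intro exI[of _ "\<lambda>i. (+>) J ` P i"]) simp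
  qed
  then show ?thesis unfolding krull_dim_def by simp
qed

section \<open>Dimension of quotients by annihilators\<close>

context fg_module
begin

text \<open>Members of \<open>Z\<close> are congruent to combinations of the generators, and scalars
  commute; whatever kills the generators kills \<open>Z\<close>.\<close>

lemma ann_generators_subset:
  assumes Z: "\<And>z. z \<in> Z \<Longrightarrow> \<exists>d. z \<in> span_box d"
  shows "ann (e ` {..<g}) \<subseteq> ann Z"
proof
  fix a assume a: "a \<in> ann (e ` {..<g})"
  have "a *s z \<in> N" if z: "z \<in> Z" for z
  proof -
    obtain v where v: "\<forall>b<g. v b \<in> polys t" "z - (\<Sum>b<g. v b *s e b) \<in> N"
      using Z[OF z] poly_box_carrier unfolding span_box_def by blast
    have "a *s z = a *s (z - (\<Sum>b<g. v b *s e b)) + (\<Sum>b<g. v b *s (a *s e b))"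
      by (simp add: scale_right_diff_distrib scale_sum_right mult.commute)
    also have "\<dots> \<in> N"
    proof (rule N_add)
      show "a *s (z - (\<Sum>b<g. v b *s e b)) \<in> N"
        using a v(2) by (intro N_scale) (auto simp: ann_def)
      show "(\<Sum>b<g. v b *s (a *s e b)) \<in> N"
      proof (rule N_sum)
        fix b assume "b \<in> {..<g}"
        then show "v b *s a *s e b \<in> N"
          using a v(1) poly_ring_t_n by (intro N_scale[of "v b"]) (auto simp: ann_def)
      qed
    qed
    finally show ?thesis .
  qed
  then show "a \<in> ann Z" using a by (auto simp: ann_def)
qed

lemma integral_ann:
  assumes Z: "\<And>z. z \<in> Z \<Longrightarrow> \<exists>d. z \<in> span_box d" and f: "f \<in> polys n"
  shows "integral_mod t (ann Z) f"
  by (rule integral_mod_mono[OF integral_ann_generators[OF f] ann_generators_subset[OF Z]])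

text \<open>Going up gives a chain of length \<open>t\<close>, and the counting bound excludes
  longer ones.\<close>

lemma krull_dim_quotient_ann_eq:
  assumes Z: "finite Z" "\<And>z. z \<in> Z \<Longrightarrow> \<exists>d. z \<in> span_box d"
    and "ann Z \<inter> polys t = {0}"
  shows "krull_dim (poly_ring n Quot ann Z) = enat t"
  unfolding krull_dim_Quot[OF cring_poly_ring ideal_ann]
proof (rule Sup_eqI)
  fix x assume "x \<in> {enat l | l. \<exists>P. (\<forall>i\<le>l. primeideal (P i) (poly_ring n) \<and> ann Z \<subseteq> P i) \<and>
    (\<forall>i<l. P i \<subset> P (Suc i))}"
  then obtain l P where "x = enat l" "\<forall>i\<le>l. primeideal (P i) (poly_ring n) \<and> ann Z \<subseteq> P i"
    "\<forall>i<l. P i \<subset> P (Suc i)" by blast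
  then show "x \<le> enat t"
    using prime_chain_length_le[OF Z integral_ann[OF Z(2)], of P l] by simp
next
  fix y assume y: "\<And>x. x \<in> {enat l | l. \<exists>P. (\<forall>i\<le>l. primeideal (P i) (poly_ring n) \<and> ann Z \<subseteq> P i) \<and>
    (\<forall>i<l. P i \<subset> P (Suc i))} \<Longrightarrow> x \<le> y"
  obtain P where P: "\<forall>i\<le>t. primeideal (P i) (poly_ring n)" "\<forall>i<t. P i \<subset> P (Suc i)" "ann Z \<subseteq> P 0"
    using exists_prime_chain[OF ideal_ann assms(3) integral_ann[OF Z(2)] t_le_n] by blast
  have "ann Z \<subseteq> P i" if "i \<le> t" for i
    using that
  proof (induction i)
    case (Suc i)
    then have "ann Z \<subseteq> P i" "P i \<subset> P (Suc i)" using P(2) by auto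
    then show ?case by blast
  qed (rule P(3))
  then show "enat t \<le> y" using P(1,2) by (intro y) blast
qed

text \<open>All primes over \<open>ann Z\<close> contain \<open>a\<close>, so the strict bound
  applies to every chain of them.\<close>

lemma krull_dim_quotient_ann_less:
  assumes Z: "finite Z" "\<And>z. z \<in> Z \<Longrightarrow> \<exists>d. z \<in> span_box d"
    and a: "a \<in> ann Z" "a \<in> polys t" "a \<noteq> 0" and proper: "1 \<notin> ann Z"
  shows "krull_dim (poly_ring n Quot ann Z) < enat t"
proof -
  have short: "l < t" if "\<forall>i\<le>l. primeideal (P i) (poly_ring n) \<and> ann Z \<subseteq> P i"
    "\<forall>i<l. P i \<subset> P (Suc i)" for l P
    using that a by (intro prime_chain_short[OF Z, of a P l]) auto
  obtain P where "primeideal P (poly_ring n)" "ann Z \<subseteq> P"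
    using proper by (rule_tac exists_prime_avoiding[OF ideal_ann, of "{1}" Z]) auto
  \<comment> \<open>A single prime is a chain of length 0, so \<open>t\<close> is positive and
    \<open>t - 1\<close> is a genuine predecessor.\<close>
  then have "0 < t" using short[of 0 "\<lambda>_. P"] by simp
  have "krull_dim (poly_ring n Quot ann Z) \<le> enat (t - 1)"
    unfolding krull_dim_Quot[OF cring_poly_ring ideal_ann] 
  proof (rule Sup_least, elim CollectE exE conjE)
    fix x l P assume "x = enat l" "\<forall>i\<le>l. primeideal (P i) (poly_ring n) \<and> ann Z \<subseteq> P i"
      "\<forall>i<l. P i \<subset> P (Suc i)"
    then show "x \<le> enat (t - 1)" using short[of l P] by simp
  qed
  also have "\<dots> < enat t" using \<open>0 < t\<close> by simp
  finally show ?thesis .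
qed

end

section \<open>Quotient modules and tensor products\<close>

lemma free_module_simps [simp]:
  "u \<oplus>\<^bsub>free_module R I\<^esub> v = (\<lambda>i. u i \<oplus>\<^bsub>R\<^esub> v i)" "\<zero>\<^bsub>free_module R I\<^esub> = (\<lambda>i. \<zero>\<^bsub>R\<^esub>)"
  "a \<odot>\<^bsub>free_module R I\<^esub> v = (\<lambda>i. a \<otimes>\<^bsub>R\<^esub> v i)"
  by (simp_all add: free_module_def)

lemma carrier_free_module:
  "v \<in> carrier (free_module R I) \<longleftrightarrow> (\<forall>i. v i \<in> carrier R) \<and> finite {i. v i \<noteq> \<zero>\<^bsub>R\<^esub>}
    \<and> {i. v i \<noteq> \<zero>\<^bsub>R\<^esub>} \<subseteq> I"
  by (simp add: free_module_def)

lemma carrier_free_module_supportI: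
  assumes "\<And>i. v i \<in> carrier R" "finite B" "B \<subseteq> I" "\<And>i. i \<notin> B \<Longrightarrow> v i = \<zero>\<^bsub>R\<^esub>"
  shows "v \<in> carrier (free_module R I)"
proof -
  have "{i. v i \<noteq> \<zero>\<^bsub>R\<^esub>} \<subseteq> B" using assms(4) by blast
  then show ?thesis using assms(1-3) finite_subset unfolding carrier_free_module by blast
qed

lemma module_free_module:
  assumes "cring R" shows "module R (free_module R I)"
proof -
  interpret cring R by fact
  show ?thesis
  proof (rule moduleI[OF assms])
    show "abelian_group (free_module R I)"
    proof (rule abelian_groupI)
      fix u v assume "u \<in> carrier (free_module R I)" "v \<in> carrier (free_module R I)"
      then show "u \<oplus>\<^bsub>free_module R I\<^esub> v \<in> carrier (free_module R I)"
        unfolding carrier_free_module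
        by (intro carrier_free_module_supportI[of _ _
          "{i. u i \<noteq> \<zero>\<^bsub>R\<^esub>} \<union> {i. v i \<noteq> \<zero>\<^bsub>R\<^esub>}", unfolded carrier_free_module]) auto
    next
      fix u assume "u \<in> carrier (free_module R I)"
      then have u: "\<And>i. u i \<in> carrier R" "finite {i. u i \<noteq> \<zero>\<^bsub>R\<^esub>}" "{i. u i \<noteq> \<zero>\<^bsub>R\<^esub>} \<subseteq> I"
        by (auto simp: carrier_free_module)
      have "(\<lambda>i. \<ominus>\<^bsub>R\<^esub> u i) \<in> carrier (free_module R I)"
        by (rule carrier_free_module_supportI[OF _ u(2,3)]) (use u(1) in auto)
      moreover have "(\<lambda>i. \<ominus>\<^bsub>R\<^esub> u i) \<oplus>\<^bsub>free_module R I\<^esub> u = \<zero>\<^bsub>free_module R I\<^esub>"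
        using u(1) by (simp add: fun_eq_iff l_neg)
      ultimately show "\<exists>v\<in>carrier (free_module R I). v \<oplus>\<^bsub>free_module R I\<^esub> u = \<zero>\<^bsub>free_module R I\<^esub>"
        by blast
    qed (auto simp: carrier_free_module fun_eq_iff a_assoc intro: a_comm)
  next
    fix a v assume a: "a \<in> carrier R" and "v \<in> carrier (free_module R I)"
    then have v: "\<And>i. v i \<in> carrier R" "finite {i. v i \<noteq> \<zero>\<^bsub>R\<^esub>}" "{i. v i \<noteq> \<zero>\<^bsub>R\<^esub>} \<subseteq> I"
      by (auto simp: carrier_free_module)
    have "(\<lambda>i. a \<otimes>\<^bsub>R\<^esub> v i) \<in> carrier (free_module R I)"
      by (rule carrier_free_module_supportI[OF _ v(2,3)]) (use a v(1) in auto)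
    then show "a \<odot>\<^bsub>free_module R I\<^esub> v \<in> carrier (free_module R I)" by simp
  qed (auto simp: carrier_free_module fun_eq_iff l_distr r_distr m_assoc)
qed

lemma basis_vector_carrier:
  assumes "cring R" "i \<in> I" shows "basis_vector R i \<in> carrier (free_module R I)"
proof -
  interpret cring R by fact
  show ?thesis
    using assms(2) by (intro carrier_free_module_supportI[of _ _ "{i}"])
      (auto simp: basis_vector_def)
qed

lemma (in Module.module) uminus_eq_smult:
  "x \<in> carrier M \<Longrightarrow> \<ominus>\<^bsub>M\<^esub> x = (\<ominus> \<one>) \<odot>\<^bsub>M\<^esub> x"
  using smult_l_minus[OF R.one_closed] by simp

lemma (in Module.module) submodule_smultI:
  assumes "H \<subseteq> carrier M" "\<zero>\<^bsub>M\<^esub> \<in> H" "\<And>x y. x \<in> H \<Longrightarrow> y \<in> H \<Longrightarrow> x \<oplus>\<^bsub>M\<^esub> y \<in> H"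
    and smult: "\<And>a x. a \<in> carrier R \<Longrightarrow> x \<in> H \<Longrightarrow> a \<odot>\<^bsub>M\<^esub> x \<in> H"
  shows "submodule H R M"
proof (rule submoduleI)
  fix x assume "x \<in> H"
  then have "\<ominus>\<^bsub>M\<^esub> x = (\<ominus> \<one>) \<odot>\<^bsub>M\<^esub> x" using assms(1) by (intro uminus_eq_smult) blast
  also have "\<dots> \<in> H" using \<open>x \<in> H\<close> by (intro smult) auto
  finally show "\<ominus>\<^bsub>M\<^esub> x \<in> H" .
qed (use assms in auto)

lemma generated_submodule_least:
  "submodule H R M \<Longrightarrow> X \<subseteq> H \<Longrightarrow> generated_submodule R M X \<subseteq> H"
  unfolding generated_submodule_def by blast

lemma generated_submodule_submodule:
  assumes "module R M" "X \<subseteq> carrier M"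
  shows "submodule (generated_submodule R M X) R M" "X \<subseteq> generated_submodule R M X"
proof -
  interpret module R M by fact
  let ?A = "{N. submodule N R M \<and> X \<subseteq> N}"
  have carr: "carrier M \<in> ?A" using carrier_is_submodule assms(2) by blast
  have zero: "\<zero>\<^bsub>M\<^esub> \<in> N" if "submodule N R M" for N
    using subgroup.one_closed[OF submodule.axioms(1)[OF that]] by simp
  show "submodule (generated_submodule R M X) R M"
    unfolding generated_submodule_def
  proof (rule submoduleI)
    show "\<Inter>?A \<subseteq> carrier M" using carr by (rule Inter_lower)
    show "\<zero>\<^bsub>M\<^esub> \<in> \<Inter>?A" using zero by simp
  qed (use submoduleE in auto)
  show "X \<subseteq> generated_submodule R M X" unfolding generated_submodule_def by auto
qed

section \<open>Quotient modules as sets of cosets\<close>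

locale module_quotient = Module.module R M for R and M (structure) +
  fixes N
  assumes N: "submodule N R M"
begin

sublocale NM: abelian_subgroup N M
proof (rule abelian_subgroupI3)
  show "additive_subgroup N M" using N by (intro additive_subgroup.intro submodule.axioms)
  show "abelian_group M" by (rule M.abelian_group_axioms)
qed

lemma N_smult: "a \<in> carrier R \<Longrightarrow> x \<in> N \<Longrightarrow> a \<odot> x \<in> N"
  using submodule.smult_closed[OF N] .

lemma coset_eq_iff:
  assumes "x \<in> carrier M" "y \<in> carrier M"
  shows "N +> x = N +> y \<longleftrightarrow> x \<ominus> y \<in> N"
proof -
  have "x \<in> N +> y \<longleftrightarrow> x \<ominus> y \<in> N"
    using NM.a_rcos_module[OF assms(2,1)] by (simp add: a_minus_def)
  then show ?thesis
    using NM.a_repr_independence'[OF _ assms(2), of x] NM.a_rcos_self[OF assms(1)] by auto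
qed

lemma coset_eq_N_iff: "x \<in> carrier M \<Longrightarrow> N +> x = N \<longleftrightarrow> x \<in> N"
  using NM.a_rcos_const[of x] NM.a_rcos_self[of x] by auto

lemma quotient_carrier: "carrier (quotient_module M N) = (\<lambda>x. N +> x) ` carrier M"
  by (auto simp: quotient_module_def A_RCOSETS_def')

lemma quotient_carrierE:
  assumes "X \<in> carrier (quotient_module M N)"
  obtains x where "x \<in> carrier M" "X = N +> x"
  using assms quotient_carrier by blast

lemma quotient_zero [simp]: "\<zero>\<^bsub>quotient_module M N\<^esub> = N"
  by (simp add: quotient_module_def)

lemma quotient_add [simp]:
  "x \<in> carrier M \<Longrightarrow> y \<in> carrier M \<Longrightarrow>
    (N +> x) \<oplus>\<^bsub>quotient_module M N\<^esub> (N +> y) = N +> (x \<oplus> y)"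
  by (simp add: quotient_module_def NM.a_rcos_sum)

text \<open>Scalar multiplication on cosets is a union over all representatives. These differ by
  elements of \<open>N\<close>, which \<open>a\<close> maps into \<open>N\<close>, so the union is
  over copies of a single coset.\<close>

lemma quotient_smult [simp]:
  assumes a: "a \<in> carrier R" and x: "x \<in> carrier M"
  shows "a \<odot>\<^bsub>quotient_module M N\<^esub> (N +> x) = N +> (a \<odot> x)"
proof -
  have same: "N +> (a \<odot> y) = N +> (a \<odot> x)" if y: "y \<in> N +> x" for y
  proof -
    have yc: "y \<in> carrier M" using NM.a_elemrcos_carrier[OF x y] .
    have "y \<ominus> x \<in> N" using NM.a_rcos_module_imp[OF x y] by (simp add: a_minus_def)
    then have "a \<odot> (y \<ominus> x) \<in> N" using N_smult a by blast
    moreover have "a \<odot> (y \<ominus> x) = a \<odot> y \<ominus> a \<odot> x"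
      using a x yc by (simp add: a_minus_def smult_r_distr smult_r_minus)
    ultimately show ?thesis using coset_eq_iff a x yc by simp
  qed
  have "x \<in> N +> x" using x by (rule NM.a_rcos_self)
  then have ne: "N +> x \<noteq> {}" by blast
  have "a \<odot>\<^bsub>quotient_module M N\<^esub> (N +> x) = (\<Union>y\<in>N +> x. N +> (a \<odot> y))"
    by (simp add: quotient_module_def)
  also have "\<dots> = (\<Union>y\<in>N +> x. N +> (a \<odot> x))" by (rule SUP_cong[OF refl same])
  also have "\<dots> = N +> (a \<odot> x)" by (simp only: UN_constant ne if_False)
  finally show ?thesis .
qed

lemma quotient_carrier_mem [simp]: "x \<in> carrier M \<Longrightarrow> N +> x \<in> carrier (quotient_module M N)"
  by (simp add: quotient_carrier)

lemma quotient_is_module: "module R (quotient_module M N)"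
proof (rule moduleI)
  let ?Q = "quotient_module M N"
  have NZ: "N = N +> \<zero>"
    using coset_eq_N_iff[OF M.zero_closed] NM.zero_closed by (rule iffD2[THEN sym])
  show "cring R" by (rule R.is_cring)
  show "abelian_group ?Q"
  proof (rule abelian_groupI)
    show "\<zero>\<^bsub>?Q\<^esub> \<in> carrier ?Q" by (subst quotient_zero, subst NZ) simp
  next
    fix X Y assume "X \<in> carrier ?Q" "Y \<in> carrier ?Q"
    then show "X \<oplus>\<^bsub>?Q\<^esub> Y \<in> carrier ?Q" "X \<oplus>\<^bsub>?Q\<^esub> Y = Y \<oplus>\<^bsub>?Q\<^esub> X"
      by (auto elim!: quotient_carrierE simp: M.a_comm)
  next
    fix X Y Z assume "X \<in> carrier ?Q" "Y \<in> carrier ?Q" "Z \<in> carrier ?Q"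
    then show "X \<oplus>\<^bsub>?Q\<^esub> Y \<oplus>\<^bsub>?Q\<^esub> Z = X \<oplus>\<^bsub>?Q\<^esub> (Y \<oplus>\<^bsub>?Q\<^esub> Z)"
      by (auto elim!: quotient_carrierE simp: M.a_assoc)
  next
    fix X assume "X \<in> carrier ?Q"
    then obtain x where x: "x \<in> carrier M" "X = N +> x" by (rule quotient_carrierE)
    have "(N +> \<zero>) \<oplus>\<^bsub>?Q\<^esub> X = X" using x by simp
    then show "\<zero>\<^bsub>?Q\<^esub> \<oplus>\<^bsub>?Q\<^esub> X = X" using NZ by simp
    have "(N +> (\<ominus> x)) \<oplus>\<^bsub>?Q\<^esub> X = \<zero>\<^bsub>?Q\<^esub>"
      using x NZ by (simp add: M.l_neg)
    then show "\<exists>Y\<in>carrier ?Q. Y \<oplus>\<^bsub>?Q\<^esub> X = \<zero>\<^bsub>?Q\<^esub>"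
      using x(1) by (intro bexI[of _ "N +> (\<ominus> x)"]) auto
  qed
qed (auto elim!: quotient_carrierE simp: smult_l_distr smult_r_distr smult_assoc1)

end

text \<open>The four families of bilinearity relations as a bare set, so that containment of the
  generated submodule can be tested on generators.\<close>

definition tensor_relation_set ::
    "('a, 'x) ring_scheme \<Rightarrow> ('a, 'b, 'y) module_scheme \<Rightarrow> ('a, 'c, 'z) module_scheme
      \<Rightarrow> ('b \<times> 'c \<Rightarrow> 'a) set" where
  "tensor_relation_set R M N =
    (let F = tensor_free R M N; e = basis_vector R in
      {e (x \<oplus>\<^bsub>M\<^esub> x', y) \<ominus>\<^bsub>F\<^esub> (e (x, y) \<oplus>\<^bsub>F\<^esub> e (x', y)) | x x' y.
          x \<in> carrier M \<and> x' \<in> carrier M \<and> y \<in> carrier N} \<union>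
       {e (x, y \<oplus>\<^bsub>N\<^esub> y') \<ominus>\<^bsub>F\<^esub> (e (x, y) \<oplus>\<^bsub>F\<^esub> e (x, y')) | x y y'.
          x \<in> carrier M \<and> y \<in> carrier N \<and> y' \<in> carrier N} \<union>
       {e (a \<odot>\<^bsub>M\<^esub> x, y) \<ominus>\<^bsub>F\<^esub> (a \<odot>\<^bsub>F\<^esub> e (x, y)) | a x y.
          a \<in> carrier R \<and> x \<in> carrier M \<and> y \<in> carrier N} \<union>
       {e (x, a \<odot>\<^bsub>N\<^esub> y) \<ominus>\<^bsub>F\<^esub> (a \<odot>\<^bsub>F\<^esub> e (x, y)) | a x y.
          a \<in> carrier R \<and> x \<in> carrier M \<and> y \<in> carrier N})"

lemma tensor_relations_eq:
  "tensor_relations R M N = generated_submodule R (tensor_free R M N) (tensor_relation_set R M N)"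
  unfolding tensor_relations_def tensor_relation_set_def Let_def ..

locale tensor = M: Module.module R M + N: Module.module R N for R (structure) and M N
begin

abbreviation "F \<equiv> tensor_free R M N"
abbreviation "e \<equiv> basis_vector R"
abbreviation "T \<equiv> tensor_product R M N"
abbreviation "pt \<equiv> pure_tensor R M N"

lemma R_cring: "cring R" by (rule M.R.is_cring)

sublocale F: Module.module R F
  unfolding tensor_free_def by (rule module_free_module[OF R_cring])

lemma e_carrier: "x \<in> carrier M \<Longrightarrow> y \<in> carrier N \<Longrightarrow> e (x, y) \<in> carrier F"
  unfolding tensor_free_def by (intro basis_vector_carrier R_cring) auto

lemma relation_set_carrier: "tensor_relation_set R M N \<subseteq> carrier F"
  unfolding tensor_relation_set_def Let_def
  by (auto intro!: F.M.minus_closed F.M.a_closed F.smult_closed e_carrier M.smult_closed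
    N.smult_closed)

sublocale Q: module_quotient R F "tensor_relations R M N"
  by (intro module_quotient.intro module_quotient_axioms.intro F.module_axioms,
    unfold tensor_relations_eq, rule generated_submodule_submodule(1)[OF F.module_axioms
      relation_set_carrier])

lemma relations: "tensor_relation_set R M N \<subseteq> tensor_relations R M N"
  unfolding tensor_relations_eq
  by (rule generated_submodule_submodule(2)[OF F.module_axioms relation_set_carrier])

lemma tensor_product_module: "module R T"
  unfolding tensor_product_def by (rule Q.quotient_is_module)

lemma pure_tensor_carrier: "x \<in> carrier M \<Longrightarrow> y \<in> carrier N \<Longrightarrow> pt x y \<in> carrier T"
  unfolding tensor_product_def pure_tensor_def by (intro Q.quotient_carrier_mem e_carrier)

lemma pure_tensor_add_right:
  assumes "x \<in> carrier M" "y \<in> carrier N" "y' \<in> carrier N"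
  shows "pt x (y \<oplus>\<^bsub>N\<^esub> y') = pt x y \<oplus>\<^bsub>T\<^esub> pt x y'"
proof -
  have "e (x, y \<oplus>\<^bsub>N\<^esub> y') \<ominus>\<^bsub>F\<^esub> (e (x, y) \<oplus>\<^bsub>F\<^esub> e (x, y')) \<in> tensor_relation_set R M N"
    unfolding tensor_relation_set_def Let_def using assms by blast
  then have "e (x, y \<oplus>\<^bsub>N\<^esub> y') \<ominus>\<^bsub>F\<^esub> (e (x, y) \<oplus>\<^bsub>F\<^esub> e (x, y')) \<in> tensor_relations R M N"
    using relations by blast
  then show ?thesis
    using assms by (simp add: tensor_product_def pure_tensor_def Q.coset_eq_iff e_carrier)
qed

lemma pure_tensor_smult_right:
  assumes "x \<in> carrier M" "y \<in> carrier N" "a \<in> carrier R"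
  shows "pt x (a \<odot>\<^bsub>N\<^esub> y) = a \<odot>\<^bsub>T\<^esub> pt x y"
proof -
  have "e (x, a \<odot>\<^bsub>N\<^esub> y) \<ominus>\<^bsub>F\<^esub> (a \<odot>\<^bsub>F\<^esub> e (x, y)) \<in> tensor_relation_set R M N"
    unfolding tensor_relation_set_def Let_def using assms by blast
  then have "e (x, a \<odot>\<^bsub>N\<^esub> y) \<ominus>\<^bsub>F\<^esub> (a \<odot>\<^bsub>F\<^esub> e (x, y)) \<in> tensor_relations R M N"
    using relations by blast
  then show ?thesis
    using assms by (simp add: tensor_product_def pure_tensor_def Q.coset_eq_iff e_carrier)
qed

lemma pure_tensor_smult_left:
  assumes "x \<in> carrier M" "y \<in> carrier N" "a \<in> carrier R"
  shows "pt (a \<odot>\<^bsub>M\<^esub> x) y = a \<odot>\<^bsub>T\<^esub> pt x y"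
proof -
  have "e (a \<odot>\<^bsub>M\<^esub> x, y) \<ominus>\<^bsub>F\<^esub> (a \<odot>\<^bsub>F\<^esub> e (x, y)) \<in> tensor_relation_set R M N"
    unfolding tensor_relation_set_def Let_def using assms by blast
  then have "e (a \<odot>\<^bsub>M\<^esub> x, y) \<ominus>\<^bsub>F\<^esub> (a \<odot>\<^bsub>F\<^esub> e (x, y)) \<in> tensor_relations R M N"
    using relations by blast
  then show ?thesis
    using assms by (simp add: tensor_product_def pure_tensor_def Q.coset_eq_iff e_carrier)
qed

lemma pure_tensor_zero_right: "x \<in> carrier M \<Longrightarrow> pt x \<zero>\<^bsub>N\<^esub> = \<zero>\<^bsub>T\<^esub>"
proof -
  assume x: "x \<in> carrier M"
  interpret T: Module.module R T by (rule tensor_product_module)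
  have "pt x (\<zero> \<odot>\<^bsub>N\<^esub> \<zero>\<^bsub>N\<^esub>) = \<zero> \<odot>\<^bsub>T\<^esub> pt x \<zero>\<^bsub>N\<^esub>"
    using x by (intro pure_tensor_smult_right) auto
  then show ?thesis using x by (simp add: pure_tensor_carrier)
qed

lemma pure_tensor_eq_zero_iff:
  assumes "x \<in> carrier M" "y \<in> carrier N"
  shows "pt x y = \<zero>\<^bsub>T\<^esub> \<longleftrightarrow> e (x, y) \<in> tensor_relations R M N"
  using assms by (simp add: tensor_product_def pure_tensor_def Q.coset_eq_N_iff e_carrier)

end

section \<open>Jets\<close>

lemma sum_fun_apply: "(\<Sum>x\<in>A. f x) i = (\<Sum>x\<in>A. f x i)"
  for f :: "'a \<Rightarrow> 'b \<Rightarrow> 'c::comm_monoid_add"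
  by (induction A rule: infinite_finite_induct) auto

text \<open>On the whole function type this is a module over the full type of polynomials, so the
  calculus of \<open>Modules.module\<close> applies; \<open>jet_space\<close> restricts the same
  operations to a carrier.\<close>

definition eqn_scale :: "'k::field mpoly \<Rightarrow> 'k equation \<Rightarrow> 'k equation" where
  "eqn_scale a v = (\<lambda>i. a * v i)"

lemma module_eqn_scale: "Modules.module eqn_scale"
  by unfold_locales (auto simp: eqn_scale_def fun_eq_iff algebra_simps)

interpretation eqn: Modules.module eqn_scale by (rule module_eqn_scale)

lemma jet_space_simps [simp]:
  "v \<oplus>\<^bsub>jet_space n m\<^esub> w = v + w" "\<zero>\<^bsub>jet_space n m\<^esub> = 0" "a \<odot>\<^bsub>jet_space n m\<^esub> v = eqn_scale a v"
  by (auto simp: jet_space_def free_module_def eqn_scale_def)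

abbreviation "jet_eqns n m \<equiv> carrier (jet_space n m)"

lemma carrier_jet_space_iff:
  "v \<in> jet_eqns n m \<longleftrightarrow> (\<forall>i. v i \<in> polys n) \<and> (\<forall>i. v i \<noteq> 0 \<longrightarrow> i \<in> {1..m})"
proof -
  have "finite {i. v i \<noteq> 0}" if "\<forall>i. v i \<noteq> 0 \<longrightarrow> i \<in> {1..m}"
  proof (rule finite_subset)
    show "{i. v i \<noteq> 0} \<subseteq> {1..m}" using that by blast
  qed simp
  moreover have "v \<in> jet_eqns n m \<longleftrightarrow> (\<forall>i. v i \<in> polys n) \<and>
      finite {i. v i \<noteq> 0} \<and> {i. v i \<noteq> 0} \<subseteq> {1..m}"
    by (simp add: jet_space_def free_module_def)
  ultimately show ?thesis by blast
qed

lemma jet_space_zero [simp, intro]: "0 \<in> jet_eqns n m"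
  by (simp add: carrier_jet_space_iff)

lemma jet_space_add [intro]:
  "v \<in> jet_eqns n m \<Longrightarrow> w \<in> jet_eqns n m \<Longrightarrow> v + w \<in> jet_eqns n m"
  unfolding carrier_jet_space_iff by (metis plus_fun_apply poly_ring_add add_0)

lemma jet_space_scale [intro]:
  "a \<in> polys n \<Longrightarrow> v \<in> jet_eqns n m \<Longrightarrow> eqn_scale a v \<in> jet_eqns n m"
  by (auto simp: carrier_jet_space_iff eqn_scale_def)

lemma module_jet_space:
  assumes "s \<le> n"
  shows "Module.module (poly_ring s) (jet_space n m :: ('k::field mpoly, 'k equation)
    Module.module)"
proof (rule Module.moduleI)
  show "abelian_group (jet_space n m :: ('k mpoly, 'k equation) Module.module)"
    unfolding jet_space_def by (rule Module.module.axioms(2)[OF module_free_module[OF cring_poly_ring]])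
next
  fix a :: "'k mpoly" and x :: "'k equation"
  assume "a \<in> polys s" "x \<in> jet_eqns n m"
  then show "a \<odot>\<^bsub>jet_space n m\<^esub> x \<in> jet_eqns n m"
    using poly_ring_mono[OF assms] by auto
qed (auto simp: cring_poly_ring eqn.scale_left_distrib eqn.scale_right_distrib)

text \<open>The ring of scalars varies: \<open>s = n\<close> for submodules over D,
  \<open>s = 0\<close> for spans over k, intermediate \<open>s\<close> for the partial
  localization.\<close>

lemma submodule_jet_space_iff:
  fixes H :: "'k::field equation set"
  assumes "s \<le> n"
  shows "submodule H (poly_ring s) (jet_space n m) \<longleftrightarrow>
    H \<subseteq> jet_eqns n m \<and> 0 \<in> H \<and> (\<forall>v\<in>H. \<forall>w\<in>H. v + w \<in> H) \<and>
    (\<forall>a\<in>polys s. \<forall>v\<in>H. eqn_scale a v \<in> H)" (is "?l \<longleftrightarrow> ?r")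
proof -
  interpret Module.module "poly_ring s" "jet_space n m :: ('k mpoly, 'k equation) Module.module"
    using assms by (rule module_jet_space)
  show ?thesis
  proof
    assume l: ?l
    interpret submodule H "poly_ring s" "jet_space n m" by (rule l)
    have "0 \<in> H" using one_closed by simp
    then show ?r using submoduleE(1,4,5)[OF l] by simp
  next
    assume r: ?r
    show ?l by (rule submodule_smultI) (use r in auto)
  qed
qed

lemma poly_ring_0_iff: "a \<in> polys 0 \<longleftrightarrow> (\<exists>c. a = single 0 c)"
proof
  assume "a \<in> polys 0"
  then have "keys a \<subseteq> {0}"
    by (auto simp: carrier_poly_ring_iff poly_mapping_eq_iff fun_eq_iff in_keys_iff)
  then have "a = single 0 (lookup a 0)"
    by (intro poly_mapping_eqI) (auto simp: lookup_single when_def in_keys_iff)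
  then show "\<exists>c. a = single 0 c" by blast
qed auto

section \<open>Jets, their order and their class\<close>

definition jet_vec :: "jet \<Rightarrow> 'k::field equation" where
  "jet_vec y = (\<lambda>j. if j = fst y then single (snd y) 1 else 0)"

definition all_jets :: "nat \<Rightarrow> nat \<Rightarrow> jet set" where
  "all_jets n m = {y. fst y \<in> {1..m} \<and> keys (snd y) \<subseteq> {1..n}}"

definition total_degree :: "multi_index \<Rightarrow> nat" where
  "total_degree \<mu> = (\<Sum>i\<in>keys \<mu>. lookup \<mu> i)"

lemma jet_order_eq: "jet_order y = total_degree (snd y)"
  by (simp add: jet_order_def total_degree_def)

lemma total_degree_superset:
  "finite I \<Longrightarrow> keys \<mu> \<subseteq> I \<Longrightarrow> total_degree \<mu> = (\<Sum>i\<in>I. lookup \<mu> i)"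
  unfolding total_degree_def by (rule sum.mono_neutral_left) (auto simp: in_keys_iff)

lemma total_degree_add: "total_degree (\<mu> + \<nu>) = total_degree \<mu> + total_degree \<nu>"
proof -
  let ?I = "keys \<mu> \<union> keys \<nu>"
  have "total_degree (\<mu> + \<nu>) = (\<Sum>i\<in>?I. lookup (\<mu> + \<nu>) i)"
    using Poly_Mapping.keys_add[of \<mu> \<nu>] by (intro total_degree_superset) auto
  also have "\<dots> = total_degree \<mu> + total_degree \<nu>"
    by (simp add: lookup_add sum.distrib total_degree_superset[of ?I])
  finally show ?thesis .
qed

lemma total_degree_single [simp]: "total_degree (single i a) = a"
  by (simp add: total_degree_def)

lemma total_degree_zero [simp]: "total_degree 0 = 0"
  by (simp add: total_degree_def)

text \<open>The difference of the exponents has degree 0. Leading jets are identified in this way: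
  exponents are compared in one direction only, and equality of orders does the rest.\<close>

lemma total_degree_le_imp_eq:
  assumes le: "\<And>j. lookup \<mu> j \<le> lookup \<nu> j"
    and deg: "total_degree \<mu> = total_degree \<nu>"
  shows "\<mu> = \<nu>"
proof -
  have "\<nu> = \<mu> + (\<nu> - \<mu>)"
    using le by (intro poly_mapping_eqI) (simp add: lookup_add lookup_minus)
  then have "total_degree (\<nu> - \<mu>) = 0" using deg total_degree_add[of \<mu> "\<nu> - \<mu>"] by simp
  then have "lookup (\<nu> - \<mu>) j = 0" for j
    by (cases "j \<in> keys (\<nu> - \<mu>)") (auto simp: total_degree_def in_keys_iff)
  then show ?thesis using le by (intro poly_mapping_eqI) (simp add: lookup_minus le_antisym)
qed

lemma lookup_le_total_degree: "lookup \<mu> i \<le> total_degree \<mu>"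
  by (cases "i \<in> keys \<mu>") (auto simp: total_degree_def in_keys_iff intro: member_le_sum)

lemma jet_vec_jet_space [intro]: "y \<in> all_jets n m \<Longrightarrow> jet_vec y \<in> jet_eqns n m"
  by (auto simp: jet_vec_def carrier_jet_space_iff all_jets_def)

lemma eqn_scale_deriv_jet_vec:
  "eqn_scale (deriv_var j) (jet_vec (k, \<mu>)) = jet_vec (k, single j 1 + \<mu>)"
  by (auto simp: deriv_var_def eqn_scale_def jet_vec_def fun_eq_iff mult_single)

lemma jet_coeff_zero [simp]: "jet_coeff 0 y = 0"
  by (simp add: jet_coeff_def)

lemma jet_coeff_add: "jet_coeff (v + w) y = jet_coeff v y + jet_coeff w y"
  by (simp add: jet_coeff_def lookup_add)

lemma jet_coeff_sum: "jet_coeff (\<Sum>x\<in>A. f x) y = (\<Sum>x\<in>A. jet_coeff (f x) y)"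
  by (simp add: jet_coeff_def sum_fun_apply lookup_sum)

lemma jet_coeff_monomial_scale:
  "jet_coeff (eqn_scale (single \<nu> c) v) (k, \<nu> + \<kappa>) = c * jet_coeff v (k, \<kappa>)"
  by (simp add: jet_coeff_def eqn_scale_def lookup_single_mult_add)

lemma jet_coeff_monomial_scale_nonzero:
  assumes "jet_coeff (eqn_scale (single \<nu> c) v) (k, \<rho>) \<noteq> 0"
  obtains \<kappa> where "\<rho> = \<nu> + \<kappa>" "jet_coeff v (k, \<kappa>) \<noteq> 0"
proof -
  have "\<rho> \<in> keys (single \<nu> c * v k)"
    using assms by (simp add: jet_coeff_def eqn_scale_def in_keys_iff)
  then obtain \<kappa> where "\<rho> = \<nu> + \<kappa>" "\<kappa> \<in> keys (v k)"
    using Poly_Mapping.keys_mult[of "single \<nu> c" "v k"] by (auto split: if_splits)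
  then show thesis using that by (simp add: jet_coeff_def in_keys_iff)
qed

lemma jet_coeff_in_all_jets:
  assumes "v \<in> jet_eqns n m" "jet_coeff v y \<noteq> 0"
  shows "y \<in> all_jets n m"
proof -
  have "snd y \<in> keys (v (fst y))" using assms(2) by (simp add: jet_coeff_def in_keys_iff)
  moreover from this have "v (fst y) \<noteq> 0" by auto
  ultimately show ?thesis
    using assms(1) unfolding carrier_jet_space_iff all_jets_def carrier_poly_ring_iff by blast
qed

lemma finite_jet_support:
  assumes "v \<in> jet_eqns n m" shows "finite {y. jet_coeff v y \<noteq> 0}"
proof (rule finite_subset)
  show "{y. jet_coeff v y \<noteq> 0} \<subseteq> (SIGMA k:{1..m}. keys (v k))"
    using jet_coeff_in_all_jets[OF assms] by (force simp: jet_coeff_def in_keys_iff all_jets_def)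
qed auto

lemma jet_expansion:
  assumes "v \<in> jet_eqns n m"
  shows "v = (\<Sum>y\<in>{y. jet_coeff v y \<noteq> 0}. eqn_scale (single 0 (jet_coeff v y)) (jet_vec y))"
    (is "v = ?s")
proof
  fix k
  show "v k = ?s k"
  proof (rule poly_mapping_eqI)
    fix \<mu>
    have "lookup (?s k) \<mu> =
      (\<Sum>y\<in>{y. jet_coeff v y \<noteq> 0}. if y = (k, \<mu>) then jet_coeff v y else 0)"
      unfolding sum_fun_apply lookup_sum
      by (intro sum.cong)
        (auto simp: eqn_scale_def jet_vec_def lookup_scalar_mult lookup_single when_def prod_eq_iff)
    also have "\<dots> = jet_coeff v (k, \<mu>)"
      using finite_jet_support[OF assms] by (simp add: sum.delta)
    finally show "lookup (v k) \<mu> = lookup (?s k) \<mu>"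
      by (simp add: jet_coeff_def)
  qed
qed

text \<open>The class as a function. For the zero multi-index the minimum is over an empty set and
  carries no information, so statements pair it with \<open>snd y \<noteq> 0\<close>.\<close>

definition jet_class :: "jet \<Rightarrow> nat" where
  "jet_class y = Min (keys (snd y))"

lemma jets_iff:
  "y \<in> jets n m q i \<longleftrightarrow> y \<in> all_jets n m \<and> jet_order y = q \<and> jet_of_class i y"
  by (auto simp: jets_def all_jets_def)

lemma jet_of_class_iff:
  assumes "y \<in> all_jets n m" "i \<ge> 1"
  shows "jet_of_class i y \<longleftrightarrow> snd y \<noteq> 0 \<and> jet_class y = i"
proof -
  have pos: "j \<ge> 1" if "j \<in> keys (snd y)" for j
    using that assms(1) by (auto simp: all_jets_def)
  show ?thesis
  proof
    assume c: "jet_of_class i y"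
    then have i: "i \<in> keys (snd y)" by (simp add: jet_of_class_def in_keys_iff)
    moreover have "i \<le> j" if "j \<in> keys (snd y)" for j
    proof (rule ccontr)
      assume "\<not> i \<le> j"
      then have "lookup (snd y) j = 0"
        using c pos[OF that] unfolding jet_of_class_def by simp
      then show False using that by (simp add: in_keys_iff)
    qed
    ultimately show "snd y \<noteq> 0 \<and> jet_class y = i"
      by (auto simp: jet_class_def intro!: Min_eqI)
  next
    assume *: "snd y \<noteq> 0 \<and> jet_class y = i"
    then have "keys (snd y) \<noteq> {}"
      using poly_mapping_nonzero_key[of "snd y"] by auto
    then have "i \<in> keys (snd y)" using * Min_in[of "keys (snd y)"]
      by (simp add: jet_class_def)
    moreover have "j \<notin> keys (snd y)" if "j < i" for j
      using * that Min_le[of "keys (snd y)" j] by (auto simp: jet_class_def)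
    ultimately show "jet_of_class i y" unfolding jet_of_class_def in_keys_iff by simp
  qed
qed

lemma jet_class_range:
  assumes "y \<in> all_jets n m" "snd y \<noteq> 0"
  shows "jet_class y \<in> {1..n}" "jet_of_class (jet_class y) y"
proof -
  have "keys (snd y) \<noteq> {}"
    using assms(2) poly_mapping_nonzero_key[of "snd y"] by auto
  then have "jet_class y \<in> keys (snd y)" by (simp add: jet_class_def)
  then show "jet_class y \<in> {1..n}" using assms(1) by (auto simp: all_jets_def)
  then show "jet_of_class (jet_class y) y" using assms by (subst jet_of_class_iff) auto
qed

section \<open>Systems in solved form\<close>

locale solved_system =
  fixes n m q :: nat and S :: "'k::field equation set" and ld :: "'k equation \<Rightarrow> jet"
  assumes linear: "linear_system n m q S" and solved: "solved_form n m q S ld"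
begin

abbreviation "N \<equiv> generated_submodule (poly_ring n) (jet_space n m) S"

lemma S_carrier: "S \<subseteq> jet_eqns n m"
  using linear by (simp add: linear_system_def)

lemma S_order: "\<Phi> \<in> S \<Longrightarrow> jet_coeff \<Phi> y \<noteq> 0 \<Longrightarrow> jet_order y \<le> q"
  using linear unfolding linear_system_def by blast

lemma N_submodule: "submodule N (poly_ring n) (jet_space n m)" and S_subset_N: "S \<subseteq> N"
  using generated_submodule_submodule[OF module_jet_space[OF order_refl] S_carrier] by auto

lemma N_closed: "N \<subseteq> jet_eqns n m" "0 \<in> N" "v \<in> N \<Longrightarrow> w \<in> N \<Longrightarrow> v + w \<in> N"
  "a \<in> polys n \<Longrightarrow> v \<in> N \<Longrightarrow> eqn_scale a v \<in> N"
  using N_submodule unfolding submodule_jet_space_iff[OF order_refl] by simp_all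

text \<open>Elimination is one-sided: a jet solved for in class \<open>i\<close> is removed from the
  other equations of class at most \<open>i\<close>, whereas equations of higher class may still
  contain it. Hence \<open>j \<in> {1..i}\<close>.\<close>

lemma coeff_leading:
  assumes "i \<in> {1..n}" "j \<in> {1..i}" "\<Phi> \<in> equations_of_class q S ld j" "\<Psi>
    \<in> equations_of_class q S ld i"
  shows "jet_coeff \<Phi> (ld \<Psi>) \<noteq> 0 \<longleftrightarrow> \<Phi> = \<Psi>"
proof -
  have "(\<forall>\<Phi>\<in>(\<Union>j\<in>{1..i}. equations_of_class q S ld j). \<forall>\<Psi>\<in>equations_of_class q S ld i.
      jet_coeff \<Phi> (ld \<Psi>) \<noteq> 0 \<longleftrightarrow> \<Phi> = \<Psi>)"
    using solved assms(1) unfolding solved_form_def Let_def by simp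
  then show ?thesis using assms by blast
qed

lemma leading_jet:
  assumes "\<Phi> \<in> top_equations q S"
  obtains i where "i \<in> {1..n}" "ld \<Phi> \<in> jets n m q i" "\<Phi> \<in> equations_of_class q S ld i"
proof -
  obtain i where "i \<in> {1..n}" "ld \<Phi> \<in> jets n m q i"
    using solved assms unfolding solved_form_def by blast
  then show thesis using that assms by (auto simp: equations_of_class_def jets_iff)
qed

text \<open>A leading jet has a class and therefore order at least 1, so for \<open>q = 0\<close> no
  equation has order \<open>q\<close>, and all coefficients of the system vanish.\<close>

lemma no_equations_order_0:
  assumes "q = 0" shows "N = {0}"
proof -
  have "top_equations q S = {}"
  proof (rule ccontr)
    assume "top_equations q S \<noteq> {}"
    then obtain \<Phi> i where *: "i \<in> {1..n}" "ld \<Phi> \<in> jets n m q i" using leading_jet by blast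
    then have "lookup (snd (ld \<Phi>)) i \<le> 0" "lookup (snd (ld \<Phi>)) i \<noteq> 0"
      using lookup_le_total_degree[of "snd (ld \<Phi>)" i] assms
      by (auto simp: jets_iff jet_order_eq jet_of_class_def)
    then show False by simp
  qed
  have "\<Phi> = 0" if "\<Phi> \<in> S" for \<Phi>
  proof -
    have "jet_coeff \<Phi> y = 0" for y
    proof (rule ccontr)
      assume y: "jet_coeff \<Phi> y \<noteq> 0"
      then have "jet_order y = q" using S_order[OF that y] assms by simp
      then have "\<Phi> \<in> top_equations q S" using that y unfolding top_equations_def by blast
      then show False using \<open>top_equations q S = {}\<close> by simp
    qed
    then show ?thesis by (auto simp: jet_coeff_def fun_eq_iff poly_mapping_eq_iff)
  qed
  then have "S \<subseteq> {0}" by blast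
  moreover have "submodule {0} (poly_ring n) (jet_space n m :: ('k mpoly, 'k equation)
    Module.module)"
    unfolding submodule_jet_space_iff[OF order_refl] by simp
  ultimately have "N \<subseteq> {0}" by (rule generated_submodule_least[rotated])
  then show ?thesis using N_closed(2) by blast
qed

text \<open>The number t of the overview. For \<open>q = 0\<close> no jet of order \<open>q\<close>
  has a class and the maximum would be 0, although the module is then free over D; the value
  \<open>n\<close> is therefore set separately. The inserted 0 covers systems solved for all jets of
  order \<open>q\<close>.\<close>

definition num_params :: nat where
  "num_params = (if q = 0 then n else
    Max (insert 0 {i \<in> {1..n}. \<not> jets n m q i \<subseteq> ld ` equations_of_class q S ld i}))"

lemma num_params_le: "num_params \<le> n"
  by (simp add: num_params_def)

lemma all_jets_leading:
  assumes "q > 0" "i \<in> {1..n}" "num_params < i" "y \<in> jets n m q i"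
  obtains \<Phi> where "\<Phi> \<in> equations_of_class q S ld i" "y = ld \<Phi>"
proof -
  have "i \<notin> {i \<in> {1..n}. \<not> jets n m q i \<subseteq> ld ` equations_of_class q S ld i}"
  proof
    assume "i \<in> {i \<in> {1..n}. \<not> jets n m q i \<subseteq> ld ` equations_of_class q S ld i}"
    then have "i \<le> num_params"
      using assms(1) unfolding num_params_def by (simp add: Max_ge)
    then show False using assms(3) by simp
  qed
  then have "jets n m q i \<subseteq> ld ` equations_of_class q S ld i" using assms(2) by blast
  then show thesis using assms(4) that by blast
qed

lemma exists_non_leading_jet:
  assumes "q > 0" "num_params > 0"
  obtains y where "y \<in> jets n m q num_params" "y \<notin> ld ` equations_of_class q S ld num_params"
proof -
  let ?A = "{i \<in> {1..n}. \<not> jets n m q i \<subseteq> ld ` equations_of_class q S ld i}"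
  have "num_params \<in> insert 0 ?A"
    using assms(1) Max_in[of "insert 0 ?A"] unfolding num_params_def by simp
  then have "num_params \<in> ?A" using assms(2) by simp
  then have "\<not> jets n m q num_params \<subseteq> ld ` equations_of_class q S ld num_params" by simp
  then show thesis using that by blast
qed

text \<open>These jets will generate the module over k[d_1,...,d_t]. The bound
  \<open>max q 1\<close> lets y^1, ..., y^m themselves in when \<open>q = 0\<close>.\<close>

definition low_jets :: "jet set" where
  "low_jets = {y \<in> all_jets n m. jet_order y < max q 1}"

lemma finite_low_jets: "finite low_jets"
proof (rule finite_subset)
  show "low_jets \<subseteq> {1..m} \<times> exponent_box n (max q 1)"
  proof
    fix y assume y: "y \<in> low_jets"
    have "lookup (snd y) i \<le> max q 1" for i
      using y lookup_le_total_degree[of "snd y" i] by (simp add: low_jets_def jet_order_eq)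
    then show "y \<in> {1..m} \<times> exponent_box n (max q 1)"
      using y by (auto simp: low_jets_def all_jets_def exponent_box_def mem_Times_iff)
  qed
qed (use exponent_box_finite in blast)

text \<open>The span of the low jets over k[d_1,...,d_t] modulo \<open>N\<close>; finite generation
  means that it is the whole jet space.\<close>

definition reducible :: "'k equation set" where
  "reducible = {v \<in> jet_eqns n m. \<exists>c. (\<forall>y\<in>low_jets. c y \<in> polys num_params) \<and>
     v - (\<Sum>y\<in>low_jets. eqn_scale (c y) (jet_vec y)) \<in> N}"

lemma poly_ring_num_params: "a \<in> polys num_params \<Longrightarrow> a \<in> polys n"
  using poly_ring_mono num_params_le by blast

lemma reducible_carrier: "reducible \<subseteq> jet_eqns n m"
  unfolding reducible_def by blast

lemma N_reducible: "N \<subseteq> reducible"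
proof
  fix v assume "v \<in> N"
  then show "v \<in> reducible"
    unfolding reducible_def using N_closed(1) by (intro CollectI conjI exI[of _ "\<lambda>_. 0"]) auto
qed

lemma reducible_add:
  assumes "v \<in> reducible" "w \<in> reducible" shows "v + w \<in> reducible"
proof -
  obtain c d where *: "\<forall>y\<in>low_jets. c y \<in> polys num_params"
    "v - (\<Sum>y\<in>low_jets. eqn_scale (c y) (jet_vec y)) \<in> N"
    "\<forall>y\<in>low_jets. d y \<in> polys num_params"
    "w - (\<Sum>y\<in>low_jets. eqn_scale (d y) (jet_vec y)) \<in> N"
    using assms unfolding reducible_def by blast
  have "v + w - (\<Sum>y\<in>low_jets. eqn_scale (c y + d y) (jet_vec y)) =
    (v - (\<Sum>y\<in>low_jets. eqn_scale (c y) (jet_vec y))) + (w - (\<Sum>y\<in>low_jets. eqn_scale (d y) (jet_vec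
      y)))"
    by (simp add: eqn.scale_left_distrib sum.distrib algebra_simps)
  also have "\<dots> \<in> N" using * by (intro N_closed(3)) auto
  finally show ?thesis
    using * assms reducible_carrier unfolding reducible_def
    by (intro CollectI conjI exI[of _ "\<lambda>y. c y + d y"]) auto
qed

lemma reducible_sum: "(\<And>i. i \<in> I \<Longrightarrow> f i \<in> reducible) \<Longrightarrow> sum f I \<in> reducible"
  using N_reducible N_closed(2)
  by (induction I rule: infinite_finite_induct) (auto intro: reducible_add)

lemma reducible_scale:
  assumes "v \<in> reducible" "a \<in> polys num_params" shows "eqn_scale a v \<in> reducible"
proof -
  obtain c where *: "\<forall>y\<in>low_jets. c y \<in> polys num_params"
    "v - (\<Sum>y\<in>low_jets. eqn_scale (c y) (jet_vec y)) \<in> N" "v \<in> jet_eqns n m"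
    using assms unfolding reducible_def by blast
  have "eqn_scale a v - (\<Sum>y\<in>low_jets. eqn_scale (a * c y) (jet_vec y)) =
    eqn_scale a (v - (\<Sum>y\<in>low_jets. eqn_scale (c y) (jet_vec y)))"
    by (simp add: eqn.scale_right_diff_distrib eqn.scale_sum_right)
  also have "\<dots> \<in> N" using * assms(2) poly_ring_num_params by (intro N_closed(4)) auto
  finally show ?thesis
    using * assms(2) poly_ring_num_params unfolding reducible_def
    by (intro CollectI conjI exI[of _ "\<lambda>y. a * c y"]) auto
qed

lemma low_jet_reducible:
  assumes "y \<in> low_jets" shows "jet_vec y \<in> reducible"
proof -
  have "(\<Sum>z\<in>low_jets. eqn_scale (if z = y then 1 else 0) (jet_vec z)) =
    (\<Sum>z\<in>low_jets. if z = y then jet_vec z else (0 :: 'k equation))"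
    by (intro sum.cong) auto
  also have "\<dots> = jet_vec y" using assms finite_low_jets by (simp add: sum.delta)
  finally have "jet_vec y - (\<Sum>z\<in>low_jets. eqn_scale (if z = y then 1 else 0) (jet_vec z)) \<in> N"
    using N_closed(2) by simp
  moreover have "(jet_vec y :: 'k equation) \<in> jet_eqns n m"
    using assms by (auto simp: low_jets_def)
  ultimately show ?thesis
    unfolding reducible_def by (intro CollectI conjI exI[of _ "\<lambda>z. if z = y then 1 else 0"]) auto
qed

lemma shift_all_jets:
  assumes "(k, \<mu>) \<in> all_jets n m" "j \<in> {1..n}"
  shows "(k, single j 1 + \<mu>) \<in> all_jets n m"
  using assms Poly_Mapping.keys_add[of "single j 1" \<mu>] by (auto simp: all_jets_def)

lemma lower_jet:
  assumes "y \<in> all_jets n m" "i \<in> keys (snd y)"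
  obtains \<mu> where "snd y = single i 1 + \<mu>" "(fst y, \<mu>) \<in> all_jets n m"
    "jet_order y = Suc (jet_order (fst y, \<mu>))"
proof -
  obtain \<mu> where mu: "snd y = single i 1 + \<mu>" "keys \<mu> \<subseteq> keys (snd y)"
    using multi_index_split[OF assms(2)] .
  then have "(fst y, \<mu>) \<in> all_jets n m" using assms(1) by (auto simp: all_jets_def)
  then show thesis using that mu(1) by (simp add: jet_order_eq total_degree_add)
qed

text \<open>Induction on the class i of the jet. For i \<le> t a derivation d_i, which belongs to
  the coefficients, can be stripped off, leaving a low jet. For i > t the jet is solved for, and the
  other jets in its equation have lower order or lower class.\<close>

lemma top_jet_reducible:
  assumes "q > 0" "y \<in> all_jets n m" "jet_order y = q"
  shows "jet_vec y \<in> reducible"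
  using assms(2,3)
proof (induction "jet_class y" arbitrary: y rule: less_induct)
  case less
  have nz: "snd y \<noteq> 0" using less.prems(2) assms(1) by (auto simp: jet_order_eq)
  define i where "i = jet_class y"
  have i: "i \<in> {1..n}" "jet_of_class i y"
    using jet_class_range[OF less.prems(1) nz] by (auto simp: i_def)
  have y: "y \<in> jets n m q i" using less.prems i(2) by (simp add: jets_iff)
  show ?case
  proof (cases "i \<le> num_params")
    case True
    have "i \<in> keys (snd y)" using i(2) by (simp add: jet_of_class_def in_keys_iff)
    then obtain \<mu> where mu: "snd y = single i 1 + \<mu>" "(fst y, \<mu>) \<in> all_jets n m"
      "jet_order y = Suc (jet_order (fst y, \<mu>))"
      using lower_jet[OF less.prems(1)] by blast
    have "y = (fst y, single i 1 + \<mu>)" using mu(1) by (simp add: prod_eq_iff)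
    then have "jet_vec y = eqn_scale (deriv_var i) (jet_vec (fst y, \<mu>) :: 'k equation)"
      by (metis eqn_scale_deriv_jet_vec)
    moreover have "jet_order (fst y, \<mu>) < max q 1"
      using mu(3) less.prems(2) by linarith
    then have "(fst y, \<mu>) \<in> low_jets"
      using mu(2) unfolding low_jets_def by blast
    ultimately show ?thesis
      using reducible_scale[OF low_jet_reducible] True i(1) by simp
  next
    case False
    then obtain \<Phi> where \<Phi>: "\<Phi> \<in> equations_of_class q S ld i" "y = ld \<Phi>"
      using all_jets_leading[OF assms(1) i(1) _ y] by auto
    have PhiS: "\<Phi> \<in> S" using \<Phi>(1) by (simp add: equations_of_class_def top_equations_def)
    have carr: "\<Phi> \<in> jet_eqns n m" using PhiS S_carrier by blast
    have lc: "jet_coeff \<Phi> y \<noteq> 0" using coeff_leading[OF i(1) _ \<Phi>(1) \<Phi>(1)] i(1) \<Phi>(2) by simp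
    have other: "jet_vec z \<in> reducible" if z: "jet_coeff \<Phi> z \<noteq> 0" "z \<noteq> y" for z
    proof -
      have zall: "z \<in> all_jets n m" using jet_coeff_in_all_jets[OF carr z(1)] .
      show ?thesis
      proof (cases "jet_order z = q")
        case True
        have znz: "snd z \<noteq> 0" using True assms(1) by (auto simp: jet_order_eq)
        define j where "j = jet_class z"
        have j: "j \<in> {1..n}" "jet_of_class j z" using jet_class_range[OF zall znz] by
          (auto simp: j_def)
        \<comment> \<open>A jet of order \<open>q\<close> and class at least \<open>i\<close> is
          itself solved for; by elimination it can occur in \<open>\<Phi>\<close> only as the
          leading jet.\<close>
        have "j < i"
        proof (rule ccontr)
          assume "\<not> j < i"
          then obtain \<Psi> where \<Psi>: "\<Psi> \<in> equations_of_class q S ld j" "z = ld \<Psi>"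
            using all_jets_leading[OF assms(1) j(1), of z] False zall True j(2) by
              (auto simp: jets_iff)
          then have "\<Phi> = \<Psi>" using coeff_leading[OF j(1) _ \<Phi>(1) \<Psi>(1)] z(1) i(1) \<open>\<not> j < i\<close> by simp
          then show False using z(2) \<Psi>(2) \<Phi>(2) by simp
        qed
        then show ?thesis using less.hyps zall True by (simp add: i_def j_def)
      next
        case False
        then have "z \<in> low_jets" using S_order[OF PhiS z(1)] zall by (simp add: low_jets_def)
        then show ?thesis by (rule low_jet_reducible)
      qed
    qed
    let ?Y = "{z. jet_coeff \<Phi> z \<noteq> 0}"
    let ?r = "\<Sum>z\<in>?Y - {y}. eqn_scale (single 0 (jet_coeff \<Phi> z)) (jet_vec z)"
    have "(\<Sum>z\<in>?Y. eqn_scale (single 0 (jet_coeff \<Phi> z)) (jet_vec z)) =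
        eqn_scale (single 0 (jet_coeff \<Phi> y)) (jet_vec y) + ?r"
      using lc by (intro sum.remove finite_jet_support[OF carr]) simp
    with jet_expansion[OF carr]
    have "\<Phi> = eqn_scale (single 0 (jet_coeff \<Phi> y)) (jet_vec y) + ?r"
      by (rule trans)
    moreover have "\<Phi> + eqn_scale (- 1) ?r = \<Phi> - ?r" by simp
    ultimately have "\<Phi> + eqn_scale (- 1) ?r = eqn_scale (single 0 (jet_coeff \<Phi> y)) (jet_vec y)"
      by (metis (no_types, lifting) add_diff_cancel_right')
    then have "jet_vec y = eqn_scale (single 0 (1 / jet_coeff \<Phi> y)) (\<Phi> + eqn_scale (- 1) ?r)"
      using lc by (simp add: mult_single)
    also have "\<dots> \<in> reducible"
    proof (intro reducible_scale reducible_add reducible_sum)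
      show "\<Phi> \<in> reducible" using PhiS S_subset_N N_reducible by blast
    qed (use other in auto)
    finally show ?thesis .
  qed
qed

text \<open>A derivative of a low jet has order at most \<open>max q 1\<close>, so it is again low
  or of top order. This gives closure under all d_1, ..., d_n, not only under those among the
  coefficients.\<close>

lemma reducible_deriv:
  assumes v: "v \<in> reducible" and j: "j \<in> {1..n}"
  shows "eqn_scale (deriv_var j) v \<in> reducible"
proof -
  obtain c where c: "\<forall>y\<in>low_jets. c y \<in> polys num_params"
    "v - (\<Sum>y\<in>low_jets. eqn_scale (c y) (jet_vec y)) \<in> N"
    using v unfolding reducible_def by blast
  have low: "eqn_scale (deriv_var j) (jet_vec y) \<in> reducible" if y: "y \<in> low_jets" for y
  proof -
    obtain k \<mu> where ymu: "y = (k, \<mu>)" by (cases y)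
    let ?z = "(k, single j 1 + \<mu>)"
    have z: "?z \<in> all_jets n m" using shift_all_jets y j by (simp add: low_jets_def ymu)
    have ord: "jet_order ?z = Suc (jet_order y)"
      by (simp add: jet_order_eq ymu total_degree_add)
    have "jet_vec ?z \<in> reducible"
    proof (cases "jet_order ?z < max q 1")
      case True
      then show ?thesis using z by (intro low_jet_reducible) (simp add: low_jets_def)
    next
      case False
      then have eq: "jet_order ?z = max q 1" using ord y by (simp add: low_jets_def)
      show ?thesis
      proof (cases "q = 0")
        case True
        \<comment> \<open>For \<open>q = 0\<close> every derivation belongs to the
          coefficients.\<close>
        then have "num_params = n" unfolding num_params_def by simp
        then have "eqn_scale (deriv_var j) (jet_vec y) \<in> reducible"
          using j y poly_ring_deriv_var[of j n] by (intro reducible_scale low_jet_reducible) auto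
        then show ?thesis by (simp add: ymu eqn_scale_deriv_jet_vec)
      next
        case False
        then show ?thesis using eq z by (intro top_jet_reducible) auto
      qed
    qed
    then show ?thesis by (simp add: ymu eqn_scale_deriv_jet_vec)
  qed
  have "eqn_scale (deriv_var j) v =
      eqn_scale (deriv_var j) (v - (\<Sum>y\<in>low_jets. eqn_scale (c y) (jet_vec y))) +
      (\<Sum>y\<in>low_jets. eqn_scale (c y) (eqn_scale (deriv_var j) (jet_vec y)))"
    by (simp add: eqn.scale_right_diff_distrib eqn.scale_sum_right mult.commute)
  also have "\<dots> \<in> reducible"
  proof (rule reducible_add)
    show "eqn_scale (deriv_var j) (v - (\<Sum>y\<in>low_jets. eqn_scale (c y) (jet_vec y))) \<in> reducible"
      using N_closed(4)[OF _ c(2)] j N_reducible by auto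
    show "(\<Sum>y\<in>low_jets. eqn_scale (c y) (eqn_scale (deriv_var j) (jet_vec y))) \<in> reducible"
      using c(1) low by (intro reducible_sum reducible_scale[OF low]) auto
  qed
  finally show ?thesis .
qed

lemma jet_vec_reducible:
  assumes "y \<in> all_jets n m" shows "jet_vec y \<in> reducible"
  using assms
proof (induction "jet_order y" arbitrary: y)
  case 0
  then show ?case by (intro low_jet_reducible) (simp add: low_jets_def)
next
  case (Suc d)
  have "snd y \<noteq> 0" using Suc.hyps(2) by (auto simp: jet_order_eq)
  then obtain i where i: "i \<in> keys (snd y)"
    by (rule poly_mapping_nonzero_key)
  then obtain \<mu> where mu: "snd y = single i 1 + \<mu>" "(fst y, \<mu>) \<in> all_jets n m"
    "jet_order y = Suc (jet_order (fst y, \<mu>))"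
    using lower_jet[OF Suc.prems] by blast
  have "i \<in> {1..n}" using i Suc.prems by (auto simp: all_jets_def)
  then have "eqn_scale (deriv_var i) (jet_vec (fst y, \<mu>)) \<in> reducible"
    using Suc.hyps mu(2,3) by (intro reducible_deriv) auto
  moreover have "y = (fst y, single i 1 + \<mu>)" using mu(1) by (simp add: prod_eq_iff)
  ultimately show ?case by (metis eqn_scale_deriv_jet_vec)
qed

lemma jet_space_reducible: "jet_eqns n m \<subseteq> reducible"
proof
  fix v :: "'k equation" assume v: "v \<in> jet_eqns n m"
  have "(\<Sum>y\<in>{y. jet_coeff v y \<noteq> 0}. eqn_scale (single 0 (jet_coeff v y)) (jet_vec y)) \<in> reducible"
    using jet_coeff_in_all_jets[OF v]
    by (intro reducible_sum reducible_scale jet_vec_reducible) auto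
  then show "v \<in> reducible" using jet_expansion[OF v] by simp
qed

text \<open>The low jets, numbered as the locale expects. The spanning property is exported as well
  because it places every equation into some \<open>span_box\<close>.\<close>

lemma exists_fg_module:
  obtains g e where "fg_module eqn_scale n num_params N g e"
    "\<And>v. v \<in> jet_eqns n m \<Longrightarrow> \<exists>c. (\<forall>b<g. c b \<in> polys num_params) \<and>
      v - (\<Sum>b<g. eqn_scale (c b) (e b)) \<in> N"
    "\<And>b. b < g \<Longrightarrow> e b \<in> jet_eqns n m"
proof -
  let ?g = "card low_jets"
  obtain h where h: "bij_betw h {..<?g} low_jets"
    using ex_bij_betw_nat_finite[OF finite_low_jets] by (auto simp: atLeast0LessThan)
  define e where "e = (\<lambda>b. jet_vec (h b) :: 'k equation)"
  have hl: "h b \<in> low_jets" if "b < ?g" for b using h that by (auto simp: bij_betw_def)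
  have e: "e b \<in> jet_eqns n m" if "b < ?g" for b
    using hl[OF that] unfolding e_def low_jets_def by (intro jet_vec_jet_space) simp
  have span: "\<exists>c. (\<forall>b<?g. c b \<in> polys num_params) \<and>
      v - (\<Sum>b<?g. eqn_scale (c b) (e b)) \<in> N" if v: "v \<in> jet_eqns n m" for v
  proof -
    obtain c where c: "\<forall>y\<in>low_jets. c y \<in> polys num_params"
      "v - (\<Sum>y\<in>low_jets. eqn_scale (c y) (jet_vec y)) \<in> N"
      using v jet_space_reducible unfolding reducible_def by blast
    have "(\<Sum>b<?g. eqn_scale (c (h b)) (e b)) = (\<Sum>y\<in>low_jets. eqn_scale (c y) (jet_vec y))"
      unfolding e_def by (rule sum.reindex_bij_betw[OF h])
    then show ?thesis using c hl by (intro exI[of _ "\<lambda>b. c (h b)"]) auto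
  qed
  have "fg_module eqn_scale n num_params N ?g e"
  proof (intro fg_module.intro module_eqn_scale fg_module_axioms.intro)
    fix f :: "'k mpoly" and j assume "f \<in> polys n" "j < ?g"
    then show "\<exists>c. (\<forall>b<?g. c b \<in> polys num_params) \<and>
      eqn_scale f (e j) - (\<Sum>b<?g. eqn_scale (c b) (e b)) \<in> N"
      using e by (intro span jet_space_scale) auto
  qed (use num_params_le N_closed in auto)
  then show thesis using that span e by blast
qed

end

section \<open>Involutive systems\<close>

lemma k_span_submodule:
  fixes X :: "'k::field equation set"
  assumes "X \<subseteq> jet_eqns n m"
  shows "submodule (k_span n m X) (poly_ring 0) (jet_space n m)" "X \<subseteq> k_span n m X"
  using generated_submodule_submodule[OF module_jet_space[OF le0] assms] by (auto simp: k_span_def)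

lemma k_span_closed:
  fixes X :: "'k::field equation set"
  assumes "X \<subseteq> jet_eqns n m"
  shows "k_span n m X \<subseteq> jet_eqns n m" "0 \<in> k_span n m X"
    "v \<in> k_span n m X \<Longrightarrow> w \<in> k_span n m X \<Longrightarrow> v + w \<in> k_span n m X"
    "v \<in> k_span n m X \<Longrightarrow> eqn_scale (single 0 c) v \<in> k_span n m X"
  using k_span_submodule(1)[OF assms] unfolding submodule_jet_space_iff[OF le0] by simp_all

lemma k_span_least:
  "submodule H (poly_ring 0) (jet_space n m) \<Longrightarrow> X \<subseteq> H \<Longrightarrow> k_span n m X \<subseteq> H"
  unfolding k_span_def by (rule generated_submodule_least)

lemma k_span_mono:
  assumes "X \<subseteq> Y" "Y \<subseteq> jet_eqns n m"
  shows "k_span n m X \<subseteq> k_span n m Y"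
  using k_span_submodule[OF assms(2)] assms(1) by (intro k_span_least) auto

text \<open>Multiplication by \<open>a\<close> is k-linear, so its effect on a span is decided on
  generators.\<close>

lemma k_span_scale_image:
  fixes a :: "'k::field mpoly"
  assumes X: "X \<subseteq> jet_eqns n m" and Y: "Y \<subseteq> jet_eqns n m"
    and img: "\<And>x. x \<in> X \<Longrightarrow> eqn_scale a x \<in> k_span n m Y" and w: "w \<in> k_span n m X"
  shows "eqn_scale a w \<in> k_span n m Y"
proof -
  let ?H = "{w \<in> jet_eqns n m. eqn_scale a w \<in> k_span n m Y}"
  have "submodule ?H (poly_ring 0) (jet_space n m)"
  proof (intro iffD2[OF submodule_jet_space_iff[OF le0]] conjI ballI)
    show "0 \<in> ?H" using k_span_closed(2)[OF Y] by simp
  next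
    fix v w assume "v \<in> ?H" "w \<in> ?H"
    then show "v + w \<in> ?H" using k_span_closed(3)[OF Y] by (auto simp: eqn.scale_right_distrib)
  next
    fix b :: "'k mpoly" and v assume b: "b \<in> polys 0" and v: "v \<in> ?H"
    obtain c where c: "b = single 0 c" using b poly_ring_0_iff by blast
    have "eqn_scale a (eqn_scale b v) = eqn_scale b (eqn_scale a v)" by (simp add: mult.commute)
    also have "\<dots> \<in> k_span n m Y" unfolding c using v by (intro k_span_closed(4)[OF Y]) blast
    finally show "eqn_scale b v \<in> ?H" using v by (auto simp: c)
  qed auto
  moreover have "X \<subseteq> ?H" using X img by blast
  ultimately have "k_span n m X \<subseteq> ?H" by (rule k_span_least)
  then show ?thesis using w by blast
qed

lemma exists_max_nat:
  fixes f :: "'a \<Rightarrow> nat"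
  assumes "finite F" "F \<noteq> {}"
  obtains x where "x \<in> F" "\<And>y. y \<in> F \<Longrightarrow> f y \<le> f x"
proof -
  have "Max (f ` F) \<in> f ` F" using assms by (intro Max_in) auto
  then obtain x where "x \<in> F" "f x = Max (f ` F)" by auto
  then show thesis using that[of x] assms(1) by simp
qed

locale involutive_system = solved_system +
  assumes involutive: "involutive n m q S ld"
begin

lemma top_equation_class:
  assumes "\<Phi> \<in> top_equations q S"
  shows "jet_class (ld \<Phi>) \<in> {1..n}" "\<Phi> \<in> equations_of_class q S ld (jet_class (ld \<Phi>))"
    "ld \<Phi> \<in> all_jets n m" "jet_order (ld \<Phi>) = q" "jet_of_class (jet_class (ld \<Phi>)) (ld \<Phi>)"
proof -
  obtain i where i: "i \<in> {1..n}" "ld \<Phi> \<in> jets n m q i" "\<Phi> \<in> equations_of_class q S ld i"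
    using leading_jet[OF assms] .
  then have "jet_class (ld \<Phi>) = i" using jet_of_class_iff[of "ld \<Phi>" n m i] by (simp add: jets_iff)
  then show "jet_class (ld \<Phi>) \<in> {1..n}" "\<Phi> \<in> equations_of_class q S ld (jet_class (ld \<Phi>))"
    "ld \<Phi> \<in> all_jets n m" "jet_order (ld \<Phi>) = q" "jet_of_class (jet_class (ld \<Phi>)) (ld \<Phi>)"
    using i by (simp_all add: jets_iff)
qed

lemma multiplicative_iff:
  assumes "\<Phi> \<in> top_equations q S"
  shows "multiplicative q S ld \<Phi> j \<longleftrightarrow> j \<in> {1..jet_class (ld \<Phi>)}"
proof
  assume "multiplicative q S ld \<Phi> j"
  then obtain i where i: "\<Phi> \<in> equations_of_class q S ld i" "j \<in> {1..i}"
    unfolding multiplicative_def by blast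
  then have "jet_class (ld \<Phi>) = i"
    using jet_of_class_iff[OF top_equation_class(3)[OF assms], of i]
    by (auto simp: equations_of_class_def)
  then show "j \<in> {1..jet_class (ld \<Phi>)}" using i by simp
next
  assume "j \<in> {1..jet_class (ld \<Phi>)}"
  then show "multiplicative q S ld \<Phi> j"
    unfolding multiplicative_def using top_equation_class(2)[OF assms] by blast
qed

lemma top_subset_S: "top_equations q S \<subseteq> S"
  by (auto simp: top_equations_def)

text \<open>Only equations of order \<open>q\<close> have multiplicative derivations, hence
  \<open>top_equations\<close>. The bound \<open>d\<close> turns their multiplicative derivatives
  into a filtration, on which any derivation will raise the level by one.\<close>

definition mult_shifts :: "nat \<Rightarrow> 'a equation set" where
  "mult_shifts d = {eqn_scale (single \<nu> 1) \<Phi> | \<Phi> \<nu>. \<Phi> \<in> top_equations q S \<and>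
     keys \<nu> \<subseteq> {1..jet_class (ld \<Phi>)} \<and> total_degree \<nu> \<le> d}"

lemma mult_shifts_carrier: "S \<union> mult_shifts d \<subseteq> jet_eqns n m"
proof -
  have "eqn_scale (single \<nu> 1) \<Phi> \<in> jet_eqns n m"
    if "\<Phi> \<in> top_equations q S" "keys \<nu> \<subseteq> {1..jet_class (ld \<Phi>)}" for \<Phi> \<nu>
  proof (rule jet_space_scale)
    show "single \<nu> 1 \<in> polys n"
      using that top_equation_class(1)[OF that(1)] by (intro poly_ring_single) fastforce
    show "\<Phi> \<in> jet_eqns n m" using that S_carrier top_subset_S by blast
  qed
  then show ?thesis using S_carrier by (auto simp: mult_shifts_def)
qed

lemma mult_shifts_mono: "d \<le> d' \<Longrightarrow> mult_shifts d \<subseteq> mult_shifts d'"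
  unfolding mult_shifts_def by (auto intro: le_trans)

abbreviation "W d \<equiv> k_span n m (S \<union> mult_shifts d)"

lemma W_mono: "d \<le> d' \<Longrightarrow> W d \<subseteq> W d'"
  using mult_shifts_mono by (intro k_span_mono mult_shifts_carrier) blast

lemma deriv_eq: "eqn_scale (deriv_var j) (eqn_scale (single \<nu> 1) \<Phi>) =
    eqn_scale (single (single j 1 + \<nu>) 1) \<Phi>"
  by (simp add: deriv_var_def mult_single)

text \<open>Involution restated: multiplicative derivatives belong to level 1 by construction,
  nonmultiplicative ones by hypothesis.\<close>

lemma deriv_S:
  assumes "\<Phi> \<in> S" "j \<in> {1..n}" shows "eqn_scale (deriv_var j) \<Phi> \<in> W 1"
proof -
  have shift: "eqn_scale (deriv_var l) \<Psi> \<in> mult_shifts 1"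
    if "\<Psi> \<in> S" "multiplicative q S ld \<Psi> l" for \<Psi> l
  proof -
    have top: "\<Psi> \<in> top_equations q S"
      using that(2) by (auto simp: multiplicative_def equations_of_class_def)
    then have "l \<in> {1..jet_class (ld \<Psi>)}" using that(2) multiplicative_iff by blast
    then show ?thesis
      using top unfolding mult_shifts_def deriv_var_def
      by (intro CollectI exI[of _ \<Psi>] exI[of _ "single l 1"]) auto
  qed
  show ?thesis
  proof (cases "multiplicative q S ld \<Phi> j")
    case True
    then show ?thesis
      using shift[OF assms(1) True] k_span_submodule(2)[OF mult_shifts_carrier] by blast
  next
    case False
    then have "prolongation n m j \<Phi> \<in>
        k_span n m (S \<union> {prolongation n m l \<Psi> | \<Psi> l. \<Psi> \<in> S \<and> multiplicative q S ld \<Psi> l})"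
      using involutive assms unfolding involutive_def by blast
    also have "\<dots> \<subseteq> W 1"
      using shift by (intro k_span_mono mult_shifts_carrier) (auto simp: prolongation_def)
    finally show ?thesis by (simp add: prolongation_def)
  qed
qed

text \<open>Termination of the reduction of nonmultiplicative prolongations: a derivative \<open>d\<^sub>j\<close> is moved
  past a multiplicative \<open>d\<^sub>l\<close> with \<open>l < j\<close>, so the induction is on the order and then on \<open>j\<close>.\<close>

lemma deriv_W:
  assumes "w \<in> W d" "j \<in> {1..n}" shows "eqn_scale (deriv_var j) w \<in> W (Suc d)"
  using assms
proof (induction d arbitrary: j w)
  case 0
  show ?case
  proof (rule k_span_scale_image[OF mult_shifts_carrier mult_shifts_carrier _ "0.prems"(1)])
    fix x assume "x \<in> S \<union> mult_shifts 0"
    \<comment> \<open>A shift of degree 0 is the equation itself, so level 0 reduces to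
      involution.\<close>
    then have "x \<in> S"
    proof
      assume "x \<in> mult_shifts 0"
      then obtain \<Phi> \<nu> where x: "x = eqn_scale (single \<nu> 1) \<Phi>" "\<Phi> \<in> top_equations q S"
        "total_degree \<nu> = 0" by (auto simp: mult_shifts_def)
      have "0 = \<nu>" using x(3) by (intro total_degree_le_imp_eq) auto
      then have "x = \<Phi>" using x(1) by (metis eqn.scale_one single_one)
      then show "x \<in> S" using x(2) top_subset_S by auto
    qed
    then show "eqn_scale (deriv_var j) x \<in> W (Suc 0)" using deriv_S[of x j] "0.prems"(2) by simp
  qed
next
  case (Suc d)
  show ?case
    using Suc.prems
  proof (induction j arbitrary: w rule: less_induct)
    case (less j)
    show ?case
    proof (rule k_span_scale_image[OF mult_shifts_carrier mult_shifts_carrier _ less.prems(1)])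
      fix x assume x: "x \<in> S \<union> mult_shifts (Suc d)"
      have S: "eqn_scale (deriv_var j) x \<in> W (Suc (Suc d))" if "x \<in> S"
        using deriv_S[OF that less.prems(2)] W_mono[of 1 "Suc (Suc d)"] by auto
      show "eqn_scale (deriv_var j) x \<in> W (Suc (Suc d))"
      proof (cases "x \<in> S")
        case False
        then obtain \<Phi> \<nu> where *: "x = eqn_scale (single \<nu> 1) \<Phi>" "\<Phi> \<in> top_equations q S"
          "keys \<nu> \<subseteq> {1..jet_class (ld \<Phi>)}" "total_degree \<nu> \<le> Suc d"
          using x by (auto simp: mult_shifts_def)
        show ?thesis
        proof (cases "j \<le> jet_class (ld \<Phi>)")
          case True
          have "eqn_scale (deriv_var j) x \<in> mult_shifts (Suc (Suc d))"
            unfolding mult_shifts_def *(1) deriv_eq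
            using * True less.prems(2) Poly_Mapping.keys_add[of "single j 1" \<nu>]
            by (intro CollectI exI[of _ \<Phi>] exI[of _ "single j 1 + \<nu>"])
              (auto simp: total_degree_add)
          then show ?thesis using k_span_submodule(2)[OF mult_shifts_carrier] by blast
        next
          case nonmult: False
          show ?thesis
          proof (cases "\<nu> = 0")
            case True
            then have "x = \<Phi>" using *(1) by (metis eqn.scale_one single_one)
            then show ?thesis using S *(2) top_subset_S by blast
          next
            case False
            then obtain l where l: "l \<in> keys \<nu>" by (rule poly_mapping_nonzero_key)
            then obtain \<nu>' where nu: "\<nu> = single l 1 + \<nu>'"
              and "keys \<nu>' \<subseteq> keys \<nu>" by (rule multi_index_split)
            then have keys: "keys \<nu>' \<subseteq> {1..jet_class (ld \<Phi>)}" using *(3) by blast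
            have deg: "total_degree \<nu>' \<le> d" using *(4) unfolding nu by (simp add: total_degree_add)
            have lj: "l < j" "l \<in> {1..n}" using l *(3) nonmult less.prems(2) by auto
            let ?x' = "eqn_scale (single \<nu>' 1) \<Phi>"
            have "?x' \<in> mult_shifts d" unfolding mult_shifts_def using *(2) keys deg by blast
            then have "?x' \<in> W d" using k_span_submodule(2)[OF mult_shifts_carrier] by blast
            then have "eqn_scale (deriv_var j) ?x' \<in> W (Suc d)" using Suc.IH less.prems(2) by blast
            then have "eqn_scale (deriv_var l) (eqn_scale (deriv_var j) ?x') \<in> W (Suc (Suc d))"
              using less.IH[OF lj(1)] lj(2) by blast
            also have "eqn_scale (deriv_var l) (eqn_scale (deriv_var j) ?x')
              = eqn_scale (deriv_var j) x"
              unfolding *(1) nu deriv_eq by (simp add: add.left_commute)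
            finally show ?thesis .
          qed
        qed
      qed (rule S)
    qed
  qed
qed

text \<open>The union of the levels is a D-submodule containing \<open>S\<close>: monomials act one
  derivation at a time, each raising the level by one, and sums are formed in a common
  level.\<close>

lemma N_subset_W: "N \<subseteq> (\<Union>d. W d)"
proof (rule generated_submodule_least)
  show "S \<subseteq> (\<Union>d. W d)" using k_span_submodule(2)[OF mult_shifts_carrier] by blast
  let ?U = "\<Union>d. W d"
  have add: "v + w \<in> ?U" if vw: "v \<in> ?U" "w \<in> ?U" for v w
  proof -
    obtain d d' where "v \<in> W d" "w \<in> W d'" using vw by blast
    then have "v \<in> W (max d d')" "w \<in> W (max d d')"
      using W_mono[of d "max d d'"] W_mono[of d' "max d d'"] by auto
    then show ?thesis using k_span_closed(3)[OF mult_shifts_carrier] by blast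
  qed
  have mon: "eqn_scale (single \<mu> c) v \<in> ?U"
    if "keys \<mu> \<subseteq> {1..n}" "v \<in> ?U" for \<mu> c v
    using that
  proof (induction "total_degree \<mu>" arbitrary: \<mu>)
    case 0
    then have "0 = \<mu>" by (intro total_degree_le_imp_eq) auto
    then show ?case using 0 k_span_closed(4)[OF mult_shifts_carrier] by blast
  next
    case (Suc e)
    then have "\<mu> \<noteq> 0" by auto
    then obtain l where l: "l \<in> keys \<mu>" by (rule poly_mapping_nonzero_key)
    then obtain \<mu>' where mu: "\<mu> = single l 1 + \<mu>'"
      and keys: "keys \<mu>' \<subseteq> keys \<mu>" by (rule multi_index_split)
    have "keys \<mu>' \<subseteq> {1..n}" using Suc.prems(1) keys by blast
    moreover have "e = total_degree \<mu>'" using Suc.hyps(2) unfolding mu by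
      (simp add: total_degree_add)
    ultimately obtain d where "eqn_scale (single \<mu>' c) v \<in> W d"
      using Suc.hyps(1) Suc.prems(2) by blast
    then have "eqn_scale (deriv_var l) (eqn_scale (single \<mu>' c) v) \<in> W (Suc d)"
      using l Suc.prems(1) by (intro deriv_W) auto
    moreover have "eqn_scale (deriv_var l) (eqn_scale (single \<mu>' c) v) =
        eqn_scale (single \<mu> c) v"
      by (simp add: deriv_var_def mult_single mu)
    ultimately show ?case by (metis UN_I UNIV_I)
  qed
  have zero: "0 \<in> ?U" using k_span_closed(2)[OF mult_shifts_carrier] by blast
  show "submodule ?U (poly_ring n) (jet_space n m)"
  proof (intro iffD2[OF submodule_jet_space_iff[OF order_refl]] conjI ballI)
    show "?U \<subseteq> jet_eqns n m" using k_span_closed(1)[OF mult_shifts_carrier] by blast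
  next
    fix a :: "'a mpoly" and v assume a: "a \<in> polys n" and v: "v \<in> ?U"
    have "eqn_scale a v = (\<Sum>\<mu>\<in>keys a. eqn_scale (single \<mu> (lookup a \<mu>)) v)"
      by (subst mpoly_sum_monomials[of a]) (rule eqn.scale_sum_left)
    also have "\<dots> \<in> ?U"
    proof -
      have "(\<Sum>\<mu>\<in>A. eqn_scale (single \<mu> (lookup a \<mu>)) v) \<in> ?U"
        if "A \<subseteq> keys a" for A
        using finite_subset[OF that finite_keys] that
      proof (induction A rule: finite_induct)
        case (insert \<mu> A)
        have "keys \<mu> \<subseteq> {1..n}" using insert.prems a by (simp add: carrier_poly_ring_iff)
        moreover have "(\<Sum>\<mu>\<in>A. eqn_scale (single \<mu> (lookup a \<mu>)) v) \<in> ?U"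
          using insert.IH insert.prems by blast
        ultimately show ?case
          unfolding sum.insert[OF insert.hyps] by (intro add[OF mon[OF _ v]])
      qed (simp only: sum.empty zero)
      then show ?thesis by blast
    qed
    finally show "eqn_scale a v \<in> ?U" .
  qed (use zero add in auto)
qed

section \<open>Representation by multiplicative derivatives\<close>

definition low_order :: "'a equation set" where
  "low_order = {v \<in> jet_eqns n m. \<forall>y. jet_coeff v y \<noteq> 0 \<longrightarrow> jet_order y < q}"

definition index_pairs :: "('a equation \<times> multi_index) set" where
  "index_pairs = {(\<Phi>, \<nu>). \<Phi> \<in> top_equations q S \<and> keys \<nu> \<subseteq> {1..jet_class (ld \<Phi>)}}"

definition shift_sum :: "('a equation \<times> multi_index \<Rightarrow> 'a) \<Rightarrow> ('a equation \<times> multi_index) set \<Rightarrow> 'a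
  equation" where
  "shift_sum c F = (\<Sum>x\<in>F. eqn_scale (single (snd x) (c x)) (fst x))"

text \<open>Equations of \<open>S\<close> of order less than \<open>q\<close> are absorbed into
  \<open>u\<close>; the rest is a combination of multiplicative derivatives with distinct indices.
  Nonzero coefficients are insisted on so that a leading term can be read off.\<close>

lemma N_representation:
  assumes "v \<in> N"
  obtains u F c where "u \<in> low_order" "finite F" "F \<subseteq> index_pairs" "\<And>x. x \<in> F \<Longrightarrow> c x \<noteq> 0"
    "v = u + shift_sum c F"
proof -
  let ?H = "{u + shift_sum c F | u c F. u \<in> low_order \<and> finite F \<and> F \<subseteq> index_pairs}"
  have low_zero: "0 \<in> low_order" by (simp add: low_order_def)
  have shift_carrier: "eqn_scale (single (snd x) a) (fst x) \<in> jet_eqns n m"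
    if "x \<in> index_pairs" for x a
  proof (rule jet_space_scale)
    have top: "fst x \<in> top_equations q S" and keys: "keys (snd x) \<subseteq> {1..jet_class (ld (fst x))}"
      using that by (auto simp: index_pairs_def)
    show "fst x \<in> jet_eqns n m" using top S_carrier top_subset_S by blast
    have "{1..jet_class (ld (fst x))} \<subseteq> {1..n}" using top_equation_class(1)[OF top] by auto
    then show "single (snd x) a \<in> polys n"
      using keys by (intro poly_ring_single) blast
  qed
  have sum_carrier: "shift_sum c F \<in> jet_eqns n m" if "F \<subseteq> index_pairs" for c F
    using that unfolding shift_sum_def
    by (induction F rule: infinite_finite_induct) (auto intro!: jet_space_add shift_carrier)
  \<comment> \<open>Coefficients are padded by zeros to a common index set so that two sums can be
    added termwise.\<close>
  have extend: "shift_sum c F = shift_sum (\<lambda>x. if x \<in> F then c x else 0) (F \<union> G)"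
    if "finite F" "finite G" for c F G
    unfolding shift_sum_def using that
    by (intro sum.mono_neutral_cong_left) auto
  have sub: "submodule ?H (poly_ring 0) (jet_space n m)"
  proof (intro iffD2[OF submodule_jet_space_iff[OF le0]] conjI ballI)
    show "?H \<subseteq> jet_eqns n m"
      using sum_carrier by (auto intro!: jet_space_add simp: low_order_def)
    have "0 = 0 + shift_sum (\<lambda>_. 0) {}" by (simp add: shift_sum_def)
    then show "0 \<in> ?H" using low_zero by blast
  next
    fix v w assume "v \<in> ?H" "w \<in> ?H"
    then obtain u c F u' c' F' where *: "v = u + shift_sum c F" "u \<in> low_order" "finite F"
      "F \<subseteq> index_pairs"
      "w = u' + shift_sum c' F'" "u' \<in> low_order" "finite F'" "F' \<subseteq> index_pairs" by blast
    have "shift_sum c F + shift_sum c' F' =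
      shift_sum (\<lambda>x. (if x \<in> F then c x else 0) + (if x \<in> F' then c' x else 0)) (F \<union> F')"
      unfolding extend[OF *(3,7)] extend[OF *(7,3)] Un_commute[of F' F]
      by (simp add: shift_sum_def single_add eqn.scale_left_distrib sum.distrib)
    then have "v + w = (u + u') +
      shift_sum (\<lambda>x. (if x \<in> F then c x else 0) + (if x \<in> F' then c' x else 0)) (F \<union> F')"
      unfolding * by (metis (no_types, lifting) add.assoc add.left_commute)
    moreover have "u + u' \<in> low_order"
    proof -
      have "jet_order y < q" if "jet_coeff (u + u') y \<noteq> 0" for y
      proof -
        have "jet_coeff u y \<noteq> 0 \<or> jet_coeff u' y \<noteq> 0" using that by (auto simp: jet_coeff_add)
        then show ?thesis using *(2,6) unfolding low_order_def by blast
      qed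
      then show ?thesis using *(2,6) unfolding low_order_def by auto
    qed
    ultimately show "v + w \<in> ?H" using *(3,4,7,8) by blast
  next
    fix b :: "'a mpoly" and v assume b: "b \<in> polys 0" and "v \<in> ?H"
    then obtain u c F where *: "v = u + shift_sum c F" "u \<in> low_order" "finite F"
      "F \<subseteq> index_pairs" by blast
    obtain a where a: "b = single 0 a" using b poly_ring_0_iff by blast
    have "eqn_scale b v = eqn_scale b u + shift_sum (\<lambda>x. a * c x) F"
      by (simp add: * a shift_sum_def eqn.scale_right_distrib eqn.scale_sum_right mult_single)
    moreover have "eqn_scale b u \<in> low_order"
    proof -
      have "jet_coeff (eqn_scale b u) y = a * jet_coeff u y" for y
        using jet_coeff_monomial_scale[of 0 a u "fst y" "snd y"] by (simp add: a)
      then show ?thesis using *(2) by (auto simp: low_order_def a)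
    qed
    ultimately show "eqn_scale b v \<in> ?H" using *(3,4) by blast
  qed
  have "S \<union> mult_shifts d \<subseteq> ?H" for d
  proof
    fix x assume x: "x \<in> S \<union> mult_shifts d"
    have shift: "eqn_scale (single \<nu> 1) \<Phi> \<in> ?H" if "(\<Phi>, \<nu>) \<in> index_pairs" for \<Phi> \<nu>
    proof -
      have "eqn_scale (single \<nu> 1) \<Phi> = 0 + shift_sum (\<lambda>_. 1) {(\<Phi>, \<nu>)}"
        by (simp add: shift_sum_def)
      moreover have "{(\<Phi>, \<nu>)} \<subseteq> index_pairs" "finite {(\<Phi>, \<nu>)}" using that by auto
      ultimately show ?thesis using low_zero by blast
    qed
    show "x \<in> ?H"
    proof (cases "x \<in> low_order")
      case True
      have "x = x + shift_sum (\<lambda>_. 0) {}" by (simp add: shift_sum_def)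
      then show ?thesis using True by blast
    next
      case False
      \<comment> \<open>An equation of \<open>S\<close> that is not of low order has order exactly
        \<open>q\<close>; it counts as its own derivative with \<nu> = 0.\<close>
      then have "\<exists>\<Phi> \<nu>. x = eqn_scale (single \<nu> 1) \<Phi> \<and> (\<Phi>, \<nu>) \<in> index_pairs"
      proof (cases "x \<in> S")
        case True
        then obtain y where y: "jet_coeff x y \<noteq> 0" "\<not> jet_order y < q"
          using False S_carrier unfolding low_order_def by blast
        then have "x \<in> top_equations q S"
          using True S_order[OF True y(1)] unfolding top_equations_def
          by (intro CollectI conjI exI[of _ y]) auto
        then show ?thesis
          by (intro exI[of _ x] exI[of _ 0]) (auto simp: index_pairs_def)
      next
        case False
        then show ?thesis using x unfolding mult_shifts_def index_pairs_def by blast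
      qed
      then show ?thesis using shift by blast
    qed
  qed
  then have "W d \<subseteq> ?H" for d using sub by (intro k_span_least)
  then have "v \<in> ?H" using N_subset_W assms by blast
  then obtain u c F where *: "v = u + shift_sum c F" "u \<in> low_order" "finite F" "F \<subseteq> index_pairs"
    by blast
  have "shift_sum c F = shift_sum c {x \<in> F. c x \<noteq> 0}"
    unfolding shift_sum_def using *(3) by (intro sum.mono_neutral_right) auto
  then have "v = u + shift_sum c {x \<in> F. c x \<noteq> 0}" using *(1) by simp
  moreover have "finite {x \<in> F. c x \<noteq> 0}" "{x \<in> F. c x \<noteq> 0} \<subseteq> index_pairs" using *(3,4) by auto
  ultimately show thesis using *(2) by (intro that[of u "{x \<in> F. c x \<noteq> 0}" c]) simp_all
qed

text \<open>\<open>d\<^sup>\<nu> \<Phi>\<close> has a coefficient at \<open>ld \<Phi>\<close> shifted by \<open>\<nu>\<close>; if \<open>(\<Phi>, \<nu>)\<close> maximizes first the order of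
  \<open>\<nu>\<close>, then the class \<open>i\<close> of \<open>\<Phi>\<close>, then the exponent \<open>\<nu>\<^sub>i\<close>, no other summand can cancel it.\<close>

lemma shift_sum_leading_coeff:
  assumes F: "finite F" "F \<noteq> {}" "F \<subseteq> index_pairs" "\<And>x. x \<in> F \<Longrightarrow> c x \<noteq> 0"
  obtains \<Phi> \<nu> where "(\<Phi>, \<nu>) \<in> index_pairs"
    "jet_coeff (shift_sum c F) (fst (ld \<Phi>), \<nu> + snd (ld \<Phi>)) \<noteq> 0"
proof -
  let ?cl = "\<lambda>x :: 'a equation \<times> multi_index. jet_class (ld (fst x))"
  obtain x1 where x1: "x1 \<in> F" "\<And>y. y \<in> F \<Longrightarrow> total_degree (snd y) \<le> total_degree (snd x1)"
    using exists_max_nat[OF F(1,2), of "\<lambda>x. total_degree (snd x)"] by blast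
  let ?F1 = "{x \<in> F. total_degree (snd x) = total_degree (snd x1)}"
  have "finite ?F1" "?F1 \<noteq> {}" using F(1) x1(1) by (simp, blast)
  then obtain x2 where x2: "x2 \<in> ?F1" "\<And>y. y \<in> ?F1 \<Longrightarrow> ?cl y \<le> ?cl x2"
    using exists_max_nat[of ?F1 ?cl] by blast
  let ?F2 = "{x \<in> ?F1. ?cl x = ?cl x2}"
  have "finite ?F2" "?F2 \<noteq> {}" using F(1) x2(1) by (simp, blast)
  then obtain x3 where x3: "x3 \<in> ?F2" "\<And>y. y \<in> ?F2 \<Longrightarrow>
      lookup (snd y) (?cl x2) \<le> lookup (snd x3) (?cl x2)"
    using exists_max_nat[of ?F2 "\<lambda>x. lookup (snd x) (?cl x2)"] by blast
  obtain \<Phi> \<nu> where x3eq: "x3 = (\<Phi>, \<nu>)" by (cases x3)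
  define i where "i = jet_class (ld \<Phi>)"
  define \<kappa> where "\<kappa> = snd (ld \<Phi>)"
  have x3F: "(\<Phi>, \<nu>) \<in> F" and deg3: "total_degree \<nu> = total_degree (snd x1)" and i2: "?cl x2 = i"
    using x3(1) by (auto simp: x3eq i_def)
  have top: "\<Phi> \<in> top_equations q S" and nu: "keys \<nu> \<subseteq> {1..i}"
    using x3F F(3) by (auto simp: index_pairs_def i_def)
  note tc = top_equation_class[OF top, folded i_def]
  have kdeg: "total_degree \<kappa> = q" using tc(4) by (simp add: jet_order_eq \<kappa>_def)
  have klow: "lookup \<kappa> j = 0" if "j < i" for j
  proof (cases "j = 0")
    case True
    then have "j \<notin> keys \<kappa>" using tc(3) by (auto simp: all_jets_def \<kappa>_def)
    then show ?thesis by (simp add: in_keys_iff)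
  next
    case False
    then show ?thesis using tc(5) that by (simp add: jet_of_class_def \<kappa>_def)
  qed
  have unique: "x = (\<Phi>, \<nu>)"
    if x: "x \<in> F" and nz: "jet_coeff (eqn_scale (single (snd x) (c x)) (fst x)) (fst (ld \<Phi>), \<nu> +
      \<kappa>) \<noteq> 0" for x
  proof -
    obtain \<Phi>' \<nu>' where xeq: "x = (\<Phi>', \<nu>')" by (cases x)
    define i' where "i' = jet_class (ld \<Phi>')"
    have top': "\<Phi>' \<in> top_equations q S" and nu': "keys \<nu>' \<subseteq> {1..i'}"
      using x F(3) by (auto simp: index_pairs_def xeq i'_def)
    obtain \<mu> where mu: "\<nu> + \<kappa> = \<nu>' + \<mu>" "jet_coeff \<Phi>' (fst (ld \<Phi>), \<mu>) \<noteq> 0"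
      using jet_coeff_monomial_scale_nonzero[OF nz] by (auto simp: xeq)
    have mdeg: "total_degree \<mu> \<le> q"
      using S_order[OF _ mu(2)] top' top_subset_S by (auto simp: jet_order_eq)
    have "total_degree \<nu>' \<le> total_degree \<nu>" using x1(2)[OF x] deg3 by (simp add: xeq)
    moreover have "total_degree \<nu> + q = total_degree \<nu>' + total_degree \<mu>"
      using mu(1) kdeg by (metis total_degree_add)
    \<comment> \<open>Neither factor can have larger order than its counterpart while the sums
      agree, so \<open>\<Phi>'\<close> contributes through a jet of order \<open>q\<close>.\<close>
    ultimately have degs: "total_degree \<nu>' = total_degree \<nu>" "total_degree \<mu> = q" using mdeg by auto
    have xF1: "x \<in> ?F1" using x degs(1) deg3 by (simp add: xeq)
    then have i'i: "i' \<le> i" using x2(2)[OF xF1] i2 by (simp add: xeq i'_def)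
    have at_i: "lookup \<nu>' i \<le> lookup \<nu> i"
    proof (cases "i' = i")
      case True
      then have "x \<in> ?F2" using xF1 i2 by (simp add: xeq i'_def)
      then show ?thesis using x3(2)[of x] i2 by (simp add: xeq x3eq)
    next
      case False
      then have "i \<notin> keys \<nu>'" using nu' i'i by auto
      then show ?thesis by (simp add: in_keys_iff)
    qed
    \<comment> \<open>Below \<open>i\<close> the leading exponent \<kappa> vanishes, above
      \<open>i\<close> the shift \<nu>' does, and at \<open>i\<close> the maximality of \<nu>
      decides. With equal orders this forces \<kappa> = \<mu>.\<close>
    have "lookup \<kappa> j \<le> lookup \<mu> j" for j
    proof -
      have eq: "lookup \<nu> j + lookup \<kappa> j =
          lookup \<nu>' j + lookup \<mu> j"
        using mu(1) by (metis lookup_add)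
      consider "j < i" | "j = i" | "j > i" by linarith
      then show ?thesis
      proof cases
        case 1 then show ?thesis using klow by simp
      next
        case 2 then show ?thesis using eq at_i by simp
      next
        case 3
        then have "j \<notin> keys \<nu>'" using nu' i'i by auto
        then have "lookup \<nu>' j = 0" by (simp add: in_keys_iff)
        then show ?thesis using eq by simp
      qed
    qed
    then have "\<kappa> = \<mu>" using kdeg degs(2) by (intro total_degree_le_imp_eq) auto
    then have "jet_coeff \<Phi>' (ld \<Phi>) \<noteq> 0" using mu(2) by (metis \<kappa>_def prod.collapse)
    then have "\<Phi>' = \<Phi>"
      using coeff_leading[OF tc(1) _ top_equation_class(2)[OF top'] tc(2)]
        top_equation_class(1)[OF top'] i'i by (simp add: i'_def)
    moreover have "\<nu>' = \<nu>" using mu(1) \<open>\<kappa> = \<mu>\<close> by simp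
    ultimately show ?thesis by (simp add: xeq)
  qed
  have "jet_coeff (shift_sum c F) (fst (ld \<Phi>), \<nu> + \<kappa>) =
      (\<Sum>x\<in>F. jet_coeff (eqn_scale (single (snd x) (c x)) (fst x)) (fst (ld \<Phi>), \<nu> + \<kappa>))"
    by (simp add: shift_sum_def jet_coeff_sum)
  also have "\<dots> = (\<Sum>x\<in>{(\<Phi>, \<nu>)}. jet_coeff (eqn_scale (single (snd x) (c x)) (fst x)) (fst (ld \<Phi>), \<nu>
    + \<kappa>))"
    using F(1) x3F unique by (intro sum.mono_neutral_right) blast+
  also have "\<dots> = c (\<Phi>, \<nu>) * jet_coeff \<Phi> (ld \<Phi>)"
    by (simp add: jet_coeff_monomial_scale) (simp add: \<kappa>_def)
  finally have "jet_coeff (shift_sum c F) (fst (ld \<Phi>), \<nu> + \<kappa>) \<noteq> 0"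
    using F(4)[OF x3F] coeff_leading[OF tc(1) _ tc(2) tc(2)] tc(1) by simp
  then show thesis using that x3F F(3) by (auto simp: \<kappa>_def)
qed

text \<open>This is the disjointness of cones: among jets of order \<open>q\<close>, each shifted
  only by monomials in the variables up to its class, no two distinct ones can meet.\<close>

lemma jet_shift_disjoint:
  assumes "(\<Phi>, \<nu>) \<in> index_pairs" "(k, \<mu>) \<in> jets n m q t" "t \<ge> 1"
    and "keys \<rho> \<subseteq> {1..t}" "fst (ld \<Phi>) = k" "\<nu> + snd (ld \<Phi>) = \<rho> + \<mu>"
  shows "ld \<Phi> = (k, \<mu>) \<and> \<Phi> \<in> equations_of_class q S ld t"
proof -
  define i where "i = jet_class (ld \<Phi>)"
  define \<kappa> where "\<kappa> = snd (ld \<Phi>)"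
  have top: "\<Phi> \<in> top_equations q S" and nu: "keys \<nu> \<subseteq> {1..i}"
    using assms(1) by (auto simp: index_pairs_def i_def)
  note tc = top_equation_class[OF top, folded i_def]
  have mu: "(k, \<mu>) \<in> all_jets n m" "jet_order (k, \<mu>) = q" "jet_of_class t (k, \<mu>)"
    using assms(2) by (simp_all add: jets_iff)
  have degs: "total_degree \<kappa> = q" "total_degree \<mu> = q"
    using tc(4) mu(2) by (simp_all add: jet_order_eq \<kappa>_def)
  have zero: "lookup (snd y) j = 0"
    if "y \<in> all_jets n m" "jet_of_class l y" "j < l" for y j l
  proof (cases "j = 0")
    case True
    then have "j \<notin> keys (snd y)" using that(1) by (auto simp: all_jets_def)
    then show ?thesis by (simp add: in_keys_iff)
  next
    case False
    then show ?thesis using that by (simp add: jet_of_class_def)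
  qed
  have nu0: "lookup \<nu> j = 0" if "j > i" for j using nu that by (force simp: in_keys_iff)
  have rho0: "lookup \<rho> j = 0" if "j > t" for j using assms(4) that by (force simp: in_keys_iff)
  have eq: "lookup \<nu> j + lookup \<kappa> j =
      lookup \<rho> j + lookup \<mu> j" for j
    using assms(6) unfolding \<kappa>_def by (metis lookup_add)
  \<comment> \<open>The jet of higher class, or for equal classes the one with the smaller exponent
    at \<open>t\<close>, is exponentwise below the other: it vanishes under its own class, and
    beyond that the shift of the other jet vanishes.\<close>
  have "\<kappa> = \<mu>"
  proof (cases "i > t \<or> (i = t \<and> lookup \<kappa> t \<le> lookup \<mu> t)")
    case True
    have "lookup \<kappa> j \<le> lookup \<mu> j" for j
    proof -
      consider "j < i" | "j = i" "i = t" | "j \<ge> i" "j > t" using True by linarith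
      then show ?thesis
      proof cases
        case 1 then show ?thesis using zero[OF tc(3,5)] by (simp add: \<kappa>_def)
      next
        case 2 then show ?thesis using True by auto
      next
        case 3 then show ?thesis using eq[of j] rho0 by simp
      qed
    qed
    then show ?thesis using degs by (intro total_degree_le_imp_eq) auto
  next
    case False
    have "lookup \<mu> j \<le> lookup \<kappa> j" for j
    proof -
      consider "j < t" | "j = t" "i = t" | "j \<ge> t" "j > i" using False by linarith
      then show ?thesis
      proof cases
        case 1 then show ?thesis using zero[OF mu(1,3)] by simp
      next
        case 2 then show ?thesis using False by auto
      next
        case 3 then show ?thesis using eq[of j] nu0 by simp
      qed
    qed
    then show ?thesis using degs by (intro total_degree_le_imp_eq[symmetric]) auto
  qed
  then have ld: "ld \<Phi> = (k, \<mu>)" using assms(5) by (simp add: \<kappa>_def prod_eq_iff)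
  then have "i = t" using jet_of_class_iff[OF mu(1) assms(3)] mu(3) by (simp add: i_def)
  then show ?thesis using ld tc(2) by simp
qed

text \<open>For an unsolved jet \<open>y\<close> of class t all jets in \<open>a\<close> times
  \<open>y\<close> lie in the cone of \<open>y\<close>. If the product were in \<open>N\<close>, its
  representation would exhibit a jet in the cone of a solved jet, and those cones are disjoint from
  that of \<open>y\<close>.\<close>

lemma ann_num_params_trivial:
  assumes a: "a \<in> polys num_params" and kill: "\<And>v. v \<in> jet_eqns n m \<Longrightarrow> eqn_scale a v \<in> N"
    and proper: "v0 \<in> jet_eqns n m" "v0 \<notin> N"
  shows "a = 0"
proof (rule ccontr)
  assume nz: "a \<noteq> 0"
  consider "q = 0" | "q > 0" "num_params = 0" | "q > 0" "num_params > 0" by linarith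
  then show False
  proof cases
    case 1
    \<comment> \<open>For \<open>q = 0\<close> the submodule is zero, and the jet space is torsion
      free.\<close>
    then have "eqn_scale a v0 = 0" using kill[OF proper(1)] no_equations_order_0 by simp
    moreover have "v0 \<noteq> 0" using proper(2) N_closed(2) by blast
    ultimately show False using nz by (auto simp: eqn_scale_def fun_eq_iff)
  next
    case 2
    \<comment> \<open>For t = 0 the polynomial \<open>a\<close> is a constant, and a nonzero
      constant is invertible.\<close>
    then obtain c where c: "a = single 0 c" using a poly_ring_0_iff by metis
    then have "c \<noteq> 0" using nz by auto
    then have "eqn_scale (single 0 (1 / c)) (eqn_scale a v0) = v0"
      by (simp add: c mult_single)
    then show False using N_closed(4)[OF _ kill[OF proper(1)], of "single 0 (1 / c)"] proper(2)
      by simp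
  next
    case 3
    obtain y where y: "y \<in> jets n m q num_params" "y \<notin> ld ` equations_of_class q S ld num_params"
      using exists_non_leading_jet[OF 3] .
    obtain k \<mu> where yeq: "y = (k, \<mu>)" by (cases y)
    let ?v = "eqn_scale a (jet_vec y)"
    have coeff: "jet_coeff ?v (k', \<mu> + \<rho>) = (if k' = k then lookup a \<rho> else 0)" for k' \<rho>
      using lookup_single_mult_add[of \<mu> 1 a \<rho>]
      by (simp add: jet_coeff_def eqn_scale_def jet_vec_def yeq mult.commute)
    have coeff_nz: "l = k \<and> (\<exists>\<rho>\<in>keys a. \<kappa> = \<rho> + \<mu>)" if "jet_coeff ?v (l, \<kappa>) \<noteq> 0" for l \<kappa>
    proof -
      have lk: "l = k" using that by (auto simp: jet_coeff_def eqn_scale_def jet_vec_def yeq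
        split: if_splits)
      then have "\<kappa> \<in> keys (a * single \<mu> 1)"
        using that by (simp add: jet_coeff_def eqn_scale_def jet_vec_def yeq in_keys_iff)
      then show ?thesis
        using lk Poly_Mapping.keys_mult[of a "single \<mu> 1"] by auto
    qed
    have "jet_vec y \<in> jet_eqns n m" using y(1) by (auto simp: jets_iff)
    then obtain u F c where rep: "u \<in> low_order" "finite F" "F \<subseteq> index_pairs" "\<And>x. x \<in> F \<Longrightarrow> c x \<noteq> 0"
      "?v = u + shift_sum c F"
      using N_representation[OF kill] by blast
    have mu_deg: "total_degree \<mu> = q" using y(1) by (simp add: jets_iff jet_order_eq yeq)
    show False
    proof (cases "F = {}")
      case True
      \<comment> \<open>Without derivatives the product has order less than \<open>q\<close>, but
        every jet in it has order at least \<open>q\<close>.\<close>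
      then have "?v = u" using rep(5) by (simp add: shift_sum_def)
      obtain \<rho> where "\<rho> \<in> keys a" using nz by (rule poly_mapping_nonzero_key)
      then have "jet_coeff u (k, \<mu> + \<rho>) \<noteq> 0" using coeff \<open>?v = u\<close> by (simp add: in_keys_iff)
      then have "jet_order (k, \<mu> + \<rho>) < q" using rep(1) unfolding low_order_def by blast
      then show False by (simp add: jet_order_eq total_degree_add mu_deg)
    next
      case False
      obtain \<Phi> \<nu> where lead: "(\<Phi>, \<nu>) \<in> index_pairs"
        "jet_coeff (shift_sum c F) (fst (ld \<Phi>), \<nu> + snd (ld \<Phi>)) \<noteq> 0"
        by (rule shift_sum_leading_coeff[OF rep(2) False rep(3), of c]) (use rep(4) in auto)
      have "jet_order (ld \<Phi>) = q" using lead(1) top_equation_class(4) by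
        (auto simp: index_pairs_def)
      \<comment> \<open>The leading jet has order at least \<open>q\<close>, so \<open>u\<close>
        cannot cancel it.\<close>
      then have "\<not> jet_order (fst (ld \<Phi>), \<nu> + snd (ld \<Phi>)) < q"
        by (simp add: jet_order_eq total_degree_add)
      then have "jet_coeff u (fst (ld \<Phi>), \<nu> + snd (ld \<Phi>)) = 0"
        using rep(1) unfolding low_order_def by blast
      then have "jet_coeff ?v (fst (ld \<Phi>), \<nu> + snd (ld \<Phi>)) \<noteq> 0"
        using lead(2) by (simp add: rep(5) jet_coeff_add)
      then obtain \<rho> where rho: "fst (ld \<Phi>) = k" "\<rho> \<in> keys a" "\<nu> + snd (ld \<Phi>) = \<rho> + \<mu>"
        using coeff_nz by blast
      have "keys \<rho> \<subseteq> {1..num_params}" using rho(2) a by (simp add: carrier_poly_ring_iff)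
      then have "ld \<Phi> = (k, \<mu>) \<and> \<Phi> \<in> equations_of_class q S ld num_params"
        using y(1) 3(2) rho by (intro jet_shift_disjoint[OF lead(1)]) (auto simp: yeq)
      then show False using y(2) yeq by (metis imageI)
    qed
  qed
qed

end

section \<open>The kernel of the localization map\<close>

lemma rational_functions_simps [simp]:
  "x \<oplus>\<^bsub>rational_functions s\<^esub> y = x + y" "\<zero>\<^bsub>rational_functions s\<^esub> = 0"
  "a \<odot>\<^bsub>rational_functions s\<^esub> x = Fract a 1 * x"
  by (simp_all add: rational_functions_def)

lemma carrier_rational_functions:
  "x \<in> carrier (rational_functions s) \<longleftrightarrow>
    (\<exists>a b. x = Fract a b \<and> a \<in> polys s \<and> b \<in> polys s \<and> b \<noteq> 0)"
  by (simp add: rational_functions_def)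

lemma Fract_in_rational_functions [intro]:
  "a \<in> polys s \<Longrightarrow> b \<in> polys s \<Longrightarrow> b \<noteq> 0 \<Longrightarrow>
    Fract a b \<in> carrier (rational_functions s)"
  unfolding carrier_rational_functions by blast

lemma one_in_rational_functions [simp]: "1 \<in> carrier (rational_functions s)"
  unfolding One_fract_def by (intro Fract_in_rational_functions) auto

lemma module_rational_functions:
  "Module.module (poly_ring s) (rational_functions s :: ('k::field mpoly, 'k mpoly fract)
    Module.module)"
proof (rule Module.moduleI)
  let ?Q = "rational_functions s :: ('k mpoly, 'k mpoly fract) Module.module"
  show "abelian_group ?Q"
  proof (rule abelian_groupI)
    fix x y assume "x \<in> carrier ?Q" "y \<in> carrier ?Q"
    then obtain a b c d where *: "x = Fract a b" "y = Fract c d" "b \<noteq> 0" "d \<noteq> 0"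
      "a \<in> polys s" "b \<in> polys s" "c \<in> polys s" "d \<in> polys s"
      unfolding carrier_rational_functions by blast
    then have "x + y = Fract (a * d + c * b) (b * d)" by simp
    also have "\<dots> \<in> carrier ?Q" using * by (intro Fract_in_rational_functions) auto
    finally show "x \<oplus>\<^bsub>?Q\<^esub> y \<in> carrier ?Q" by simp
  next
    have "(0 :: 'k mpoly fract) = Fract 0 1" by (rule Zero_fract_def)
    also have "\<dots> \<in> carrier ?Q" by (intro Fract_in_rational_functions) auto
    finally show "\<zero>\<^bsub>?Q\<^esub> \<in> carrier ?Q" by simp
  next
    fix x assume "x \<in> carrier ?Q"
    then obtain a b where *: "x = Fract a b" "b \<noteq> 0"
      "a \<in> polys s" "b \<in> polys s"
      unfolding carrier_rational_functions by blast
    then have "- x = Fract (- a) b" by simp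
    also have "\<dots> \<in> carrier ?Q" using * by (intro Fract_in_rational_functions) auto
    finally show "\<exists>y\<in>carrier ?Q. y \<oplus>\<^bsub>?Q\<^esub> x = \<zero>\<^bsub>?Q\<^esub>" by (intro bexI[of _ "- x"]) auto
  qed (auto simp: algebra_simps)
next
  fix a :: "'k mpoly" and x assume a: "a \<in> polys s" and "x
    \<in> carrier (rational_functions s :: ('k mpoly, 'k mpoly fract) Module.module)"
  then obtain c d where *: "x = Fract c d" "d \<noteq> 0" "c \<in> polys s" "d \<in> polys s"
    unfolding carrier_rational_functions by blast
  then have "Fract a 1 * x = Fract (a * c) d" by simp
  also have "\<dots> \<in> carrier (rational_functions s)" using a *
    by (intro Fract_in_rational_functions) auto
  finally show "a \<odot>\<^bsub>rational_functions s\<^esub> x \<in> carrier (rational_functions s)" by simp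
next
  fix a b :: "'k mpoly" and x
  have "Fract (a + b) 1 = Fract a 1 + Fract b 1" by simp
  then show "(a \<oplus>\<^bsub>poly_ring s\<^esub> b) \<odot>\<^bsub>rational_functions s\<^esub> x =
      a \<odot>\<^bsub>rational_functions s\<^esub> x \<oplus>\<^bsub>rational_functions s\<^esub> b \<odot>\<^bsub>rational_functions s\<^esub> x"
    by (simp only: poly_ring_simps rational_functions_simps distrib_right)
next
  fix a b :: "'k mpoly" and x
  have "Fract (a * b) 1 = Fract a 1 * Fract b 1" by simp
  then show "(a \<otimes>\<^bsub>poly_ring s\<^esub> b) \<odot>\<^bsub>rational_functions s\<^esub> x =
      a \<odot>\<^bsub>rational_functions s\<^esub> (b \<odot>\<^bsub>rational_functions s\<^esub> x)"
    by (simp only: poly_ring_simps rational_functions_simps mult.assoc)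
qed (auto simp: cring_poly_ring One_fract_def[symmetric] distrib_left)

section \<open>Clearing denominators in the tensor product\<close>

locale localization = Mo: Module.module "poly_ring s :: 'k::field mpoly ring" M
  for s :: nat and M :: "('k::field mpoly, 'b, 'y) module_scheme" (structure)
begin

sublocale tensor "poly_ring s" "rational_functions s" M
  by (intro tensor.intro module_rational_functions Mo.module_axioms)

definition denominator :: "'k mpoly \<Rightarrow> 'k mpoly fract \<Rightarrow> bool" where
  "denominator a z \<longleftrightarrow> (\<exists>p\<in>polys s. Fract a 1 * z = Fract p 1)"

text \<open>The product of \<open>a\<close> and \<open>z\<close> read back as a polynomial. The
  default 0 keeps the value in \<open>polys s\<close> for every \<open>a\<close> and
  \<open>z\<close>, so that terms built from it always lie in the module.\<close>

definition numerator :: "'k mpoly \<Rightarrow> 'k mpoly fract \<Rightarrow> 'k mpoly" where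
  "numerator a z = (if denominator a z
     then SOME p. p \<in> polys s \<and> Fract a 1 * z = Fract p 1 else 0)"

lemma numerator_spec:
  "denominator a z \<Longrightarrow> numerator a z \<in> polys s \<and> Fract a 1 * z = Fract (numerator a z) 1"
  unfolding numerator_def
  using someI_ex[of "\<lambda>p. p \<in> polys s \<and> Fract a 1 * z = Fract p 1"]
  by (auto simp: denominator_def)

lemma numerator_carrier [simp, intro]: "numerator a z \<in> polys s"
  using numerator_spec by (cases "denominator a z") (auto simp: numerator_def)

lemma numerator_eqI:
  assumes "p \<in> polys s" "Fract a 1 * z = Fract p 1"
  shows "denominator a z" "numerator a z = p"
proof -
  show d: "denominator a z" using assms unfolding denominator_def by blast
  have "Fract (numerator a z) 1 = Fract p 1" using numerator_spec[OF d] assms(2) by simp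
  then show "numerator a z = p" by (simp add: eq_fract)
qed

lemma denominator_mult:
  assumes "denominator a z" "b \<in> polys s"
  shows "denominator (b * a) z" "numerator (b * a) z = b * numerator a z"
proof -
  have "Fract (b * a) 1 * z = Fract b 1 * (Fract a 1 * z)" by (simp flip: mult.assoc)
  also have "\<dots> = Fract (b * numerator a z) 1" using numerator_spec[OF assms(1)] by simp
  finally have *: "Fract (b * a) 1 * z = Fract (b * numerator a z) 1" .
  show "denominator (b * a) z" "numerator (b * a) z = b * numerator a z"
    by (rule numerator_eqI[OF _ *], use assms(2) in simp)+
qed

lemma common_denominator:
  assumes "finite Z" "Z \<subseteq> carrier (rational_functions s)"
  obtains a where "a \<in> polys s" "a \<noteq> 0" "\<And>z. z \<in> Z \<Longrightarrow> denominator a z"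
proof -
  have "\<exists>a\<in>polys s. a \<noteq> 0 \<and> (\<forall>z\<in>Z. denominator a z)"
    using assms
  proof (induction Z rule: finite_induct)
    case empty
    then show ?case by (intro bexI[of _ 1]) auto
  next
    case (insert z Z)
    then obtain a where a: "a \<in> polys s" "a \<noteq> 0" "\<forall>z\<in>Z. denominator a z" by auto
    obtain c d where z: "z = Fract c d" "d \<noteq> 0" "c \<in> polys s" "d \<in> polys s"
      using insert.prems by (auto simp: carrier_rational_functions)
    have "Fract d 1 * z = Fract c 1" using z(1,2) by (simp add: eq_fract)
    then have "denominator d z" using z(3) by (intro numerator_eqI(1))
    then have "denominator (a * d) z" using a(1) by (rule denominator_mult)
    moreover have "denominator (a * d) w" if "w \<in> Z" for w
      using denominator_mult(1)[of a w d] a(3) that z(4) by (simp add: mult.commute)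
    ultimately show ?case using a z by (intro bexI[of _ "a * d"]) auto
  qed
  then show thesis using that by blast
qed

text \<open>For \<open>a\<close> a common denominator and \<open>B\<close> containing the support of
  \<open>v\<close>, this is \<open>a\<close> times the value of the formal sum \<open>v\<close>,
  computed inside \<open>M\<close> itself: each first component is replaced by its numerator over
  \<open>a\<close>.\<close>

definition eval_cleared :: "'k mpoly \<Rightarrow> ('k mpoly fract \<times> 'b \<Rightarrow> 'k mpoly) \<Rightarrow> ('k mpoly fract \<times> 'b)
  set \<Rightarrow> 'b" where
  "eval_cleared a v B = finsum M (\<lambda>i. (v i * numerator a (fst i)) \<odot> snd i) B"

abbreviation "pairs \<equiv> carrier (rational_functions s) \<times> carrier M"

lemma F_values: "v \<in> carrier F \<Longrightarrow> v i \<in> polys s"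
  unfolding tensor_free_def carrier_free_module by blast

lemma F_ops: "u \<oplus>\<^bsub>F\<^esub> v = (\<lambda>i. u i + v i)" "b \<odot>\<^bsub>F\<^esub> v = (\<lambda>i. b * v i)" "\<zero>\<^bsub>F\<^esub> = (\<lambda>_. 0)"
  by (simp_all add: tensor_free_def)

lemma F_minus:
  assumes "u \<in> carrier F" "v \<in> carrier F"
  shows "u \<ominus>\<^bsub>F\<^esub> v = u \<oplus>\<^bsub>F\<^esub> (- 1) \<odot>\<^bsub>F\<^esub> v"
  using F.uminus_eq_smult[OF assms(2)] by (simp add: a_minus_def)

lemma eval_cleared_term:
  assumes "v \<in> carrier F" "B \<subseteq> pairs"
  shows "(\<lambda>i. (v i * numerator a (fst i)) \<odot> snd i) \<in> B \<rightarrow> carrier M"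
  using assms F_values[OF assms(1)] by (auto intro!: Mo.smult_closed)

lemma eval_cleared_carrier: "v \<in> carrier F \<Longrightarrow> B \<subseteq> pairs \<Longrightarrow> eval_cleared a v B \<in> carrier M"
  unfolding eval_cleared_def by (intro Mo.M.finsum_closed eval_cleared_term)

lemma eval_cleared_add:
  assumes "u \<in> carrier F" "v \<in> carrier F" "B \<subseteq> pairs"
  shows "eval_cleared a (u \<oplus>\<^bsub>F\<^esub> v) B = eval_cleared a u B \<oplus> eval_cleared a v B"
proof -
  have "eval_cleared a (u \<oplus>\<^bsub>F\<^esub> v) B =
    finsum M (\<lambda>i. (u i * numerator a (fst i)) \<odot> snd i \<oplus> (v i * numerator a (fst i)) \<odot> snd i) B"
    unfolding eval_cleared_def
  proof (rule Mo.M.finsum_cong')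
    fix i assume i: "i \<in> B"
    have "((u i * numerator a (fst i)) \<oplus>\<^bsub>poly_ring s\<^esub> (v i * numerator a (fst i))) \<odot> snd i =
      (u i * numerator a (fst i)) \<odot> snd i \<oplus> (v i * numerator a (fst i)) \<odot> snd i"
      using assms i F_values by (intro Mo.smult_l_distr) auto
    then show "((u \<oplus>\<^bsub>F\<^esub> v) i * numerator a (fst i)) \<odot> snd i =
      (u i * numerator a (fst i)) \<odot> snd i \<oplus> (v i * numerator a (fst i)) \<odot> snd i"
      by (simp add: F_ops distrib_right)
  qed (use eval_cleared_term[OF assms(1,3)] eval_cleared_term[OF assms(2,3)] in \<open>auto intro!:
    Mo.M.a_closed\<close>)
  also have "\<dots> = eval_cleared a u B \<oplus> eval_cleared a v B"
    unfolding eval_cleared_def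
    by (rule Mo.M.finsum_addf[OF eval_cleared_term[OF assms(1,3)] eval_cleared_term[OF assms(2,3)]])
  finally show ?thesis .
qed

lemma eval_cleared_smult:
  assumes "v \<in> carrier F" "finite B" "B \<subseteq> pairs" "b \<in> polys s"
  shows "eval_cleared a (b \<odot>\<^bsub>F\<^esub> v) B = b \<odot> eval_cleared a v B"
proof -
  have "b \<odot> eval_cleared a v B = finsum M (\<lambda>i. b \<odot> ((v i * numerator a (fst i)) \<odot> snd i)) B"
    unfolding eval_cleared_def
    by (rule Mo.finsum_smult_ldistr[OF assms(2,4) eval_cleared_term[OF assms(1,3)]])
  also have "\<dots> = eval_cleared a (b \<odot>\<^bsub>F\<^esub> v) B"
    unfolding eval_cleared_def
  proof (rule Mo.M.finsum_cong')
    fix i assume i: "i \<in> B"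
    have "(b \<otimes>\<^bsub>poly_ring s\<^esub> (v i * numerator a (fst i))) \<odot> snd i
      = b \<odot> ((v i * numerator a (fst i)) \<odot> snd i)"
      using assms i F_values by (intro Mo.smult_assoc1) auto
    then show "b \<odot> ((v i * numerator a (fst i)) \<odot> snd i)
      = ((b \<odot>\<^bsub>F\<^esub> v) i * numerator a (fst i)) \<odot> snd i"
      by (simp add: F_ops mult.assoc)
  next
    show "(\<lambda>i. ((b \<odot>\<^bsub>F\<^esub> v) i * numerator a (fst i)) \<odot> snd i) \<in> B \<rightarrow> carrier M"
      using assms by (intro eval_cleared_term F.smult_closed)
  qed simp
  finally show ?thesis by simp
qed

lemma eval_cleared_minus:
  assumes "u \<in> carrier F" "v \<in> carrier F" "finite B" "B \<subseteq> pairs"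
  shows "eval_cleared a (u \<ominus>\<^bsub>F\<^esub> v) B = eval_cleared a u B \<ominus> eval_cleared a v B"
proof -
  have c: "eval_cleared a v B \<in> carrier M" using assms by (intro eval_cleared_carrier)
  have neg: "\<ominus> eval_cleared a v B = (- 1) \<odot> eval_cleared a v B" using Mo.uminus_eq_smult[OF c]
    by simp
  have "eval_cleared a (u \<ominus>\<^bsub>F\<^esub> v) B = eval_cleared a u B \<oplus> eval_cleared a ((- 1) \<odot>\<^bsub>F\<^esub> v) B"
    unfolding F_minus[OF assms(1,2)] using assms
    by (intro eval_cleared_add F.smult_closed) auto
  also have "eval_cleared a ((- 1) \<odot>\<^bsub>F\<^esub> v) B = (- 1) \<odot> eval_cleared a v B"
    using assms by (intro eval_cleared_smult) auto
  finally show ?thesis by (simp add: neg a_minus_def)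
qed

lemma eval_cleared_mono:
  assumes "v \<in> carrier F" "finite B'" "B \<subseteq> B'" "B' \<subseteq> pairs" "\<And>i. i \<in> B' - B \<Longrightarrow> v i = 0"
  shows "eval_cleared a v B = eval_cleared a v B'"
  unfolding eval_cleared_def
proof (rule Mo.M.add.finprod_mono_neutral_cong_left[OF assms(2,3)])
  fix i assume i: "i \<in> B' - B"
  then have "snd i \<in> carrier M" using assms(4) by auto
  then show "(v i * numerator a (fst i)) \<odot> snd i = \<zero>"
    using Mo.smult_l_null[of "snd i"] assms(5)[OF i] by simp
qed (use eval_cleared_term[OF assms(1,4)] in auto)

lemma eval_cleared_denominator_mult:
  assumes "v \<in> carrier F" "finite B" "B \<subseteq> pairs" "b \<in> polys s"
    "\<And>i. i \<in> B \<Longrightarrow> denominator a (fst i)"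
  shows "eval_cleared (b * a) v B = b \<odot> eval_cleared a v B"
proof -
  have "eval_cleared (b * a) v B = eval_cleared a (b \<odot>\<^bsub>F\<^esub> v) B"
    unfolding eval_cleared_def
  proof (rule Mo.M.finsum_cong')
    fix i assume "i \<in> B"
    then have "numerator (b * a) (fst i) = b * numerator a (fst i)"
      using assms(4,5) by (intro denominator_mult) auto
    then show "(v i * numerator (b * a) (fst i)) \<odot> snd i
      = ((b \<odot>\<^bsub>F\<^esub> v) i * numerator a (fst i)) \<odot> snd i"
      by (simp add: F_ops mult_ac)
  next
    show "(\<lambda>i. ((b \<odot>\<^bsub>F\<^esub> v) i * numerator a (fst i)) \<odot> snd i) \<in> B \<rightarrow> carrier M"
      using assms by (intro eval_cleared_term F.smult_closed)
  qed simp
  then show ?thesis using eval_cleared_smult[OF assms(1-4)] by simp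
qed

lemma eval_cleared_basis:
  assumes "i \<in> B" "finite B" "B \<subseteq> pairs"
  shows "eval_cleared a (e i) B = numerator a (fst i) \<odot> snd i"
proof -
  have ei: "e i \<in> carrier F" using assms(1,3) e_carrier[of "fst i" "snd i"] by auto
  have "eval_cleared a (e i) B = eval_cleared a (e i) {i}"
    using assms by (intro eval_cleared_mono[symmetric] ei) (auto simp: basis_vector_def)
  moreover have "numerator a (fst i) \<odot> snd i \<in> carrier M" using assms by
    (auto intro!: Mo.smult_closed)
  ultimately show ?thesis by (simp add: eval_cleared_def basis_vector_def)
qed

text \<open>The formal sums that vanish in the localization of \<open>M\<close>, witnessed by one
  common denominator. It must be nonzero, since 0 clears every fraction.\<close>

definition cleared_kernel :: "('k mpoly fract \<times> 'b \<Rightarrow> 'k mpoly) set" where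
  "cleared_kernel = {v \<in> carrier F. \<exists>a B. a \<in> polys s \<and> a \<noteq> 0 \<and> finite B \<and> B \<subseteq> pairs \<and>
     (\<forall>i. i \<notin> B \<longrightarrow> v i = 0) \<and> (\<forall>i\<in>B. denominator a (fst i)) \<and> eval_cleared a v B = \<zero>}"

text \<open>For a sum the two denominators are multiplied and the finite sets united; passing to a
  multiple of a denominator only multiplies the vanishing value by a polynomial.\<close>

lemma cleared_kernel_submodule: "submodule cleared_kernel (poly_ring s) F"
proof -
  have smult: "b \<odot>\<^bsub>F\<^esub> v \<in> cleared_kernel"
    if b: "b \<in> polys s" and v: "v \<in> cleared_kernel" for b v
  proof -
    obtain a B where *: "v \<in> carrier F" "a \<in> polys s" "a \<noteq> 0" "finite B" "B \<subseteq> pairs"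
      "\<forall>i. i \<notin> B \<longrightarrow> v i = 0" "\<forall>i\<in>B. denominator a (fst i)" "eval_cleared a v B = \<zero>"
      using v unfolding cleared_kernel_def by blast
    have "b \<odot>\<^bsub>F\<^esub> v \<in> carrier F" using b * by (intro F.smult_closed)
    moreover have "eval_cleared a (b \<odot>\<^bsub>F\<^esub> v) B = \<zero>"
      using eval_cleared_smult[OF *(1,4,5) b] *(8) Mo.smult_r_null[OF b] by simp
    moreover have "\<forall>i. i \<notin> B \<longrightarrow> (b \<odot>\<^bsub>F\<^esub> v) i = 0" using *(6) by (simp add: F_ops)
    ultimately show ?thesis using * unfolding cleared_kernel_def by blast
  qed
  show ?thesis
  proof (rule F.submodule_smultI)
    show "cleared_kernel \<subseteq> carrier F" unfolding cleared_kernel_def by blast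
    have "eval_cleared 1 \<zero>\<^bsub>F\<^esub> {} = \<zero>" by (simp add: eval_cleared_def)
    moreover have "\<zero>\<^bsub>F\<^esub> i = 0" for i by (simp add: F_ops)
    ultimately show "\<zero>\<^bsub>F\<^esub> \<in> cleared_kernel"
      unfolding cleared_kernel_def
      by (intro CollectI conjI exI[of _ 1] exI[of _ "{}"]) simp_all
  next
    fix v w assume "v \<in> cleared_kernel" "w \<in> cleared_kernel"
    then obtain a B b C where *: "v \<in> carrier F" "a \<in> polys s" "a \<noteq> 0" "finite B" "B \<subseteq> pairs"
      "\<forall>i. i \<notin> B \<longrightarrow> v i = 0" "\<forall>i\<in>B. denominator a (fst i)" "eval_cleared a v B = \<zero>"
      and **: "w \<in> carrier F" "b \<in> polys s" "b \<noteq> 0" "finite C" "C \<subseteq> pairs"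
      "\<forall>i. i \<notin> C \<longrightarrow> w i = 0" "\<forall>i\<in>C. denominator b (fst i)" "eval_cleared b w C = \<zero>"
      unfolding cleared_kernel_def by blast
    have BC: "finite (B \<union> C)" "B \<union> C \<subseteq> pairs" using * ** by auto
    have v0: "eval_cleared (b * a) v (B \<union> C) = \<zero>"
    proof -
      have "eval_cleared (b * a) v (B \<union> C) = eval_cleared (b * a) v B"
        using * BC by (intro eval_cleared_mono[symmetric]) auto
      also have "\<dots> = b \<odot> \<zero>" using eval_cleared_denominator_mult[OF *(1,4,5) **(2)] *(7,8) by simp
      finally show ?thesis using **(2) by simp
    qed
    have w0: "eval_cleared (b * a) w (B \<union> C) = \<zero>"
    proof -
      have "eval_cleared (b * a) w (B \<union> C) = eval_cleared (a * b) w C"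
        unfolding mult.commute[of b a] using ** BC by (intro eval_cleared_mono[symmetric]) auto
      also have "\<dots> = a \<odot> \<zero>" using eval_cleared_denominator_mult[OF **(1,4,5) *(2)] **(7,8) by simp
      finally show ?thesis using *(2) by simp
    qed
    have "eval_cleared (b * a) (v \<oplus>\<^bsub>F\<^esub> w) (B \<union> C) = \<zero>"
      unfolding eval_cleared_add[OF *(1) **(1) BC(2)] v0 w0 by simp
    moreover have "denominator (b * a) (fst i)" if "i \<in> B \<union> C" for i
      using that
    proof
      assume "i \<in> B"
      then show ?thesis using *(7) **(2) by (intro denominator_mult(1)) auto
    next
      assume "i \<in> C"
      then have "denominator (a * b) (fst i)" using **(7) *(2) by (intro denominator_mult(1)) auto
      then show ?thesis by (simp add: mult.commute)
    qed
    moreover have "\<forall>i. i \<notin> B \<union> C \<longrightarrow> (v \<oplus>\<^bsub>F\<^esub> w) i = 0" using *(6) **(6) by (simp add: F_ops)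
    moreover have "v \<oplus>\<^bsub>F\<^esub> w \<in> carrier F" using *(1) **(1) by (rule F.M.a_closed)
    moreover have "b * a \<in> polys s" "b * a \<noteq> 0" using * ** by auto
    ultimately show "v \<oplus>\<^bsub>F\<^esub> w \<in> cleared_kernel" using BC unfolding cleared_kernel_def by blast
  qed (rule smult)
qed

text \<open>The finitely many fractions in \<open>B\<close> have a common denominator, so it
  suffices to compute with an arbitrary one.\<close>

lemma cleared_kernelI:
  assumes "v \<in> carrier F" "finite B" "B \<subseteq> pairs" "\<And>i. i \<notin> B \<Longrightarrow> v i = 0"
    and "\<And>a. a \<in> polys s \<Longrightarrow> (\<And>i. i \<in> B \<Longrightarrow> denominator a (fst i)) \<Longrightarrow> eval_cleared a v B = \<zero>"
  shows "v \<in> cleared_kernel"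
proof -
  have "finite (fst ` B)" "fst ` B \<subseteq> carrier (rational_functions s)" using assms(2,3) by auto
  then obtain a where a: "a \<in> polys s" "a \<noteq> 0" "\<And>z. z \<in> fst ` B \<Longrightarrow> denominator a z"
    using common_denominator by blast
  then have "eval_cleared a v B = \<zero>" by (intro assms(5)) auto
  moreover have "\<forall>i\<in>B. denominator a (fst i)" using a(3) by auto
  ultimately show ?thesis using assms(1-4) a(1,2) unfolding cleared_kernel_def by blast
qed

lemma minus_apply: "u \<in> carrier F \<Longrightarrow> v \<in> carrier F \<Longrightarrow> (u \<ominus>\<^bsub>F\<^esub> v) i = u i - v i"
  by (simp add: F_minus F_ops)

lemma numerator_add:
  assumes "denominator a x" "denominator a y" shows "numerator a (x + y)
    = numerator a x + numerator a y"
proof (rule numerator_eqI(2))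
  show "Fract a 1 * (x + y) = Fract (numerator a x + numerator a y) 1"
    using numerator_spec[OF assms(1)] numerator_spec[OF assms(2)] by (simp add: distrib_left)
qed auto

lemma numerator_smult:
  assumes "denominator a x" "c \<in> polys s" shows "numerator a (Fract c 1 * x) = c * numerator a x"
proof (rule numerator_eqI(2))
  have "Fract a 1 * (Fract c 1 * x) = Fract c 1 * (Fract a 1 * x)" by (rule mult.left_commute)
  also have "\<dots> = Fract (c * numerator a x) 1" using numerator_spec[OF assms(1)] by simp
  finally show "Fract a 1 * (Fract c 1 * x) = Fract (c * numerator a x) 1" .
qed (use assms in auto)

text \<open>Every tensor relation is a basis vector minus a formal sum \<open>w\<close>; after
  clearing, only equality of two values in \<open>M\<close> has to be checked.\<close>

lemma difference_in_kernel:
  assumes p: "p \<in> B" and w: "w \<in> carrier F" "\<And>i. i \<notin> B \<Longrightarrow> w i = 0" and B: "finite B" "B \<subseteq> pairs"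
    and eq: "\<And>a. (\<And>i. i \<in> B \<Longrightarrow> denominator a (fst i)) \<Longrightarrow>
      eval_cleared a w B = numerator a (fst p) \<odot> snd p"
  shows "e p \<ominus>\<^bsub>F\<^esub> w \<in> cleared_kernel"
proof (rule cleared_kernelI[OF _ B])
  have ep: "e p \<in> carrier F" using e_carrier[of "fst p" "snd p"] p B(2) by auto
  show "e p \<ominus>\<^bsub>F\<^esub> w \<in> carrier F" using ep w(1) by (rule F.M.minus_closed)
  show "(e p \<ominus>\<^bsub>F\<^esub> w) i = 0" if "i \<notin> B" for i
    using that w(2) p minus_apply[OF ep w(1)] by (auto simp: basis_vector_def)
  fix a assume "a \<in> polys s" and den: "\<And>i. i \<in> B \<Longrightarrow> denominator a (fst i)"
  have "eval_cleared a (e p \<ominus>\<^bsub>F\<^esub> w) B = eval_cleared a w B \<ominus> eval_cleared a w B"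
    unfolding eval_cleared_minus[OF ep w(1) B] eval_cleared_basis[OF p B] using eq[OF den] by simp
  also have "\<dots> = \<zero>"
    unfolding a_minus_def by (rule Mo.M.r_neg[OF eval_cleared_carrier[OF w(1) B(2)]])
  finally show "eval_cleared a (e p \<ominus>\<^bsub>F\<^esub> w) B = \<zero>" .
qed

lemma relation3_in_kernel:
  assumes p: "p1 \<in> pairs" "p2 \<in> pairs" "p3 \<in> pairs"
    and eq: "\<And>a. denominator a (fst p1) \<Longrightarrow> denominator a (fst p2) \<Longrightarrow> denominator a (fst p3) \<Longrightarrow>
      numerator a (fst p1) \<odot> snd p1 = numerator a (fst p2) \<odot> snd p2 \<oplus> numerator a (fst p3) \<odot> snd p3"
  shows "e p1 \<ominus>\<^bsub>F\<^esub> (e p2 \<oplus>\<^bsub>F\<^esub> e p3) \<in> cleared_kernel"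
proof (rule difference_in_kernel[of _ "{p1, p2, p3}"])
  have eF: "e p2 \<in> carrier F" "e p3 \<in> carrier F" using p e_carrier by auto
  have B: "finite {p1, p2, p3}" "{p1, p2, p3} \<subseteq> pairs" using p by auto
  then show "finite {p1, p2, p3}" "{p1, p2, p3} \<subseteq> pairs" .
  show "e p2 \<oplus>\<^bsub>F\<^esub> e p3 \<in> carrier F" using eF by (rule F.M.a_closed)
  fix a assume "\<And>i. i \<in> {p1, p2, p3} \<Longrightarrow> denominator a (fst i)"
  then show "eval_cleared a (e p2 \<oplus>\<^bsub>F\<^esub> e p3) {p1, p2, p3} = numerator a (fst p1) \<odot> snd p1"
    unfolding eval_cleared_add[OF eF B(2)] using eval_cleared_basis[OF _ B] eq[of a] by simp
qed (auto simp: F_ops basis_vector_def)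

lemma relation2_in_kernel:
  assumes p: "p1 \<in> pairs" "p2 \<in> pairs" and c: "c \<in> polys s"
    and eq: "\<And>a. denominator a (fst p1) \<Longrightarrow> denominator a (fst p2) \<Longrightarrow>
      numerator a (fst p1) \<odot> snd p1 = c \<odot> (numerator a (fst p2) \<odot> snd p2)"
  shows "e p1 \<ominus>\<^bsub>F\<^esub> (c \<odot>\<^bsub>F\<^esub> e p2) \<in> cleared_kernel"
proof (rule difference_in_kernel[of _ "{p1, p2}"])
  have eF: "e p2 \<in> carrier F" using p e_carrier by auto
  have B: "finite {p1, p2}" "{p1, p2} \<subseteq> pairs" using p by auto
  then show "finite {p1, p2}" "{p1, p2} \<subseteq> pairs" .
  show "c \<odot>\<^bsub>F\<^esub> e p2 \<in> carrier F" using c eF by (rule F.smult_closed)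
  fix a assume "\<And>i. i \<in> {p1, p2} \<Longrightarrow> denominator a (fst i)"
  then show "eval_cleared a (c \<odot>\<^bsub>F\<^esub> e p2) {p1, p2} = numerator a (fst p1) \<odot> snd p1"
    unfolding eval_cleared_smult[OF eF B c] using eval_cleared_basis[OF _ B] eq[of a] by simp
qed (auto simp: F_ops basis_vector_def)

text \<open>Each of the four families of relations becomes an identity in \<open>M\<close> after
  clearing denominators. Thus \<open>cleared_kernel\<close> can show that a tensor is
  nonzero.\<close>

lemma tensor_relations_subset_kernel: "tensor_relations (poly_ring s) (rational_functions s) M \<subseteq>
  cleared_kernel"
  unfolding tensor_relations_eq
proof (rule generated_submodule_least[OF cleared_kernel_submodule])
  note Q_add = abelian_monoid.a_closed[OF abelian_group.axioms(1)[OF Module.module.axioms(2)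
        [OF module_rational_functions]]]
  note Q_smult = Module.module.smult_closed[OF module_rational_functions]
  have 1: "e (x + x', y) \<ominus>\<^bsub>F\<^esub> (e (x, y) \<oplus>\<^bsub>F\<^esub> e (x', y)) \<in> cleared_kernel"
    if "x \<in> carrier (rational_functions s)" "x' \<in> carrier (rational_functions s)" "y \<in> carrier M"
      for x x' y
  proof (rule relation3_in_kernel)
    show "(x + x', y) \<in> pairs" using that Q_add[of x s x'] by simp
    fix a assume "denominator a (fst (x, y))" "denominator a (fst (x', y))"
    then have "numerator a (x + x') = numerator a x \<oplus>\<^bsub>poly_ring s\<^esub> numerator a x'"
      by (simp add: numerator_add)
    then show "numerator a (fst (x + x', y)) \<odot> snd (x + x', y) =
      numerator a (fst (x, y)) \<odot> snd (x, y) \<oplus> numerator a (fst (x', y)) \<odot> snd (x', y)"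
      using Mo.smult_l_distr[of "numerator a x" "numerator a x'" y] that(3) by simp
  qed (use that in auto)
  have 2: "e (x, y \<oplus> y') \<ominus>\<^bsub>F\<^esub> (e (x, y) \<oplus>\<^bsub>F\<^esub> e (x, y')) \<in> cleared_kernel"
    if "x \<in> carrier (rational_functions s)" "y \<in> carrier M" "y' \<in> carrier M" for x y y'
    using that by (intro relation3_in_kernel) (auto simp: Mo.smult_r_distr)
  have 3: "e (Fract c 1 * x, y) \<ominus>\<^bsub>F\<^esub> (c \<odot>\<^bsub>F\<^esub> e (x, y)) \<in> cleared_kernel"
    if "c \<in> polys s" "x \<in> carrier (rational_functions s)" "y \<in> carrier M" for c x y
  proof (rule relation2_in_kernel)
    show "(Fract c 1 * x, y) \<in> pairs" using that Q_smult[of c s x] by simp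
    fix a assume "denominator a (fst (x, y))"
    then have "numerator a (Fract c 1 * x) = c \<otimes>\<^bsub>poly_ring s\<^esub> numerator a x"
      using that(1) by (simp add: numerator_smult)
    then show "numerator a (fst (Fract c 1 * x, y)) \<odot> snd (Fract c 1 * x, y) =
      c \<odot> (numerator a (fst (x, y)) \<odot> snd (x, y))"
      using Mo.smult_assoc1[of c "numerator a x" y] that by simp
  qed (use that in auto)
  have 4: "e (x, c \<odot> y) \<ominus>\<^bsub>F\<^esub> (c \<odot>\<^bsub>F\<^esub> e (x, y)) \<in> cleared_kernel"
    if "c \<in> polys s" "x \<in> carrier (rational_functions s)" "y \<in> carrier M" for c x y
  proof (rule relation2_in_kernel)
    fix a
    show "numerator a (fst (x, c \<odot> y)) \<odot> snd (x, c \<odot> y)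
      = c \<odot> (numerator a (fst (x, y)) \<odot> snd (x, y))"
      using Mo.smult_assoc1[of c "numerator a x" y] Mo.smult_assoc1[of "numerator a x" c y] that
      by (simp add: mult.commute)
  qed (use that in auto)
  show "tensor_relation_set (poly_ring s) (rational_functions s) M \<subseteq> cleared_kernel"
    unfolding tensor_relation_set_def Let_def rational_functions_simps
    by (intro Un_least subsetI; elim CollectE exE conjE; hypsubst; (rule 1 | rule 2 | rule 3 |
      rule 4); assumption)
qed

text \<open>If the tensor of 1 and \<open>x\<close> vanishes, clearing with some nonzero
  \<open>a\<close> shows that \<open>a\<close> kills \<open>x\<close>, since the numerator of 1 over
  \<open>a\<close> is \<open>a\<close>. Conversely 1 is \<open>a\<close> times 1/a, and
  \<open>a\<close> moves across the tensor sign.\<close>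

lemma localization_map_eq_zero_iff:
  assumes x: "x \<in> carrier M"
  shows "localization_map s M x = \<zero>\<^bsub>partial_localization s M\<^esub> \<longleftrightarrow>
    (\<exists>a\<in>polys s. a \<noteq> 0 \<and> a \<odot> x = \<zero>)"
proof
  assume "localization_map s M x = \<zero>\<^bsub>partial_localization s M\<^esub>"
  then have "e (1, x) \<in> tensor_relations (poly_ring s) (rational_functions s) M"
    using pure_tensor_eq_zero_iff[OF one_in_rational_functions x]
    by (simp add: localization_map_def partial_localization_def)
  then have "e (1, x) \<in> cleared_kernel" using tensor_relations_subset_kernel by blast
  then obtain a B where *: "a \<in> polys s" "a \<noteq> 0" "finite B" "B \<subseteq> pairs"
      "\<forall>i. i \<notin> B \<longrightarrow> e (1, x) i = 0" "eval_cleared a (e (1, x)) B = \<zero>"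
    unfolding cleared_kernel_def by blast
  \<comment> \<open>The coefficient at (1, x) is 1, so this pair must belong to
    \<open>B\<close>.\<close>
  have "e (1, x) (1, x) = 1" by (simp add: basis_vector_def)
  then have "(1, x) \<in> B" using *(5) by (metis zero_neq_one)
  then have "numerator a 1 \<odot> x = \<zero>" using eval_cleared_basis[of "(1, x)" B a] * by simp
  moreover have "numerator a 1 = a" using *(1) by (intro numerator_eqI(2)) auto
  ultimately show "\<exists>a\<in>polys s. a \<noteq> 0 \<and> a \<odot> x = \<zero>" using * by auto
next
  assume "\<exists>a\<in>polys s. a \<noteq> 0 \<and> a \<odot> x = \<zero>"
  then obtain a where a: "a \<in> polys s" "a \<noteq> 0" "a \<odot> x = \<zero>" by blast
  have inv: "Fract 1 a \<in> carrier (rational_functions s)" using a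
    by (intro Fract_in_rational_functions) auto
  have "1 = a \<odot>\<^bsub>rational_functions s\<^esub> Fract 1 a"
    using a(2) by (simp add: One_fract_def eq_fract)
  then have "pt 1 x = pt (a \<odot>\<^bsub>rational_functions s\<^esub> Fract 1 a) x" by simp
  also have "\<dots> = a \<odot>\<^bsub>T\<^esub> pt (Fract 1 a) x" by (rule pure_tensor_smult_left[OF inv x a(1)])
  also have "\<dots> = pt (Fract 1 a) (a \<odot> x)" by (rule pure_tensor_smult_right[OF inv x a(1), symmetric])
  also have "\<dots> = \<zero>\<^bsub>T\<^esub>" using pure_tensor_zero_right[OF inv] a(3) by simp
  finally show "localization_map s M x = \<zero>\<^bsub>partial_localization s M\<^esub>"
    by (simp add: localization_map_def partial_localization_def)
qed

lemma localization_map_module_map: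
  "localization_map s M \<in> module_maps (poly_ring s) M (partial_localization s M)"
  unfolding module_maps_def localization_map_def partial_localization_def
  by (auto simp: pure_tensor_carrier pure_tensor_add_right pure_tensor_smult_right)

lemma module_partial_localization: "Module.module (poly_ring s) (partial_localization s M)"
  unfolding partial_localization_def by (rule tensor_product_module)

end

section \<open>Torsion submodules of involutive systems\<close>

locale involutive_module = involutive_system +
  fixes r :: nat
  assumes codim: "codim n (system_module n m S) = enat r"
begin

abbreviation "M \<equiv> system_module n m S"

lemma N_submodule_le: "s \<le> n \<Longrightarrow> submodule N (poly_ring s) (jet_space n m)"
  using N_closed(1-3) N_closed(4)[OF poly_ring_mono] by (simp add: submodule_jet_space_iff)

lemma module_quotient_le: "s \<le> n \<Longrightarrow> module_quotient (poly_ring s) (jet_space n m) N"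
  by (intro module_quotient.intro module_quotient_axioms.intro module_jet_space N_submodule_le)

sublocale Qn: module_quotient "poly_ring n" "jet_space n m" N
  by (rule module_quotient_le) simp

lemma M_eq: "M = quotient_module (jet_space n m) N"
  by (rule system_module_def)

lemma module_M: "s \<le> n \<Longrightarrow> Module.module (poly_ring s) M"
  unfolding M_eq by (intro module_quotient.quotient_is_module module_quotient_le)

abbreviation coset :: "'a equation \<Rightarrow> 'a equation set" where
  "coset v \<equiv> N +>\<^bsub>jet_space n m\<^esub> v"

lemma M_elim:
  assumes "X \<in> carrier M"
  obtains v where "v \<in> jet_eqns n m" "X = coset v"
  using assms Qn.quotient_carrierE unfolding M_eq by blast

lemma coset_carrier: "v \<in> jet_eqns n m \<Longrightarrow> coset v \<in> carrier M"
  by (simp add: M_eq)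

lemma zero_M: "\<zero>\<^bsub>M\<^esub> = N"
  by (simp add: M_eq)

lemma coset_zero_iff: "v \<in> jet_eqns n m \<Longrightarrow> coset v = \<zero>\<^bsub>M\<^esub> \<longleftrightarrow> v \<in> N"
  by (simp add: zero_M Qn.coset_eq_N_iff)

lemma smult_coset:
  "a \<in> polys n \<Longrightarrow> v \<in> jet_eqns n m \<Longrightarrow> a \<odot>\<^bsub>M\<^esub> coset v = coset (eqn_scale a v)"
  using Qn.quotient_smult by (simp add: M_eq)

lemma smult_coset_zero_iff:
  "a \<in> polys n \<Longrightarrow> v \<in> jet_eqns n m \<Longrightarrow>
    a \<odot>\<^bsub>M\<^esub> coset v = \<zero>\<^bsub>M\<^esub> \<longleftrightarrow> eqn_scale a v \<in> N"
  by (simp add: smult_coset coset_zero_iff jet_space_scale)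

text \<open>Finite codimension excludes the zero module, whose codimension is infinite by
  convention.\<close>

lemma nonzero_element: obtains v where "v \<in> jet_eqns n m" "v \<notin> N"
proof -
  have "carrier M \<noteq> {\<zero>\<^bsub>M\<^esub>}" using codim by (auto simp: codim_def)
  moreover have "\<zero>\<^bsub>M\<^esub> \<in> carrier M"
    using coset_carrier[OF jet_space_zero] coset_zero_iff[OF jet_space_zero] N_closed(2) by simp
  ultimately obtain X where X: "X \<in> carrier M" "X \<noteq> \<zero>\<^bsub>M\<^esub>" by blast
  obtain v where "v \<in> jet_eqns n m" "X = coset v" using M_elim[OF X(1)] .
  then show thesis using that[of v] X(2) coset_zero_iff by blast
qed

lemma annihilator_M_trivial:
  assumes "a \<in> polys num_params" "\<And>v. v \<in> jet_eqns n m \<Longrightarrow> eqn_scale a v \<in> N"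
  shows "a = 0"
proof -
  obtain v where "v \<in> jet_eqns n m" "v \<notin> N" by (rule nonzero_element)
  then show ?thesis using ann_num_params_trivial assms by blast
qed

lemma annihilator_M:
  "annihilator (poly_ring n) M = {a \<in> polys n. \<forall>v\<in>jet_eqns n m. eqn_scale a v \<in> N}"
proof -
  have "(\<forall>X\<in>carrier M. a \<odot>\<^bsub>M\<^esub> X = \<zero>\<^bsub>M\<^esub>) \<longleftrightarrow> (\<forall>v\<in>jet_eqns n m. eqn_scale a v \<in> N)"
    if "a \<in> polys n" for a
  proof
    assume "\<forall>X\<in>carrier M. a \<odot>\<^bsub>M\<^esub> X = \<zero>\<^bsub>M\<^esub>"
    then show "\<forall>v\<in>jet_eqns n m. eqn_scale a v \<in> N"
      using smult_coset_zero_iff[OF that] coset_carrier by blast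
  next
    assume *: "\<forall>v\<in>jet_eqns n m. eqn_scale a v \<in> N"
    show "\<forall>X\<in>carrier M. a \<odot>\<^bsub>M\<^esub> X = \<zero>\<^bsub>M\<^esub>"
    proof
      fix X assume "X \<in> carrier M"
      then obtain v where "v \<in> jet_eqns n m" "X = coset v" by (rule M_elim)
      then show "a \<odot>\<^bsub>M\<^esub> X = \<zero>\<^bsub>M\<^esub>" using * smult_coset_zero_iff[OF that] by simp
    qed
  qed
  then show ?thesis unfolding annihilator_def by blast
qed

text \<open>By commutativity an element that kills the generator kills all its multiples.\<close>

lemma annihilator_cyclic:
  assumes v: "v \<in> jet_eqns n m"
  shows "annihilator (poly_ring n) (M\<lparr>carrier := cyclic_submodule (poly_ring n) M (coset v)\<rparr>) =
    {a \<in> polys n. eqn_scale a v \<in> N}"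
proof -
  have "(\<forall>X\<in>cyclic_submodule (poly_ring n) M (coset v). a \<odot>\<^bsub>M\<^esub> X = \<zero>\<^bsub>M\<^esub>) \<longleftrightarrow> eqn_scale a v \<in> N"
    if a: "a \<in> polys n" for a
  proof
    assume kill: "\<forall>X\<in>cyclic_submodule (poly_ring n) M (coset v). a \<odot>\<^bsub>M\<^esub> X = \<zero>\<^bsub>M\<^esub>"
    have "1 \<odot>\<^bsub>M\<^esub> coset v = coset v" using smult_coset[OF poly_ring_one v] by simp
    then have "coset v \<in> cyclic_submodule (poly_ring n) M (coset v)"
      unfolding cyclic_submodule_def by (metis (mono_tags, lifting) mem_Collect_eq poly_ring_one)
    then show "eqn_scale a v \<in> N" using kill smult_coset_zero_iff[OF a v] by simp
  next
    assume av: "eqn_scale a v \<in> N"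
    show "\<forall>X\<in>cyclic_submodule (poly_ring n) M (coset v). a \<odot>\<^bsub>M\<^esub> X = \<zero>\<^bsub>M\<^esub>"
    proof
      fix X assume "X \<in> cyclic_submodule (poly_ring n) M (coset v)"
      then obtain b where b: "b \<in> polys n" "X = b \<odot>\<^bsub>M\<^esub> coset v"
        unfolding cyclic_submodule_def by blast
      have X: "X = coset (eqn_scale b v)" using b v by (simp add: smult_coset)
      have "eqn_scale a (eqn_scale b v) = eqn_scale b (eqn_scale a v)" by (simp add: mult.commute)
      also have "\<dots> \<in> N" using b(1) av by (rule N_closed(4))
      finally show "a \<odot>\<^bsub>M\<^esub> X = \<zero>\<^bsub>M\<^esub>"
        unfolding X using smult_coset_zero_iff[OF a jet_space_scale[OF b(1) v]] by simp
    qed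
  qed
  then show ?thesis unfolding annihilator_def by auto
qed

definition torsion_elements :: "'a equation set set" where
  "torsion_elements = {X \<in> carrier M. \<exists>a\<in>polys num_params. a \<noteq> 0 \<and> a \<odot>\<^bsub>M\<^esub> X = \<zero>\<^bsub>M\<^esub>}"

text \<open>The two claims share one proof because codimension can be compared with torsion only
  once r is known to be n - t.\<close>

lemma dimension_and_torsion: "n - r = num_params" "torsion n r M = torsion_elements"
proof -
  obtain g e where fg: "fg_module eqn_scale n num_params N g e"
    and span: "\<And>v. v \<in> jet_eqns n m \<Longrightarrow> \<exists>c. (\<forall>b<g. c b \<in> polys num_params) \<and>
      v - (\<Sum>b<g. eqn_scale (c b) (e b)) \<in> N"
    and e: "\<And>b. b < g \<Longrightarrow> e b \<in> jet_eqns n m"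
    using exists_fg_module by blast
  interpret fg: fg_module eqn_scale n num_params N g e by (rule fg)
  have box: "\<exists>d. v \<in> fg.span_box d" if "v \<in> jet_eqns n m" for v
    using span[OF that] fg.span_boxI by blast
  have dim_M: "krull_dim (poly_ring n Quot annihilator (poly_ring n) M) = enat num_params"
  proof -
    \<comment> \<open>The dimension results want a finite set, so the annihilator of the module is
      expressed by generators.\<close>
    have "fg.ann (jet_eqns n m) = fg.ann (e ` {..<g})"
      using fg.ann_generators_subset[OF box] e by (auto simp: fg.ann_def)
    then have ann: "annihilator (poly_ring n) M = fg.ann (e ` {..<g})"
      unfolding annihilator_M fg.ann_def by simp
    have "fg.ann (e ` {..<g}) \<inter> polys num_params = {0}"
    proof -
      have "a = 0" if "a \<in> fg.ann (e ` {..<g})" "a \<in> polys num_params" for a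
        using that annihilator_M_trivial[of a] unfolding ann[symmetric] annihilator_M by blast
      moreover have "0 \<in> fg.ann (e ` {..<g})" using ideal_poly_ring_closed(2)[OF fg.ideal_ann] .
      ultimately show ?thesis by auto
    qed
    then show ?thesis
      unfolding ann using e box by (intro fg.krull_dim_quotient_ann_eq) auto
  qed
  have "carrier M \<noteq> {\<zero>\<^bsub>M\<^esub>}" using codim by (auto simp: codim_def)
  then have "enat n - enat num_params = enat r"
    using codim dim_M by (simp add: codim_def)
  then have r: "r = n - num_params" by simp
  then show "n - r = num_params" using num_params_le by simp
  have "codim n (M\<lparr>carrier := cyclic_submodule (poly_ring n) M X\<rparr>) > enat r \<longleftrightarrow>
      (\<exists>a\<in>polys num_params. a \<noteq> 0 \<and> a \<odot>\<^bsub>M\<^esub> X = \<zero>\<^bsub>M\<^esub>)" (is "?l \<longleftrightarrow> ?r")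
    if Xc: "X \<in> carrier M" for X
  proof -
    obtain v where v: "v \<in> jet_eqns n m" "X = coset v" using M_elim[OF Xc] .
    have one: "1 \<odot>\<^bsub>M\<^esub> X = X" using smult_coset[OF poly_ring_one v(1)] v(2) by simp
    have ann: "annihilator (poly_ring n) (M\<lparr>carrier := cyclic_submodule (poly_ring n) M X\<rparr>)
      = fg.ann {v}"
      unfolding v(2) annihilator_cyclic[OF v(1)] fg.ann_def by simp
    have kill: "a \<odot>\<^bsub>M\<^esub> X = \<zero>\<^bsub>M\<^esub> \<longleftrightarrow> a \<in> fg.ann {v}" if "a \<in> polys n" for a
      using smult_coset_zero_iff[OF that v(1)] that by (simp add: v(2) fg.ann_def)
    show ?thesis
    \<comment> \<open>The zero element is separate: its cyclic module has infinite codimension by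
      convention, and it is killed by 1.\<close>
    proof (cases "v \<in> N")
      case True
      then have X: "X = \<zero>\<^bsub>M\<^esub>" using coset_zero_iff[OF v(1)] v(2) by simp
      have zero: "a \<odot>\<^bsub>M\<^esub> X = \<zero>\<^bsub>M\<^esub>" if "a \<in> polys n" for a
        using smult_coset_zero_iff[OF that v(1)] N_closed(4)[OF that True] v(2) by simp
      then have "cyclic_submodule (poly_ring n) M X = {\<zero>\<^bsub>M\<^esub>}"
        unfolding cyclic_submodule_def by (auto intro: exI[of _ 0])
      then have ?l by (simp add: codim_def)
      moreover have ?r using zero[of 1] by (intro bexI[of _ 1]) auto
      ultimately show ?thesis by blast
    next
      case False
      then have "X \<noteq> \<zero>\<^bsub>M\<^esub>" using coset_zero_iff[OF v(1)] v(2) by simp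
      moreover have "X \<in> cyclic_submodule (poly_ring n) M X"
        unfolding cyclic_submodule_def using one
          by (metis (mono_tags, lifting) mem_Collect_eq poly_ring_one)
      ultimately have codim_X: "codim n (M\<lparr>carrier := cyclic_submodule (poly_ring n) M X\<rparr>) =
          enat n - krull_dim (poly_ring n Quot fg.ann {v})"
        unfolding codim_def ann by auto
      have Z: "finite {v}" "\<And>z. z \<in> {v} \<Longrightarrow> \<exists>d. z \<in> fg.span_box d" using box v(1) by auto
      show ?thesis
      proof (cases ?r)
        case True
        then obtain a where a: "a \<in> polys num_params" "a \<noteq> 0" "a \<in> fg.ann {v}"
          using kill poly_ring_num_params by blast
        have "1 \<notin> fg.ann {v}" using False by (simp add: fg.ann_def)
        then have less: "krull_dim (poly_ring n Quot fg.ann {v}) < enat num_params"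
          using fg.krull_dim_quotient_ann_less[OF Z a(3,1,2)] by simp
        then obtain k where k: "krull_dim (poly_ring n Quot fg.ann {v}) = enat k" "k < num_params"
          by (metis enat_iless enat_ord_simps(2))
        then have "codim n (M\<lparr>carrier := cyclic_submodule (poly_ring n) M X\<rparr>) = enat (n - k)"
          by (simp add: codim_X)
        moreover have "r < n - k" using k(2) num_params_le r by linarith
        ultimately show ?thesis using True by simp
      next
        case no: False
        have "fg.ann {v} \<inter> polys num_params = {0}"
        proof -
          have "a = 0" if "a \<in> fg.ann {v}" "a \<in> polys num_params" for a
            using no kill[OF poly_ring_num_params[OF that(2)]] that by blast
          moreover have "0 \<in> fg.ann {v}" using ideal_poly_ring_closed(2)[OF fg.ideal_ann] .
          ultimately show ?thesis by auto
        qed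
        then have "krull_dim (poly_ring n Quot fg.ann {v}) = enat num_params"
          using fg.krull_dim_quotient_ann_eq[OF Z] by simp
        then show ?thesis using no codim_X r by simp
      qed
    qed
  qed
  then show "torsion n r M = torsion_elements"
    unfolding torsion_def torsion_elements_def by blast
qed

text \<open>Two rings occur: \<open>s = n\<close> makes t_r(M) a submodule over D,
  \<open>s = t\<close> makes it a term of the exact sequence. For sums the annihilating polynomials
  are multiplied, and the product is nonzero in a domain.\<close>

lemma torsion_elements_submodule:
  assumes "num_params \<le> s" "s \<le> n"
  shows "submodule torsion_elements (poly_ring s) M"
proof -
  interpret Ms: Module.module "poly_ring s" M using assms(2) by (rule module_M)
  have up: "a \<in> polys s" if "a \<in> polys num_params" for a
    using assms(1) that by (rule poly_ring_mono)
  have smult: "b \<odot>\<^bsub>M\<^esub> X \<in> torsion_elements" if b: "b \<in> polys s" and X: "X \<in> torsion_elements"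
    for b X
  proof -
    obtain a where a: "a \<in> polys num_params" "a \<noteq> 0" "a \<odot>\<^bsub>M\<^esub> X = \<zero>\<^bsub>M\<^esub>" and Xc: "X \<in> carrier M"
      using X unfolding torsion_elements_def by blast
    have "a \<odot>\<^bsub>M\<^esub> (b \<odot>\<^bsub>M\<^esub> X) = b \<odot>\<^bsub>M\<^esub> (a \<odot>\<^bsub>M\<^esub> X)"
      using Ms.smult_assoc1[OF up[OF a(1)] b Xc] Ms.smult_assoc1[OF b up[OF a(1)] Xc]
      by (simp add: mult.commute)
    then have "a \<odot>\<^bsub>M\<^esub> (b \<odot>\<^bsub>M\<^esub> X) = \<zero>\<^bsub>M\<^esub>" using a(3) b by simp
    then show ?thesis using a b Xc unfolding torsion_elements_def by blast
  qed
  show ?thesis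
  proof (rule Ms.submodule_smultI)
    show "torsion_elements \<subseteq> carrier M" unfolding torsion_elements_def by blast
    have "1 \<odot>\<^bsub>M\<^esub> \<zero>\<^bsub>M\<^esub> = \<zero>\<^bsub>M\<^esub>" by (rule Ms.smult_r_null) simp
    then show "\<zero>\<^bsub>M\<^esub> \<in> torsion_elements"
      unfolding torsion_elements_def by (intro CollectI conjI bexI[of _ 1]) auto
  next
    fix X Y assume "X \<in> torsion_elements" "Y \<in> torsion_elements"
    then obtain a b where a: "a \<in> polys num_params" "a \<noteq> 0" "a \<odot>\<^bsub>M\<^esub> X = \<zero>\<^bsub>M\<^esub>" "X \<in> carrier M"
      and b: "b \<in> polys num_params" "b \<noteq> 0" "b \<odot>\<^bsub>M\<^esub> Y = \<zero>\<^bsub>M\<^esub>" "Y \<in> carrier M"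
      unfolding torsion_elements_def by blast
    have "(b * a) \<odot>\<^bsub>M\<^esub> X = b \<odot>\<^bsub>M\<^esub> (a \<odot>\<^bsub>M\<^esub> X)" "(a * b) \<odot>\<^bsub>M\<^esub> Y = a \<odot>\<^bsub>M\<^esub> (b \<odot>\<^bsub>M\<^esub> Y)"
      using Ms.smult_assoc1[OF up[OF b(1)] up[OF a(1)] a(4)]
        Ms.smult_assoc1[OF up[OF a(1)] up[OF b(1)] b(4)] by simp_all
    then have "(b * a) \<odot>\<^bsub>M\<^esub> X = \<zero>\<^bsub>M\<^esub>" "(b * a) \<odot>\<^bsub>M\<^esub> Y = \<zero>\<^bsub>M\<^esub>"
      using a(3) b(3) Ms.smult_r_null[OF up[OF a(1)]] Ms.smult_r_null[OF up[OF b(1)]]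
      by (simp_all add: mult.commute[of b a])
    then have "(b * a) \<odot>\<^bsub>M\<^esub> (X \<oplus>\<^bsub>M\<^esub> Y) = \<zero>\<^bsub>M\<^esub>"
      using Ms.smult_r_distr[OF poly_ring_mult[OF up[OF b(1)] up[OF a(1)]] a(4) b(4)] by simp
    moreover have "b * a \<in> polys num_params" "b * a \<noteq> 0" using a b by auto
    moreover have "X \<oplus>\<^bsub>M\<^esub> Y \<in> carrier M" using a(4) b(4) by (rule Ms.M.a_closed)
    ultimately show "X \<oplus>\<^bsub>M\<^esub> Y \<in> torsion_elements" unfolding torsion_elements_def by blast
  qed (rule smult)
qed

text \<open>Exactness at M holds because the kernel of the localization map is described by the very
  condition that defines \<open>torsion_elements\<close>.\<close>

lemma left_exact_localization:
  "left_exact (poly_ring num_params) (M\<lparr>carrier := torsion_elements\<rparr>) (\<lambda>x. x)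
    M (localization_map num_params M) (partial_localization num_params M)"
proof -
  interpret Lo: localization num_params M
    by (rule localization.intro) (rule module_M[OF num_params_le])
  have sub: "submodule torsion_elements (poly_ring num_params) M"
    by (rule torsion_elements_submodule[OF order_refl num_params_le])
  have TM: "torsion_elements \<subseteq> carrier M" unfolding torsion_elements_def by blast
  have zero: "\<zero>\<^bsub>M\<^esub> \<in> torsion_elements"
    using subgroup.one_closed[OF submodule.axioms(1)[OF sub]] by simp
  show ?thesis
    unfolding left_exact_def
  proof (intro conjI)
    show "Module.module (poly_ring num_params) (M\<lparr>carrier := torsion_elements\<rparr>)"
      by (rule submodule.submodule_is_module[OF sub Lo.Mo.module_axioms])
    show "Module.module (poly_ring num_params) M" by (rule Lo.Mo.module_axioms)
    show "Module.module (poly_ring num_params) (partial_localization num_params M)"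
      by (rule Lo.module_partial_localization)
    show "(\<lambda>x. x) \<in> module_maps (poly_ring num_params) (M\<lparr>carrier := torsion_elements\<rparr>) M"
      using TM by (auto simp: module_maps_def)
    show "localization_map num_params M \<in> module_maps (poly_ring num_params) M
      (partial_localization num_params M)"
      by (rule Lo.localization_map_module_map)
    show "a_kernel (M\<lparr>carrier := torsion_elements\<rparr>) M (\<lambda>x. x) = {\<zero>\<^bsub>M\<lparr>carrier := torsion_elements\<rparr>\<^esub>}"
      using zero by (auto simp: a_kernel_def')
    show "(\<lambda>x. x) ` carrier (M\<lparr>carrier := torsion_elements\<rparr>) =
        a_kernel M (partial_localization num_params M) (localization_map num_params M)"
      using Lo.localization_map_eq_zero_iff by (auto simp: a_kernel_def' torsion_elements_def)
  qed
qed

end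

theorem theorem3p8:
  fixes n m q r :: nat
    and S :: "'k::field_char_0 equation set"
    and ld :: "'k equation \<Rightarrow> jet"
  defines "M \<equiv> system_module n m S"
  assumes "linear_system n m q S"
    and "solved_form n m q S ld"
    and "involutive n m q S ld"
    and "codim n M = enat r"
  shows "submodule (torsion n r M) (poly_ring n) M \<and>
    left_exact (poly_ring (n - r))
      (M\<lparr>carrier := torsion n r M\<rparr>) (\<lambda>x. x)
      M (localization_map (n - r) M)
      (partial_localization (n - r) M)"
proof -
  interpret involutive_module n m q S ld r
    using assms(2-5) unfolding M_def by unfold_locales
  show ?thesis
    \<comment> \<open>Rewriting n - r to t and t_r(M) to the torsion over k[d_1,...,d_t] leaves the
      two preceding results.\<close>
    unfolding M_def dimension_and_torsion
    using torsion_elements_submodule[OF num_params_le order_refl] left_exact_localization by blast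
qed

end
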